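(* Let $\mathbb{K}$ be a field, let $G$ be a finite simple graph, and let $R$ be the polynomial ring over $\mathbb{K}$ whose variables are the vertices of $G$. Then subadditivity holds for $G$, i.e. $t_{a+b}(G)\le t_a(G)+t_b(G)$ for all $a,b\ge0$ with $a+b\le\operatorname{pd}(R/I(G))$, in each of the following cases: (1) $G=W_n=x*C_n$ is the wheel graph on $n+1$ vertices ($n\geq 3$); (2) $G=J_{2,n}=x*_U C_{2n}$ is the Jahangir graph on $2n+1$ vertices ($n\ge 2$), where $U$ is a vertex cover of $C_{2n}$ of size $n$; (3) $G$ is a complete multipartite graph; (4) $G=F_{m,n}=x_1*_U(\cdots *_U(x_m*_U P_n))$ with $U=V(P_n)$ is a fan graph ($m\ge 1$, $n\ge 2$).
   Context: The edge ideal of a graph $G$ is $I(G)=(uv : \{u,v\}\in E(G))\subset R$ (vertices identified with variables), and $t_i(G)=\sup\{j:\beta_{i,j}^R(R/I(G))\neq 0\}$, with $\beta_{i,j}^R$ the graded Betti numbers over the standard graded ring $R$ and $\sup\emptyset=-\infty$. For a graph $H$, a subset $U\subseteq V(H)$ and a new vertex $x$, the cone $x*_U H$ of $H$ along $U$ is the graph with vertex set $V(H)\cup\{x\}$ and edge set $E(H)\cup\{\{x,u\}:u\in U\}$; $x*H$ means $x*_{V(H)}H$. A vertex cover of $H$ is a subset of $V(H)$ meeting every edge. $C_n$ is the cycle on $n$ vertices and $P_n$ is the path on $n$ vertices. In (4), $x_1,\dots,x_m$ are distinct new vertices, each joined exactly to the vertices of $P_n$. *)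

theory Defs
  imports
    "HOL-Library.Poly_Mapping"
    "HOL-Library.Extended_Real"
    "HOL-Library.Disjoint_Sets"
    "Jordan_Normal_Form.Matrix"
begin

type_synonym ('v, 'k) mpoly = "('v \<Rightarrow>\<^sub>0 nat) \<Rightarrow>\<^sub>0 'k"

definition mono_degree :: "('v \<Rightarrow>\<^sub>0 nat) \<Rightarrow> nat" where
  "mono_degree m = (\<Sum>v\<in>Poly_Mapping.keys m. Poly_Mapping.lookup m v)"

text \<open>The polynomial ring whose variables are exactly the elements of \<open>V\<close>.\<close>

definition polys :: "'v set \<Rightarrow> ('v, 'k::field) mpoly set" where
  "polys V = {p. \<forall>m\<in>Poly_Mapping.keys p. Poly_Mapping.keys m \<subseteq> V}"

definition pvar :: "'v \<Rightarrow> ('v, 'k::field) mpoly" where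
  "pvar v = Poly_Mapping.single (Poly_Mapping.single v 1) 1"

text \<open>Degrees are integers, since matrix entries of a graded complex may be forced into negative
  degree; the zero polynomial is homogeneous of every degree, and it is the only one that is
  homogeneous of negative degree.\<close>

definition homogeneous :: "int \<Rightarrow> ('v, 'k::field) mpoly \<Rightarrow> bool" where
  "homogeneous d p \<longleftrightarrow> (\<forall>m\<in>Poly_Mapping.keys p. int (mono_degree m) = d)"

definition irrelevant_ideal :: "'v set \<Rightarrow> ('v, 'k::field) mpoly set" where
  "irrelevant_ideal V = {p \<in> polys V. Poly_Mapping.lookup p 0 = 0}"

text \<open>Only meant for finite \<open>S\<close>: the sum over an infinite set is \<open>0\<close>.\<close>

definition ideal_gen :: "'v set \<Rightarrow> ('v, 'k::field) mpoly set \<Rightarrow> ('v, 'k) mpoly set" where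
  "ideal_gen V S = {(\<Sum>f\<in>S. c f * f) | c. \<forall>f\<in>S. c f \<in> polys V}"

text \<open>Numerical and matrix data of a complex
  \<open>\<dots> \<rightarrow> F\<^sub>2 \<rightarrow> F\<^sub>1 \<rightarrow> F\<^sub>0 \<rightarrow> R/I\<close> of graded free modules of finite
  rank over \<open>R\<close>: \<open>gens F i\<close> lists the
  degrees of the basis elements of \<open>F\<^sub>i\<close>, that is, \<open>F\<^sub>i\<close> is the direct sum of the
  \<open>R(-d)\<close> over the entries \<open>d\<close> of this list; \<open>diff F i\<close> is the matrix of \<open>F\<^sub>i\<^sub>+\<^sub>1 \<rightarrow> F\<^sub>i\<close>; and
  \<open>aug F\<close> lists representatives in \<open>R\<close> of the images in \<open>R/I\<close> of the basis elements of \<open>F\<^sub>0\<close>.\<close>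

record 'r graded_complex =
  gens :: "nat \<Rightarrow> int list"
  diff :: "nat \<Rightarrow> 'r mat"
  aug :: "'r vec"

definition free_rank :: "'r graded_complex \<Rightarrow> nat \<Rightarrow> nat" where
  "free_rank F i = length (gens F i)"

definition free_module :: "'v set \<Rightarrow> nat \<Rightarrow> ('v, 'k::field) mpoly vec set" where
  "free_module V n = {w \<in> carrier_vec n. \<forall>k<n. w $ k \<in> polys V}"

definition graded_free_resolution ::
    "'v set \<Rightarrow> ('v, 'k::field) mpoly set \<Rightarrow> ('v, 'k) mpoly graded_complex \<Rightarrow> bool" where
  "graded_free_resolution V I F \<longleftrightarrow>
     aug F \<in> free_module V (free_rank F 0) \<and>
     (\<forall>k < free_rank F 0. homogeneous (gens F 0 ! k) (aug F $ k)) \<and>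
     (\<forall>i. diff F i \<in> carrier_mat (free_rank F i) (free_rank F (Suc i)) \<and>
        (\<forall>r < free_rank F i. \<forall>c < free_rank F (Suc i).
           diff F i $$ (r, c) \<in> polys V \<and>
           homogeneous (gens F (Suc i) ! c - gens F i ! r) (diff F i $$ (r, c)))) \<and>
     (\<forall>p \<in> polys V. \<exists>w \<in> free_module V (free_rank F 0). p - aug F \<bullet> w \<in> I) \<and>
     {w \<in> free_module V (free_rank F 0). aug F \<bullet> w \<in> I}
       = (\<lambda>w. diff F 0 *\<^sub>v w) ` free_module V (free_rank F 1) \<and>
     (\<forall>i. {w \<in> free_module V (free_rank F (Suc i)). diff F i *\<^sub>v w = 0\<^sub>v (free_rank F i)}
       = (\<lambda>w. diff F (Suc i) *\<^sub>v w) ` free_module V (free_rank F (Suc (Suc i))))"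

definition minimal_graded_free_resolution ::
    "'v set \<Rightarrow> ('v, 'k::field) mpoly set \<Rightarrow> ('v, 'k) mpoly graded_complex \<Rightarrow> bool" where
  "minimal_graded_free_resolution V I F \<longleftrightarrow>
     graded_free_resolution V I F \<and>
     (\<forall>i. \<forall>r < free_rank F i. \<forall>c < free_rank F (Suc i). diff F i $$ (r, c) \<in> irrelevant_ideal V)"

text \<open>The graded Betti number \<open>\<beta>\<^sub>i\<^sub>,\<^sub>j(R/I)\<close>: the multiplicity of \<open>R(-j)\<close> in the \<open>i\<close>-th module of the
  minimal graded free resolution of \<open>R/I\<close>. For a homogeneous ideal \<open>I\<close> and finite \<open>V\<close> such a
  resolution exists and is unique up to isomorphism, so the supremum merely selects the value
  common to all of them.\<close>

definition graded_betti :: "'v set \<Rightarrow> ('v, 'k::field) mpoly set \<Rightarrow> nat \<Rightarrow> int \<Rightarrow> enat" where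
  "graded_betti V I i j =
     (SUP F \<in> {F. minimal_graded_free_resolution V I F}. enat (count_list (gens F i) j))"

text \<open>The projective dimension of \<open>R/I\<close>, as the least length of a graded free resolution
  (finitely generated graded projective modules over a polynomial ring are free, and the
  graded and ungraded projective dimensions of a finitely generated graded module agree).\<close>

definition proj_dim :: "'v set \<Rightarrow> ('v, 'k::field) mpoly set \<Rightarrow> enat" where
  "proj_dim V I =
     (INF n \<in> {n. \<exists>F. graded_free_resolution V I F \<and> (\<forall>i>n. free_rank F i = 0)}. enat n)"

record 'v ugraph =
  verts :: "'v set"
  edges :: "'v set set"

definition finite_simple_graph :: "'v ugraph \<Rightarrow> bool" where
  "finite_simple_graph G \<longleftrightarrow>
     finite (verts G) \<and> (\<forall>e \<in> edges G. e \<subseteq> verts G \<and> card e = 2)"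

definition cone :: "'v \<Rightarrow> 'v set \<Rightarrow> 'v ugraph \<Rightarrow> 'v ugraph" where
  "cone x U H = \<lparr>verts = insert x (verts H), edges = edges H \<union> {{x, u} | u. u \<in> U}\<rparr>"

definition vertex_cover :: "'v set \<Rightarrow> 'v ugraph \<Rightarrow> bool" where
  "vertex_cover U H \<longleftrightarrow> U \<subseteq> verts H \<and> (\<forall>e \<in> edges H. e \<inter> U \<noteq> {})"

definition is_cycle_graph :: "nat \<Rightarrow> 'v ugraph \<Rightarrow> bool" where
  "is_cycle_graph n H \<longleftrightarrow> n \<ge> 3 \<and>
     (\<exists>v. inj_on v {..<n} \<and>
        H = \<lparr>verts = v ` {..<n}, edges = {{v i, v (Suc i mod n)} | i. i < n}\<rparr>)"

definition is_path_graph :: "nat \<Rightarrow> 'v ugraph \<Rightarrow> bool" where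
  "is_path_graph n H \<longleftrightarrow>
     (\<exists>v. inj_on v {..<n} \<and>
        H = \<lparr>verts = v ` {..<n}, edges = {{v i, v (Suc i)} | i. Suc i < n}\<rparr>)"

definition is_wheel :: "nat \<Rightarrow> 'v ugraph \<Rightarrow> bool" where
  "is_wheel n G \<longleftrightarrow>
     (\<exists>H x. is_cycle_graph n H \<and> x \<notin> verts H \<and> G = cone x (verts H) H)"

definition is_jahangir2 :: "nat \<Rightarrow> 'v ugraph \<Rightarrow> bool" where
  "is_jahangir2 n G \<longleftrightarrow>
     (\<exists>H U x. is_cycle_graph (2 * n) H \<and> vertex_cover U H \<and> card U = n \<and>
        x \<notin> verts H \<and> G = cone x U H)"

definition complete_multipartite :: "'v ugraph \<Rightarrow> bool" where
  "complete_multipartite G \<longleftrightarrow>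
     (\<exists>P. partition_on (verts G) P \<and>
        edges G = {{u, w} | u w. \<exists>A\<in>P. \<exists>B\<in>P. A \<noteq> B \<and> u \<in> A \<and> w \<in> B})"

text \<open>Every \<open>x\<^sub>i\<close> is coned along the vertex set of the original path, so the \<open>x\<^sub>i\<close> are pairwise
  nonadjacent.\<close>

definition is_fan :: "nat \<Rightarrow> nat \<Rightarrow> 'v ugraph \<Rightarrow> bool" where
  "is_fan m n G \<longleftrightarrow>
     (\<exists>H xs. is_path_graph n H \<and> length xs = m \<and> distinct xs \<and> set xs \<inter> verts H = {} \<and>
        G = foldr (\<lambda>x H'. cone x (verts H) H') xs H)"

definition edge_ideal :: "'v ugraph \<Rightarrow> ('v, 'k::field) mpoly set" where
  "edge_ideal G = ideal_gen (verts G) ((\<lambda>e. \<Prod>v\<in>e. pvar v) ` edges G)"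

text \<open>The invariant \<open>t\<^sub>i(G)\<close> over the coefficient field \<open>'k\<close>; the supremum of the empty set is
  \<open>-\<infinity>\<close> in \<^typ>\<open>ereal\<close>.\<close>

definition t_inv :: "'k::field itself \<Rightarrow> 'v ugraph \<Rightarrow> nat \<Rightarrow> ereal" where
  "t_inv K G i =
     (SUP j \<in> {j. graded_betti (verts G) (edge_ideal G :: ('v, 'k) mpoly set) i j \<noteq> 0}.
        ereal (of_int j))"

definition pd_edge_ideal_quotient :: "'k::field itself \<Rightarrow> 'v ugraph \<Rightarrow> enat" where
  "pd_edge_ideal_quotient K G = proj_dim (verts G) (edge_ideal G :: ('v, 'k) mpoly set)"

definition subadditive :: "'k::field itself \<Rightarrow> 'v ugraph \<Rightarrow> bool" where
  "subadditive K G \<longleftrightarrow>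
     (\<forall>a b. enat (a + b) \<le> pd_edge_ideal_quotient K G \<longrightarrow>
        t_inv K G (a + b) \<le> t_inv K G a + t_inv K G b)"

end

theory Submission
  imports Defs
begin

text \<open>
  For \<open>\<sigma> \<subseteq> V(G)\<close> the part of \<open>Tor\<^sub>i(R/I(G), k)\<close> in multidegree \<open>\<sigma>\<close> is the reduced
  cohomology of the independence complex of \<open>G[\<sigma>]\<close> in dimension \<open>|\<sigma>| - i - 1\<close>, and all other
  multidegrees vanish (Hochster). Dimension shifting along the syzygy modules identifies the
  degrees of the generators of the \<open>i\<close>-th module of any minimal resolution with the sizes of the
  sets \<open>\<sigma>\<close> for which this cohomology does not vanish. Subadditivity thus becomes a statement about
  such sets. The long exact sequence for deletion and link of a vertex settles paths and cycles:
  pieces at the start of a path with three or two vertices can be split off one at a time. If \<open>U\<close> is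
  a vertex cover of \<open>H\<close>, the link of the apex in the independence complex of the cone along \<open>U\<close> is
  a simplex, so that beyond the linear strand adding the apex to a set merely raises its homological
  degree and its size by one; on the linear strand \<open>t\<^sub>a \<ge> a + 1\<close> is enough. In a complete
  multipartite graph every vertex is such an apex, and the whole resolution is linear.
\<close>

section \<open>Koszul complexes of families of sets\<close>

text \<open>The definitions present minimal resolutions only as matrices and lists of degrees, so
  Tor has to be rebuilt by hand. Chains are functions on sets, and of homology only its vanishing or
  nonvanishing is recorded. A long exact sequence then becomes three implications:
  \<open>khom_cases\<close>, \<open>khom_deletionI\<close> and \<open>khom_linkI\<close>. Exactness
  of the Koszul complex of the variables drives the dimension shift; minimality enters in the last
  step, where homological degree 0 is reached. On the combinatorial side the sets witnessing t_a and
  t_b need neither be disjoint nor lie inside the given set S; only card S <= s + t is required.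
  This freedom matters twice. A piece of three vertices of a path has degree 2 and cannot be cut
  into two parts of degree 1, but one edge can serve for both. The full vertex set of a cycle lies
  in no path, but its size and degree are so constrained by the exact sequence that two intervals
  with ceil(3a/2) and ceil(3b/2) vertices are large enough.\<close>

text \<open>Signs need a linear order on the vertices, and the vertex type carries none; the
  well-ordering theorem supplies one on the whole type.\<close>

definition vorder :: "'v rel" where
  "vorder = (SOME r. well_order_on UNIV r)"

text \<open>The sign of sorting the basis vector of u into the exterior product of those of t, meant
  for u outside t.\<close>

definition ksign :: "'v \<Rightarrow> 'v set \<Rightarrow> 'a::comm_ring_1" where
  "ksign u t = (-1) ^ card {w \<in> t. (w, u) \<in> vorder}"

lemma vorder_iff:
  assumes "u \<noteq> v"
  shows "(u, v) \<in> vorder \<longleftrightarrow> (v, u) \<notin> vorder"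
proof -
  have "\<exists>r::'a rel. well_order_on UNIV r"
    using well_order_on by blast
  hence "well_order_on UNIV (vorder :: 'a rel)"
    unfolding vorder_def by (rule someI_ex)
  thus ?thesis
    using assms unfolding well_order_on_def linear_order_on_def partial_order_on_def
    by (metis UNIV_I antisymD total_on_def)
qed

lemma ksign_sq [simp]: "ksign u t * ksign u t = 1"
  by (simp add: ksign_def flip: power_mult_distrib)

lemma ksign_sq' [simp]: "ksign u t * (ksign u t * x) = x"
  by (simp add: mult.assoc[symmetric])

lemma ksign_neq_0 [simp]: "ksign u t \<noteq> 0"
  by (metis ksign_sq mult_zero_left zero_neq_one)

lemma ksign_empty [simp]: "ksign u {} = 1"
  by (simp add: ksign_def)

lemma ksign_insert:
  assumes "finite t" "v \<notin> t"
  shows "ksign u (insert v t) = (if (v, u) \<in> vorder then - ksign u t else ksign u t)"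
proof -
  have "{w \<in> insert v t. (w, u) \<in> vorder} =
      (if (v, u) \<in> vorder then insert v {w \<in> t. (w, u) \<in> vorder} else {w \<in> t. (w, u) \<in> vorder})"
    by auto
  thus ?thesis
    using assms by (simp add: ksign_def)
qed

text \<open>Exactly one of u and v precedes the other, so exactly one of the two insertions changes
  sign. This is the reason for \<open>koszul_koszul\<close>.\<close>

lemma ksign_swap:
  assumes "finite t" "u \<noteq> v" "u \<notin> t" "v \<notin> t"
  shows "ksign u (insert v t) * ksign v t = - (ksign v (insert u t) * ksign u t)"
  using assms vorder_iff[OF assms(2)] by (simp add: ksign_insert mult.commute)

text \<open>Exchanging the summation order would only show that the sum equals its own negative,
  which says nothing in characteristic 2. Induction cancels the terms in pairs instead.\<close>

lemma sum_antisymmetric: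
  fixes f :: "'b \<Rightarrow> 'b \<Rightarrow> 'a::ab_group_add"
  assumes "finite S" "\<And>u v. u \<in> S \<Longrightarrow> v \<in> S \<Longrightarrow> u \<noteq> v \<Longrightarrow> f u v = - f v u"
  shows "(\<Sum>u\<in>S. \<Sum>v\<in>S - {u}. f u v) = 0"
  using assms
proof (induction S rule: finite_induct)
  case (insert x S)
  have "(\<Sum>v\<in>insert x S - {u}. f u v) = f u x + (\<Sum>v\<in>S - {u}. f u v)" if "u \<in> S" for u
  proof -
    have "insert x S - {u} = insert x (S - {u})" using that insert.hyps by auto
    thus ?thesis using insert.hyps by simp
  qed
  hence "(\<Sum>u\<in>S. \<Sum>v\<in>insert x S - {u}. f u v) = (\<Sum>u\<in>S. f u x) + (\<Sum>u\<in>S. \<Sum>v\<in>S - {u}. f u v)"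
    by (simp add: sum.distrib)
  moreover have "(\<Sum>u\<in>S. \<Sum>v\<in>S - {u}. f u v) = 0"
    using insert.IH insert.prems by blast
  moreover have "(\<Sum>u\<in>S. f u x) = - (\<Sum>v\<in>S. f x v)"
    unfolding sum_negf[symmetric]
  proof (rule sum.cong)
    fix u assume "u \<in> S"
    thus "f u x = - f x u" using insert.hyps by (intro insert.prems) auto
  qed simp
  moreover have "insert x S - {x} = S" using insert.hyps by auto
  ultimately show ?case
    using insert.hyps by simp
qed simp

text \<open>The Koszul differential on coefficients: \<open>g t\<close> is the coefficient of the
  exterior basis element of t, and the value at t collects all terms that lose one u. For x =
  \<open>pvar\<close> it belongs to the polynomial ring; for x constantly 1 it is the scalar complex
  of a single multidegree.\<close>

definition koszul :: "('v \<Rightarrow> 'a::comm_ring_1) \<Rightarrow> 'v set \<Rightarrow> ('v set \<Rightarrow> 'a) \<Rightarrow> 'v set \<Rightarrow> 'a" where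
  "koszul x S g t = (\<Sum>u\<in>S - t. ksign u t * x u * g (insert u t))"

lemma koszul_diff: "koszul x S (\<lambda>t. g t - h t) t = koszul x S g t - koszul x S h t"
  by (simp add: koszul_def algebra_simps sum_subtractf)

lemma koszul_add: "koszul x S (\<lambda>t. g t + h t) t = koszul x S g t + koszul x S h t"
  by (simp add: koszul_def algebra_simps sum.distrib)

lemma koszul_uminus: "koszul x S (\<lambda>t. - g t) t = - koszul x S g t"
  by (simp add: koszul_def sum_negf)

lemma koszul_mult: "koszul x S (\<lambda>t. a * g t) t = a * koszul x S g t"
  by (simp add: koszul_def algebra_simps sum_distrib_left)

lemma koszul_sum: "koszul x S (\<lambda>t. \<Sum>i\<in>I. g i t) t = (\<Sum>i\<in>I. koszul x S (g i) t)"
  unfolding koszul_def by (subst sum.swap) (simp add: sum_distrib_left)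

lemma koszul_cong:
  assumes "\<And>u. u \<in> S - t \<Longrightarrow> g (insert u t) = h (insert u t)"
  shows "koszul x S g t = koszul x S h t"
  using assms by (simp add: koszul_def)

lemma koszul_koszul:
  assumes "finite S" "finite t"
  shows "koszul x S (koszul x S g) t = 0"
proof -
  define f where "f u v = ksign u t * x u * (ksign v (insert u t) * x v * g (insert v (insert u t)))" for u v
  have "koszul x S (koszul x S g) t = (\<Sum>u\<in>S - t. \<Sum>v\<in>(S - t) - {u}. f u v)"
    unfolding koszul_def f_def sum_distrib_left by (simp only: Diff_insert[of S _ t])
  also have "\<dots> = 0"
  proof (rule sum_antisymmetric)
    fix u v assume uv: "u \<in> S - t" "v \<in> S - t" "u \<noteq> v"
    have "f u v = (ksign v (insert u t) * ksign u t) * (x u * x v * g (insert v (insert u t)))"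
      by (simp add: f_def algebra_simps)
    also have "\<dots> = - (ksign u (insert v t) * ksign v t) * (x u * x v * g (insert v (insert u t)))"
      using uv assms by (subst ksign_swap) auto
    also have "\<dots> = - f v u"
      by (simp add: f_def algebra_simps insert_commute)
    finally show "f u v = - f v u" .
  qed (use assms in simp)
  finally show ?thesis .
qed

abbreviation bd :: "'v set \<Rightarrow> ('v set \<Rightarrow> 'a::comm_ring_1) \<Rightarrow> 'v set \<Rightarrow> 'a" where
  "bd \<equiv> koszul (\<lambda>_. 1)"

lemma bd_split:
  assumes "finite S" "v \<in> S - t"
  shows "bd S g t = ksign v t * g (insert v t) + bd (S - {v}) g t"
proof -
  have "S - t = insert v (S - {v} - t)" using assms by auto
  thus ?thesis using assms by (simp add: koszul_def)
qed

text \<open>Contraction with v anticommutes with the differential. This identifies the part of a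
  complex on sets containing v with a complex on \<open>S - {v}\<close>, shifted by one.\<close>

lemma bd_twist:
  assumes "finite S" "v \<notin> t" "t \<subseteq> S"
  shows "bd (S - {v}) (\<lambda>t. ksign v t * g (insert v t)) t = - (ksign v t * bd S g (insert v t))"
proof -
  have fin: "finite t" using assms finite_subset by blast
  have "ksign u t * (ksign v (insert u t) * g (insert v (insert u t))) =
      - (ksign v t * (ksign u (insert v t) * g (insert u (insert v t))))" if "u \<in> S - insert v t" for u
  proof -
    have "ksign u t * ksign v (insert u t) = - (ksign v t * ksign u (insert v t) :: 'b)"
      using ksign_swap[OF fin, of v u] that assms by (auto simp: mult.commute)
    thus ?thesis by (simp add: mult.assoc[symmetric] insert_commute)
  qed
  moreover have "S - {v} - t = S - insert v t" by auto
  ultimately show ?thesis by (simp add: koszul_def sum_distrib_left sum_negf)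
qed

text \<open>Nonvanishing of homology at sets of size \<open>p\<close>. Values of cochains outside the family \<open>A\<close> are
  irrelevant: since \<open>A\<close> is closed upwards, \<open>bd\<close> at a member of \<open>A\<close> only involves members of \<open>A\<close>.\<close>

definition khom :: "'k::field itself \<Rightarrow> 'v set \<Rightarrow> ('v set \<Rightarrow> bool) \<Rightarrow> nat \<Rightarrow> bool" where
  "khom K S A p \<longleftrightarrow> (\<exists>g::'v set \<Rightarrow> 'k.
     (\<forall>t\<subseteq>S. A t \<and> Suc (card t) = p \<longrightarrow> bd S g t = 0) \<and>
     \<not> (\<exists>h. \<forall>t\<subseteq>S. A t \<and> card t = p \<longrightarrow> g t = bd S h t))"

lemma khom_cong:
  assumes "\<And>t. t \<subseteq> S \<Longrightarrow> A t \<longleftrightarrow> A' t"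
  shows "khom K S A p \<longleftrightarrow> khom K S A' p"
  unfolding khom_def using assms by (metis (no_types, lifting))

lemma khomI:
  fixes g :: "'v set \<Rightarrow> 'k::field"
  assumes "\<And>t. t \<subseteq> S \<Longrightarrow> A t \<Longrightarrow> Suc (card t) = p \<Longrightarrow> bd S g t = 0"
    and "\<And>h. (\<And>t. t \<subseteq> S \<Longrightarrow> A t \<Longrightarrow> card t = p \<Longrightarrow> g t = bd S h t) \<Longrightarrow> False"
  shows "khom TYPE('k) S A p"
  unfolding khom_def using assms by metis

lemma not_khomD:
  fixes g :: "'v set \<Rightarrow> 'k::field"
  assumes "\<not> khom TYPE('k) S A p"
    and "\<And>t. t \<subseteq> S \<Longrightarrow> A t \<Longrightarrow> Suc (card t) = p \<Longrightarrow> bd S g t = 0"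
  shows "\<exists>h. \<forall>t. t \<subseteq> S \<longrightarrow> A t \<longrightarrow> card t = p \<longrightarrow> g t = bd S h t"
  using assms khomI by metis

section \<open>Cones and the exact sequence of a vertex\<close>

text \<open>Exterior multiplication by v is a contracting homotopy as soon as v can be removed from
  members of the family.\<close>

lemma not_khom_cone:
  assumes "finite S" "v \<in> S"
    and "\<And>t. t \<subseteq> S - {v} \<Longrightarrow> A (insert v t) \<Longrightarrow> A t"
  shows "\<not> khom TYPE('k::field) S A p"
proof
  assume "khom TYPE('k) S A p"
  then obtain g :: "'a set \<Rightarrow> 'k" where
    cyc: "\<And>t. t \<subseteq> S \<Longrightarrow> A t \<Longrightarrow> Suc (card t) = p \<Longrightarrow> bd S g t = 0" and
    nb: "\<And>h. (\<And>t. t \<subseteq> S \<Longrightarrow> A t \<Longrightarrow> card t = p \<Longrightarrow> g t = bd S h t) \<Longrightarrow> False"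
    unfolding khom_def by metis
  define h where "h t = (if v \<in> t then ksign v (t - {v}) * g (t - {v}) else 0)" for t
  show False
  proof (rule nb[of h])
    fix t assume t: "t \<subseteq> S" "A t" "card t = p"
    have fin: "finite t" using t assms finite_subset by blast
    show "g t = bd S h t"
    proof (cases "v \<in> t")
      case False
      have "bd (S - {v}) h t = 0"
        unfolding koszul_def using False by (intro sum.neutral) (auto simp: h_def)
      thus ?thesis using False t assms by (subst bd_split[of _ v]) (auto simp: h_def)
    next
      case True
      define t0 where "t0 = t - {v}"
      have t0: "t = insert v t0" "v \<notin> t0" "t0 \<subseteq> S" "finite t0" using True t fin by (auto simp: t0_def)
      \<comment> \<open>This is where the cone hypothesis enters: \<open>t0\<close> is a member, and
        the cycle condition there expresses \<open>g t\<close> by values on sets without v, which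
        are the values \<open>h\<close> was built from.\<close>
      have "A t0" using assms(3)[of t0] t0 t(2) by auto
      moreover have "Suc (card t0) = p" using t t0 by simp
      ultimately have "bd S g t0 = 0" using cyc t0 by simp
      hence 1: "ksign v t0 * g t + bd (S - {v}) g t0 = 0"
        using t0 assms by (subst (asm) bd_split[of _ v]) auto
      have "bd (S - {v}) (\<lambda>t. ksign v t * h (insert v t)) t0 = - (ksign v t0 * bd S h (insert v t0))"
        using t0 assms by (intro bd_twist) auto
      moreover have "bd (S - {v}) (\<lambda>t. ksign v t * h (insert v t)) t0 = bd (S - {v}) g t0"
        using t0 by (intro koszul_cong) (auto simp: h_def)
      ultimately have "bd (S - {v}) g t0 = - (ksign v t0 * bd S h t)" using t0 by simp
      hence "ksign v t0 * bd S h t = ksign v t0 * g t" using 1 by (metis add_implies_diff diff_0 minus_minus add.commute)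
      hence "ksign v t0 * (ksign v t0 * bd S h t) = ksign v t0 * (ksign v t0 * g t)" by simp
      thus ?thesis by simp
    qed
  qed
qed

text \<open>The chains vanishing on all sets that contain v form a subcomplex, and the sets
  containing v give the quotient, with one element fewer once v is dropped. The statement is
  exactness in the middle of the long exact sequence.\<close>

lemma khom_cases:
  assumes fin: "finite S" and v: "v \<in> S"
    and up: "\<And>t u. t \<subseteq> S \<Longrightarrow> u \<in> S \<Longrightarrow> A t \<Longrightarrow> A (insert u t)"
    and K: "khom TYPE('k::field) S A p"
  shows "khom TYPE('k) (S - {v}) A p \<or>
    (\<exists>q. p = Suc q \<and> khom TYPE('k) (S - {v}) (\<lambda>t. A (insert v t)) q)"
proof (rule ccontr)
  assume neg: "\<not> ?thesis"
  obtain g :: "'a set \<Rightarrow> 'k" where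
    cyc: "\<And>t. t \<subseteq> S \<Longrightarrow> A t \<Longrightarrow> Suc (card t) = p \<Longrightarrow> bd S g t = 0" and
    nb: "\<And>h. (\<And>t. t \<subseteq> S \<Longrightarrow> A t \<Longrightarrow> card t = p \<Longrightarrow> g t = bd S h t) \<Longrightarrow> False"
    using K unfolding khom_def by metis
  have "\<exists>h. \<forall>t\<subseteq>S. v \<in> t \<and> A t \<and> card t = p \<longrightarrow> g t = bd S h t"
  proof (cases p)
    case 0
    have "\<And>t. t \<subseteq> S \<Longrightarrow> v \<in> t \<Longrightarrow> card t \<noteq> 0" using fin by (metis card_0_eq empty_iff finite_subset)
    thus ?thesis using 0 by blast
  next
    case (Suc q)
    define G where "G t = ksign v t * g (insert v t)" for t
    have "\<not> khom TYPE('k) (S - {v}) (\<lambda>t. A (insert v t)) q" using neg Suc by blast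
    moreover have "bd (S - {v}) G t = 0"
      if "t \<subseteq> S - {v}" "A (insert v t)" "Suc (card t) = q" for t
    proof -
      have "finite t" using that fin finite_subset by blast
      hence "bd S g (insert v t) = 0"
        using that v Suc by (intro cyc) (auto simp: card_insert_if)
      thus ?thesis unfolding G_def using that fin by (subst bd_twist) auto
    qed
    ultimately have "\<exists>H. \<forall>t. t \<subseteq> S - {v} \<longrightarrow> A (insert v t) \<longrightarrow> card t = q \<longrightarrow> G t = bd (S - {v}) H t"
      by (rule not_khomD)
    then obtain H where H: "\<And>t. t \<subseteq> S - {v} \<Longrightarrow> A (insert v t) \<Longrightarrow> card t = q \<Longrightarrow> G t = bd (S - {v}) H t"
      by blast
    define h where "h t = - (ksign v (t - {v}) * H (t - {v}))" for t
    have "g t = bd S h t" if t: "t \<subseteq> S" "v \<in> t" "A t" "card t = p" for t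
    proof -
      define t0 where "t0 = t - {v}"
      have t0: "t = insert v t0" "v \<notin> t0" "t0 \<subseteq> S - {v}" using t by (auto simp: t0_def)
      have "finite t0" using t0 fin finite_subset by blast
      hence "card t0 = q" using t t0 Suc by simp
      hence "G t0 = bd (S - {v}) H t0" using t t0 by (intro H) auto
      also have "bd (S - {v}) H t0 = bd (S - {v}) (\<lambda>t. - (ksign v t * h (insert v t))) t0"
        using t0 by (intro koszul_cong) (auto simp: h_def)
      also have "\<dots> = ksign v t0 * bd S h t"
        using t0 fin by (subst koszul_uminus, subst bd_twist) auto
      finally have "ksign v t0 * (ksign v t0 * g t) = ksign v t0 * (ksign v t0 * bd S h t)"
        using t0 by (simp add: G_def)
      thus ?thesis by simp
    qed
    thus ?thesis by blast
  qed
  then obtain h where h: "\<And>t. t \<subseteq> S \<Longrightarrow> v \<in> t \<Longrightarrow> A t \<Longrightarrow> card t = p \<Longrightarrow> g t = bd S h t"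
    by blast
  \<comment> \<open>After subtracting a boundary the cycle vanishes on the members of size p that
    contain v, so it is a cycle of the subcomplex.\<close>
  define g' where "g' t = g t - bd S h t" for t
  have "\<not> khom TYPE('k) (S - {v}) A p" using neg by blast
  moreover have "bd (S - {v}) g' t = 0" if t: "t \<subseteq> S - {v}" "A t" "Suc (card t) = p" for t
  proof -
    have ft: "finite t" using t fin finite_subset by blast
    have "bd S g' t = 0"
      unfolding g'_def using t fin ft by (subst koszul_diff) (auto simp: koszul_koszul intro!: cyc)
    moreover have "g' (insert v t) = 0"
      unfolding g'_def using t v up[of t v] ft by (subst h) (auto simp: card_insert_if)
    ultimately show ?thesis using t v fin by (subst (asm) bd_split[of _ v]) auto
  qed
  ultimately have "\<exists>b. \<forall>t. t \<subseteq> S - {v} \<longrightarrow> A t \<longrightarrow> card t = p \<longrightarrow> g' t = bd (S - {v}) b t"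
      by (rule not_khomD)
    then obtain b where b: "\<And>t. t \<subseteq> S - {v} \<Longrightarrow> A t \<Longrightarrow> card t = p \<Longrightarrow> g' t = bd (S - {v}) b t"
      by blast
  define b' where "b' t = (if v \<in> t then 0 else b t)" for t
  show False
  proof (rule nb[of "\<lambda>t. h t + b' t"])
    fix t assume t: "t \<subseteq> S" "A t" "card t = p"
    have "g' t = bd S b' t"
    proof (cases "v \<in> t")
      case True
      have "bd S b' t = 0" unfolding koszul_def using True by (intro sum.neutral) (auto simp: b'_def)
      moreover have "g' t = 0" using h[OF t(1) True] t by (simp add: g'_def)
      ultimately show ?thesis by simp
    next
      case False
      have "bd (S - {v}) b t = bd (S - {v}) b' t"
        using False by (intro koszul_cong) (auto simp: b'_def)
      moreover have "bd S b' t = bd (S - {v}) b' t"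
        using False fin v by (subst bd_split[of _ v]) (auto simp: b'_def)
      ultimately show ?thesis using b[of t] t False by auto
    qed
    thus "g t = bd S (\<lambda>t. h t + b' t) t"
      by (simp add: koszul_add g'_def algebra_simps)
  qed
qed

text \<open>A class of the quotient lifts when its image under the connecting homomorphism vanishes,
  and that image lives in a group that is zero by the last assumption.\<close>

lemma khom_deletionI:
  assumes fin: "finite S" and v: "v \<in> S"
    and up: "\<And>t u. t \<subseteq> S \<Longrightarrow> u \<in> S \<Longrightarrow> A t \<Longrightarrow> A (insert u t)"
    and K: "khom TYPE('k::field) (S - {v}) (\<lambda>t. A (insert v t)) p"
    and L: "\<not> khom TYPE('k) (S - {v}) A p"
  shows "khom TYPE('k) S A (Suc p)"
proof -
  obtain G :: "'a set \<Rightarrow> 'k" where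
    cyc: "\<And>t. t \<subseteq> S - {v} \<Longrightarrow> A (insert v t) \<Longrightarrow> Suc (card t) = p \<Longrightarrow> bd (S - {v}) G t = 0" and
    nb: "\<And>h. (\<And>t. t \<subseteq> S - {v} \<Longrightarrow> A (insert v t) \<Longrightarrow> card t = p \<Longrightarrow> G t = bd (S - {v}) h t) \<Longrightarrow> False"
    using K unfolding khom_def by metis
  define g where "g t = (if v \<in> t then ksign v (t - {v}) * G (t - {v}) else 0)" for t
  have bdg: "bd S g (insert v t) = - (ksign v t * bd (S - {v}) G t)" if "t \<subseteq> S - {v}" for t
  proof -
    have "bd (S - {v}) (\<lambda>t. ksign v t * g (insert v t)) t = - (ksign v t * bd S g (insert v t))"
      using that fin by (intro bd_twist) auto
    moreover have "bd (S - {v}) (\<lambda>t. ksign v t * g (insert v t)) t = bd (S - {v}) G t"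
    proof (rule koszul_cong)
      fix u assume "u \<in> S - {v} - t"
      hence "insert u t - {v} = insert u t" using that by auto
      thus "ksign v (insert u t) * g (insert v (insert u t)) = G (insert u t)" by (simp add: g_def)
    qed
    ultimately show ?thesis by simp
  qed
  \<comment> \<open>On sets without v, \<open>bd S g\<close> represents the connecting homomorphism
    applied to the class of \<open>G\<close>. It bounds some \<open>h\<close>, and subtracting
    \<open>h\<close> turns \<open>g\<close> into a cycle.\<close>
  have "bd (S - {v}) (bd S g) t = 0" if t: "t \<subseteq> S - {v}" "A t" "Suc (card t) = p" for t
  proof -
    have ft: "finite t" using t fin finite_subset by blast
    have "bd S g (insert v t) = 0"
      using bdg[of t] cyc[of t] up[of t v] t v by auto
    moreover have "bd S (bd S g) t = 0" using fin ft by (rule koszul_koszul)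
    ultimately show ?thesis using t v fin by (subst (asm) bd_split[of _ v]) auto
  qed
  with L have "\<exists>h. \<forall>t. t \<subseteq> S - {v} \<longrightarrow> A t \<longrightarrow> card t = p \<longrightarrow> bd S g t = bd (S - {v}) h t"
      by (rule not_khomD)
    then obtain h where h: "\<And>t. t \<subseteq> S - {v} \<Longrightarrow> A t \<Longrightarrow> card t = p \<Longrightarrow> bd S g t = bd (S - {v}) h t"
      by blast
  define h' where "h' t = (if v \<in> t then 0 else h t)" for t
  have bdh: "bd S h' t = (if v \<in> t then 0 else bd (S - {v}) h t)" for t
  proof (cases "v \<in> t")
    case True
    thus ?thesis by (auto simp: koszul_def h'_def intro!: sum.neutral)
  next
    case False
    have "bd (S - {v}) h t = bd (S - {v}) h' t"
      using False by (intro koszul_cong) (auto simp: h'_def)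
    thus ?thesis using False fin v by (subst bd_split[of _ v]) (auto simp: h'_def)
  qed
  show ?thesis
  proof (rule khomI[of _ _ _ "\<lambda>t. g t - h' t"])
    fix t assume t: "t \<subseteq> S" "A t" "Suc (card t) = Suc p"
    show "bd S (\<lambda>t. g t - h' t) t = 0"
    proof (cases "v \<in> t")
      case True
      define t0 where "t0 = t - {v}"
      have t0: "t = insert v t0" "v \<notin> t0" "t0 \<subseteq> S - {v}" using True t by (auto simp: t0_def)
      have "finite t0" using t0 fin finite_subset by blast
      hence "bd (S - {v}) G t0 = 0" using t t0 by (intro cyc) auto
      thus ?thesis using bdg[of t0] t0 by (simp add: koszul_diff bdh)
    next
      case False
      thus ?thesis using h[of t] t by (auto simp: koszul_diff bdh)
    qed
  next
    fix b assume b: "\<And>t. t \<subseteq> S \<Longrightarrow> A t \<Longrightarrow> card t = Suc p \<Longrightarrow> g t - h' t = bd S b t"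
    show False
    proof (rule nb[of "\<lambda>t. - (ksign v t * b (insert v t))"])
      fix t assume t: "t \<subseteq> S - {v}" "A (insert v t)" "card t = p"
      have ft: "finite t" "v \<notin> t" using t fin finite_subset by blast+
      have "ksign v t * G t = bd S b (insert v t)"
        using b[of "insert v t"] t v ft by (auto simp: g_def h'_def)
      hence "G t = ksign v t * bd S b (insert v t)" by (metis ksign_sq')
      thus "G t = bd (S - {v}) (\<lambda>t. - (ksign v t * b (insert v t))) t"
        using t fin by (subst koszul_uminus, subst bd_twist) auto
    qed
  qed
qed

text \<open>A class of the subcomplex dies in the whole complex only if it comes from the quotient
  in the next degree, which has no homology here.\<close>

lemma khom_linkI:
  assumes fin: "finite S" and v: "v \<in> S"
    and up: "\<And>t u. t \<subseteq> S \<Longrightarrow> u \<in> S \<Longrightarrow> A t \<Longrightarrow> A (insert u t)"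
    and K: "khom TYPE('k::field) (S - {v}) A p"
    and L: "\<not> khom TYPE('k) (S - {v}) (\<lambda>t. A (insert v t)) p"
  shows "khom TYPE('k) S A p"
proof -
  obtain G :: "'a set \<Rightarrow> 'k" where
    cyc: "\<And>t. t \<subseteq> S - {v} \<Longrightarrow> A t \<Longrightarrow> Suc (card t) = p \<Longrightarrow> bd (S - {v}) G t = 0" and
    nb: "\<And>h. (\<And>t. t \<subseteq> S - {v} \<Longrightarrow> A t \<Longrightarrow> card t = p \<Longrightarrow> G t = bd (S - {v}) h t) \<Longrightarrow> False"
    using K unfolding khom_def by metis
  define ext :: "('a set \<Rightarrow> 'k) \<Rightarrow> 'a set \<Rightarrow> 'k" where "ext h t = (if v \<in> t then 0 else h t)" for h t
  have bdext: "bd S (ext h) t = (if v \<in> t then 0 else bd (S - {v}) h t)" for t h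
  proof (cases "v \<in> t")
    case True
    thus ?thesis by (auto simp: koszul_def ext_def intro!: sum.neutral)
  next
    case False
    have "bd (S - {v}) h t = bd (S - {v}) (ext h) t"
      using False by (intro koszul_cong) (auto simp: ext_def)
    thus ?thesis using False fin v by (subst bd_split[of _ v]) (auto simp: ext_def)
  qed
  show ?thesis
  proof (rule khomI[of _ _ _ "ext G"])
    fix t assume "t \<subseteq> S" "A t" "Suc (card t) = p"
    thus "bd S (ext G) t = 0" using cyc[of t] by (auto simp: bdext)
  next
    fix b assume b: "\<And>t. t \<subseteq> S \<Longrightarrow> A t \<Longrightarrow> card t = p \<Longrightarrow> ext G t = bd S b t"
    have "bd (S - {v}) (\<lambda>t. ksign v t * b (insert v t)) t = 0"
      if t: "t \<subseteq> S - {v}" "A (insert v t)" "Suc (card t) = p" for t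
    proof -
      have "finite t" "v \<notin> t" using t fin finite_subset by blast+
      hence "bd S b (insert v t) = 0"
        using b[of "insert v t"] t v by (auto simp: ext_def card_insert_if)
      thus ?thesis using t fin by (subst bd_twist) auto
    qed
    with L have "\<exists>h. \<forall>t. t \<subseteq> S - {v} \<longrightarrow> A (insert v t) \<longrightarrow> card t = p \<longrightarrow> ksign v t * b (insert v t) = bd (S - {v}) h t"
      by (rule not_khomD)
    then obtain h where h: "\<And>t. t \<subseteq> S - {v} \<Longrightarrow> A (insert v t) \<Longrightarrow> card t = p \<Longrightarrow>
        ksign v t * b (insert v t) = bd (S - {v}) h t"
      by blast
    \<comment> \<open>Adding \<open>bd S H\<close> to \<open>b\<close> does not change its boundary
      but cancels its values on the relevant sets containing v, so the remainder bounds
      \<open>G\<close> inside the subcomplex.\<close>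
    define H where "H t = (if v \<in> t then ksign v (t - {v}) * h (t - {v}) else 0)" for t
    show False
    proof (rule nb[of "\<lambda>t. b t + bd S H t"])
      fix t assume t: "t \<subseteq> S - {v}" "A t" "card t = p"
      have ft: "finite t" using t fin finite_subset by blast
      have "bd (S - {v}) (\<lambda>t. ksign v t * H (insert v t)) t = - (ksign v t * bd S H (insert v t))"
        using t fin by (intro bd_twist) auto
      moreover have "bd (S - {v}) (\<lambda>t. ksign v t * H (insert v t)) t = bd (S - {v}) h t"
      proof (rule koszul_cong)
        fix u assume "u \<in> S - {v} - t"
        hence "insert u t - {v} = insert u t" using t by auto
        thus "ksign v (insert u t) * H (insert v (insert u t)) = h (insert u t)" by (simp add: H_def)
      qed
      moreover have "bd (S - {v}) h t = ksign v t * b (insert v t)"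
      proof -
        have "A (insert v t)" by (rule up) (use t v in auto)
        thus ?thesis using h[of t] t by simp
      qed
      ultimately have "ksign v t * (ksign v t * b (insert v t)) = ksign v t * - (ksign v t * bd S H (insert v t))"
        by simp
      hence 0: "b (insert v t) + bd S H (insert v t) = 0" by simp
      have "t \<subseteq> S" "v \<notin> t" using t by auto
      hence "G t = bd S b t" using b[of t] t by (auto simp: ext_def)
      also have "\<dots> = bd S (\<lambda>t. b t + bd S H t) t"
        using fin ft by (simp add: koszul_add koszul_koszul)
      also have "\<dots> = bd (S - {v}) (\<lambda>t. b t + bd S H t) t"
        using 0 t fin v by (subst bd_split[of _ v]) auto
      finally show "G t = bd (S - {v}) (\<lambda>t. b t + bd S H t) t" .
    qed
  qed
qed

section \<open>Independence complexes\<close>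

lemma khom_empty_family:
  assumes "\<And>t. t \<subseteq> S \<Longrightarrow> \<not> A t"
  shows "\<not> khom K S A p"
  using assms by (auto simp: khom_def)

text \<open>For v in N no member avoids v, so the subcomplex is zero and the exact sequence is an
  isomorphism that shifts the degree by one. This is repeated for all of N.\<close>

lemma khom_forced:
  assumes "finite N" "finite S" "N \<subseteq> S"
    and up: "\<And>t u. t \<subseteq> S \<Longrightarrow> u \<in> S \<Longrightarrow> A t \<Longrightarrow> A (insert u t)"
    and forced: "\<And>t. t \<subseteq> S \<Longrightarrow> A t \<Longrightarrow> N \<subseteq> t"
  shows "khom TYPE('k::field) S A p \<longleftrightarrow>
    card N \<le> p \<and> khom TYPE('k) (S - N) (\<lambda>t. A (N \<union> t)) (p - card N)"
  using assms
proof (induction N arbitrary: S A p rule: finite_induct)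
  case empty
  thus ?case by simp
next
  case (insert v N)
  have no: "\<not> khom TYPE('k) (S - {v}) A q" for q
    by (rule khom_empty_family) (use insert.prems in blast)
  have "khom TYPE('k) S A p \<longleftrightarrow> (\<exists>q. p = Suc q \<and> khom TYPE('k) (S - {v}) (\<lambda>t. A (insert v t)) q)"
  proof
    assume "khom TYPE('k) S A p"
    with khom_cases[of S v A p] insert.prems no show "\<exists>q. p = Suc q \<and> khom TYPE('k) (S - {v}) (\<lambda>t. A (insert v t)) q"
      by blast
  next
    assume "\<exists>q. p = Suc q \<and> khom TYPE('k) (S - {v}) (\<lambda>t. A (insert v t)) q"
    thus "khom TYPE('k) S A p"
      using khom_deletionI[of S v A] insert.prems no by blast
  qed
  also have "\<dots> \<longleftrightarrow> (\<exists>q. p = Suc q \<and> card N \<le> q \<and>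
      khom TYPE('k) (S - {v} - N) (\<lambda>t. A (insert v (N \<union> t))) (q - card N))"
  proof -
    have up': "A (insert v (insert u t))"
      if "t \<subseteq> S - {v}" "u \<in> S - {v}" "A (insert v t)" for t u
      using insert.prems(3)[of "insert v t" u] insert.prems(2) that by (auto simp: insert_commute)
    have forced': "N \<subseteq> t" if "t \<subseteq> S - {v}" "A (insert v t)" for t
    proof -
      have "insert v N \<subseteq> insert v t"
        using insert.prems(4)[of "insert v t"] insert.prems(2) that by auto
      thus ?thesis using insert.hyps by blast
    qed
    have "khom TYPE('k) (S - {v}) (\<lambda>t. A (insert v t)) q \<longleftrightarrow> card N \<le> q \<and>
      khom TYPE('k) (S - {v} - N) (\<lambda>t. A (insert v (N \<union> t))) (q - card N)" for q
      using insert.prems(1,2) insert.hyps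
      by (intro insert.IH) (auto intro: up' dest: forced')
    thus ?thesis by simp
  qed
  also have "\<dots> \<longleftrightarrow> card (insert v N) \<le> p \<and>
      khom TYPE('k) (S - insert v N) (\<lambda>t. A (insert v N \<union> t)) (p - card (insert v N))"
    using insert.hyps by (cases p) (auto simp flip: Diff_insert2)
  finally show ?case .
qed

definition edge_free :: "'v set set \<Rightarrow> 'v set \<Rightarrow> bool" where
  "edge_free E f \<longleftrightarrow> (\<forall>e\<in>E. \<not> e \<subseteq> f)"

definition nbrs :: "'v set set \<Rightarrow> 'v set \<Rightarrow> 'v \<Rightarrow> 'v set" where
  "nbrs E S v = {u \<in> S. {u, v} \<in> E}"

text \<open>A set \<open>t\<close> stands for the face \<open>S - t\<close> of the independence complex; hence \<open>p\<close> is the homological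
  degree of the Betti number, and removing \<open>u\<close> from the complement is the simplicial coboundary.\<close>

definition ghom :: "'k::field itself \<Rightarrow> 'v set set \<Rightarrow> 'v set \<Rightarrow> nat \<Rightarrow> bool" where
  "ghom K E S p = khom K S (\<lambda>t. edge_free E (S - t)) p"

lemma ghom_cong:
  assumes "\<And>e. e \<subseteq> S \<Longrightarrow> e \<in> E \<longleftrightarrow> e \<in> E'"
  shows "ghom K E S p \<longleftrightarrow> ghom K E' S p"
  unfolding ghom_def edge_free_def using assms by (intro khom_cong) (meson Diff_subset order_trans)

locale edge_set =
  fixes E :: "'v set set"
  assumes card_edge: "e \<in> E \<Longrightarrow> card e = 2"
begin

lemma edge_free_iff:
  "edge_free E f \<longleftrightarrow> (\<forall>u\<in>f. \<forall>v\<in>f. {u, v} \<notin> E)"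
proof
  assume *: "\<forall>u\<in>f. \<forall>v\<in>f. {u, v} \<notin> E"
  show "edge_free E f"
    unfolding edge_free_def
  proof (intro ballI notI)
    fix e assume "e \<in> E" "e \<subseteq> f"
    moreover obtain u v where "e = {u, v}" using card_edge[OF \<open>e \<in> E\<close>] by (auto simp: card_2_iff)
    ultimately show False using * by simp
  qed
next
  assume ind: "edge_free E f"
  show "\<forall>u\<in>f. \<forall>v\<in>f. {u, v} \<notin> E"
  proof (intro ballI notI)
    fix u v assume "u \<in> f" "v \<in> f" "{u, v} \<in> E"
    with ind have "\<not> {u, v} \<subseteq> f" unfolding edge_free_def by blast
    thus False using \<open>u \<in> f\<close> \<open>v \<in> f\<close> by simp
  qed
qed

lemma no_loop: "{v} \<notin> E" "{v, v} \<notin> E"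
  using card_edge[of "{v}"] by auto

lemma edge_free_mono: "edge_free E f \<Longrightarrow> f' \<subseteq> f \<Longrightarrow> edge_free E f'"
  by (auto simp: edge_free_def)

lemma edge_free_insert:
  "edge_free E (insert v f) \<longleftrightarrow> edge_free E f \<and> nbrs E f v = {}"
  unfolding edge_free_iff nbrs_def using no_loop by (auto simp: insert_commute)

section \<open>Deletion, link and special vertices\<close>

text \<open>If v is not in t, then v lies in the face S - t, so all neighbours of v are forced into
  t. They account for the shift by their number; v itself, lying in no t, contributes
  nothing.\<close>

lemma khom_link:
  assumes "finite S" "v \<in> S"
  shows "khom TYPE('k::field) (S - {v}) (\<lambda>t. edge_free E (S - t)) p \<longleftrightarrow>
    card (nbrs E S v) \<le> p \<and> ghom TYPE('k) E (S - {v} - nbrs E S v) (p - card (nbrs E S v))"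
proof -
  let ?N = "nbrs E S v"
  have sub: "?N \<subseteq> S - {v}" using no_loop by (auto simp: nbrs_def)
  have "khom TYPE('k) (S - {v}) (\<lambda>t. edge_free E (S - t)) p \<longleftrightarrow> card ?N \<le> p \<and>
      khom TYPE('k) (S - {v} - ?N) (\<lambda>t. edge_free E (S - (?N \<union> t))) (p - card ?N)"
  proof (rule khom_forced)
    fix t assume "t \<subseteq> S - {v}" "edge_free E (S - t)"
    thus "?N \<subseteq> t" using assms by (force simp: nbrs_def edge_free_iff)
    next
    fix t u assume "edge_free E (S - t)"
    thus "edge_free E (S - insert u t)" by (rule edge_free_mono) auto
  qed (use assms sub in \<open>auto intro: finite_subset[of _ S]\<close>)
  also have "khom TYPE('k) (S - {v} - ?N) (\<lambda>t. edge_free E (S - (?N \<union> t))) (p - card ?N) \<longleftrightarrow>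
      ghom TYPE('k) E (S - {v} - ?N) (p - card ?N)"
    unfolding ghom_def
  proof (rule khom_cong)
    fix t assume "t \<subseteq> S - {v} - ?N"
    hence "S - (?N \<union> t) = insert v (S - {v} - ?N - t)" using assms sub by auto
    moreover have "nbrs E (S - {v} - ?N - t) v = {}" by (auto simp: nbrs_def)
    ultimately show "edge_free E (S - (?N \<union> t)) = edge_free E (S - {v} - ?N - t)"
      by (simp add: edge_free_insert)
  qed
  finally show ?thesis .
qed

lemma khom_deletion:
  "khom K (S - {v}) (\<lambda>t. edge_free E (S - insert v t)) p \<longleftrightarrow> ghom K E (S - {v}) p"
  by (simp add: ghom_def flip: Diff_insert2)

lemma ghom_cases:
  assumes "ghom TYPE('k::field) E S p" "finite S" "v \<in> S"
  obtains (deletion) q where "p = Suc q" "ghom TYPE('k) E (S - {v}) q"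
  | (link) "card (nbrs E S v) \<le> p" "ghom TYPE('k) E (S - {v} - nbrs E S v) (p - card (nbrs E S v))"
proof -
  have "khom TYPE('k) (S - {v}) (\<lambda>t. edge_free E (S - t)) p \<or>
      (\<exists>q. p = Suc q \<and> khom TYPE('k) (S - {v}) (\<lambda>t. edge_free E (S - insert v t)) q)"
    using assms by (intro khom_cases) (auto simp: ghom_def elim: edge_free_mono)
  thus thesis using deletion link khom_link[OF assms(2,3)] khom_deletion by metis
qed

lemma ghom_deletionI:
  assumes "finite S" "v \<in> S" "ghom TYPE('k::field) E (S - {v}) p"
    and "\<And>q. p = q + card (nbrs E S v) \<Longrightarrow> \<not> ghom TYPE('k) E (S - {v} - nbrs E S v) q"
  shows "ghom TYPE('k) E S (Suc p)"
  unfolding ghom_def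
proof (rule khom_deletionI[OF assms(1,2)])
  show "\<not> khom TYPE('k) (S - {v}) (\<lambda>t. edge_free E (S - t)) p"
    using assms(4)[of "p - card (nbrs E S v)"] by (auto simp: khom_link[OF assms(1,2)])
qed (use assms in \<open>auto simp: khom_deletion intro: edge_free_mono\<close>)

lemma ghom_linkI:
  assumes "finite S" "v \<in> S" "ghom TYPE('k::field) E (S - {v} - nbrs E S v) p"
    and "\<not> ghom TYPE('k) E (S - {v}) (p + card (nbrs E S v))"
  shows "ghom TYPE('k) E S (p + card (nbrs E S v))"
  unfolding ghom_def
  using assms khom_link[OF assms(1,2), of "p + card (nbrs E S v)"]
  by (intro khom_linkI[of S v]) (auto simp: khom_deletion intro: edge_free_mono)

text \<open>The independence complex is a cone with apex v.\<close>

lemma ghom_isolated: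
  assumes "finite S" "v \<in> S" "nbrs E S v = {}"
  shows "\<not> ghom TYPE('k::field) E S p"
  unfolding ghom_def
proof (rule not_khom_cone[OF assms(1,2)])
  fix t assume "t \<subseteq> S - {v}" "edge_free E (S - insert v t)"
  moreover from this have "S - t = insert v (S - insert v t)" using assms by auto
  ultimately show "edge_free E (S - t)"
    using assms(3) by (auto simp: edge_free_insert nbrs_def)
qed

text \<open>The complex whose only face is empty has reduced cohomology exactly in dimension -1.
  This is the Betti number in homological degree 0 and internal degree 0.\<close>

lemma ghom_empty: "ghom TYPE('k::field) E {} p \<longleftrightarrow> p = 0"
proof
  have "edge_free E {}" by (simp add: edge_free_iff)
  thus "ghom TYPE('k) E {} p" if "p = 0"
    unfolding ghom_def using that
    by (intro khomI[of _ _ _ "\<lambda>_. 1"]) (auto simp: koszul_def)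
  show "p = 0" if "ghom TYPE('k) E {} p"
    using that unfolding ghom_def khom_def by fastforce
qed

text \<open>Degree p = card S is the empty face, dimension -1. Since single vertices are faces, the
  coboundary is injective there.\<close>

lemma ghom_less_card:
  assumes "finite S" "ghom TYPE('k::field) E S p" "S \<noteq> {}"
  shows "p < card S"
proof (rule ccontr)
  assume "\<not> p < card S"
  obtain g :: "'v set \<Rightarrow> 'k" where
    cyc: "\<And>t. t \<subseteq> S \<Longrightarrow> edge_free E (S - t) \<Longrightarrow> Suc (card t) = p \<Longrightarrow> bd S g t = 0" and
    nb: "\<And>h. (\<And>t. t \<subseteq> S \<Longrightarrow> edge_free E (S - t) \<Longrightarrow> card t = p \<Longrightarrow> g t = bd S h t) \<Longrightarrow> False"
    using assms(2) unfolding ghom_def khom_def by metis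
  show False
  proof (rule nb[of "\<lambda>_. 0"])
    fix t assume t: "t \<subseteq> S" "card t = p"
    hence "card S \<le> card t" using \<open>\<not> p < card S\<close> by simp
    hence "t = S" using card_seteq[OF assms(1) t(1)] by simp
    obtain v where v: "v \<in> S" using assms by auto
    have "S - (S - {v}) = {v}" using v by auto
    hence "bd S g (S - {v}) = 0"
      using t v card_Suc_Diff1[OF assms(1) v] \<open>t = S\<close> no_loop
      by (intro cyc) (auto simp: edge_free_iff)
    hence "ksign v (S - {v}) * g S = 0"
      using v by (simp add: koszul_def \<open>S - (S - {v}) = {v}\<close> insert_absorb)
    hence "g S = 0" by (metis ksign_sq' mult_zero_right)
    thus "g t = bd S (\<lambda>_. 0) t" by (simp add: \<open>t = S\<close> koszul_def)
  qed
qed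

text \<open>An isolated edge suspends the rest of the complex: deleting w isolates v, so only the
  link of w contributes.\<close>

lemma ghom_edge:
  assumes "finite S" "v \<in> S" "w \<in> S" "nbrs E S v = {w}" "nbrs E S w = {v}"
  shows "ghom TYPE('k::field) E S p \<longleftrightarrow> (\<exists>q. p = Suc q \<and> ghom TYPE('k) E (S - {v, w}) q)"
proof -
  have "w \<in> nbrs E S v" using assms(4) by simp
  hence "v \<noteq> w" using no_loop by (auto simp: nbrs_def)
  hence "nbrs E (S - {w}) v = {}" using assms(4) by (auto simp: nbrs_def)
  hence no: "\<not> ghom TYPE('k) E (S - {w}) q" for q
    using assms \<open>v \<noteq> w\<close> by (intro ghom_isolated[of _ v]) auto
  have eq: "S - {w} - nbrs E S w = S - {v, w}" using assms by auto
  show ?thesis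
  proof
    assume "ghom TYPE('k) E S p"
    thus "\<exists>q. p = Suc q \<and> ghom TYPE('k) E (S - {v, w}) q"
    proof (cases rule: ghom_cases[OF _ assms(1,3), consumes 1, case_names deletion link])
      case link
      thus ?thesis using eq assms(5) by (cases p) auto
    qed (use no in blast)
  next
    assume "\<exists>q. p = Suc q \<and> ghom TYPE('k) E (S - {v, w}) q"
    then obtain q where "p = q + card (nbrs E S w)" "ghom TYPE('k) E (S - {w} - nbrs E S w) q"
      using eq assms(5) by auto
    thus "ghom TYPE('k) E S p" using ghom_linkI[OF assms(1,3)] no by blast
  qed
qed

text \<open>The fold lemma for independence complexes: every neighbour of v is a neighbour of u, so
  v becomes isolated in the link of u and only the deletion of u contributes.\<close>

lemma ghom_leaf:
  assumes "finite S" "v \<in> S" "w \<in> S" "u \<in> S" "nbrs E S v = {w}" "u \<noteq> v" "{u, w} \<in> E"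
  shows "ghom TYPE('k::field) E S p \<longleftrightarrow> (\<exists>q. p = Suc q \<and> ghom TYPE('k) E (S - {u}) q)"
proof -
  have "u \<noteq> w" using assms(7) no_loop by auto
  hence "{u, v} \<notin> E" using assms(4,5) by (auto simp: nbrs_def)
  hence "v \<in> S - {u} - nbrs E S u" using assms by (auto simp: nbrs_def insert_commute)
  moreover have "nbrs E (S - {u} - nbrs E S u) v = {}"
  proof -
    have "w \<in> nbrs E S u" using assms(3,7) by (simp add: nbrs_def insert_commute)
    moreover have "nbrs E (S - {u} - nbrs E S u) v \<subseteq> nbrs E S v - nbrs E S u"
      by (auto simp: nbrs_def)
    ultimately show ?thesis using assms(5) by auto
  qed
  ultimately have no: "\<not> ghom TYPE('k) E (S - {u} - nbrs E S u) q" for q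
    using assms(1) by (intro ghom_isolated[of _ v]) auto
  show ?thesis
  proof
    assume "ghom TYPE('k) E S p"
    thus "\<exists>q. p = Suc q \<and> ghom TYPE('k) E (S - {u}) q"
      by (cases rule: ghom_cases[OF _ assms(1,4), consumes 1, case_names deletion link]) (use no in blast)+
  next
    assume "\<exists>q. p = Suc q \<and> ghom TYPE('k) E (S - {u}) q"
    thus "ghom TYPE('k) E S p" using ghom_deletionI[OF assms(1,4)] no by blast
  qed
qed

text \<open>An edge-free link is a simplex and has no homology unless it is empty. If it is empty, x
  is adjacent to all other vertices of S, and the degree shift by their number puts S on the linear
  strand.\<close>

lemma ghom_cone_cases:
  assumes "finite S" "x \<in> S" "edge_free E (S - {x} - nbrs E S x)" "ghom TYPE('k::field) E S p"
  shows "card S \<le> Suc p \<or> (\<exists>q. p = Suc q \<and> ghom TYPE('k) E (S - {x}) q)"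
  using assms(4)
proof (cases rule: ghom_cases[OF _ assms(1,2), consumes 1, case_names deletion link])
  case link
  let ?L = "S - {x} - nbrs E S x"
  have "?L = {}"
  proof (rule ccontr)
    assume "?L \<noteq> {}"
    then obtain v where v: "v \<in> ?L" by blast
    hence "nbrs E ?L v = {}" using assms(3) unfolding nbrs_def edge_free_iff by blast
    thus False using link(2) ghom_isolated[of ?L v] v assms(1) by auto
  qed
  hence "S \<subseteq> insert x (nbrs E S x)" by auto
  hence "card S \<le> card (insert x (nbrs E S x))"
    using assms(1) by (intro card_mono) (auto simp: nbrs_def)
  also have "\<dots> \<le> Suc (card (nbrs E S x))" by (rule card_insert_le_m1) auto
  finally show ?thesis using link(1) by simp
qed blast

text \<open>The bound on p excludes the one link that could interfere, the empty one: there the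
  shift already equals \<open>card (S - {x})\<close>.\<close>

lemma ghom_coneI:
  assumes "finite S" "x \<in> S" "edge_free E (S - {x} - nbrs E S x)"
    and "ghom TYPE('k::field) E (S - {x}) p" "p < card (S - {x})"
  shows "ghom TYPE('k) E S (Suc p)"
proof (rule ghom_deletionI[OF assms(1,2,4)])
  let ?L = "S - {x} - nbrs E S x"
  fix q assume q: "p = q + card (nbrs E S x)"
  show "\<not> ghom TYPE('k) E ?L q"
  proof (cases "?L = {}")
    case True
    hence "S - {x} \<subseteq> nbrs E S x" by auto
    hence "card (S - {x}) \<le> card (nbrs E S x)"
      using assms(1) by (intro card_mono) (auto simp: nbrs_def)
    thus ?thesis using q assms(5) by simp
  next
    case False
    then obtain v where v: "v \<in> ?L" by blast
    hence "nbrs E ?L v = {}" using assms(3) unfolding nbrs_def edge_free_iff by blast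
    thus ?thesis using ghom_isolated[of ?L v] v assms(1) by auto
  qed
qed

end

section \<open>Paths, cycles and cones\<close>

text \<open>Degrees up to \<open>a + 1\<close> come for free, since \<open>t\<^sub>a \<ge> a + 1\<close> for \<open>0 < a \<le> pd\<close>.\<close>

definition linear_or_ghom :: "'k::field itself \<Rightarrow> 'v set set \<Rightarrow> 'v set \<Rightarrow> nat \<Rightarrow> nat \<Rightarrow> bool" where
  "linear_or_ghom K E V a s \<longleftrightarrow> s \<le> Suc a \<or> (\<exists>S\<subseteq>V. ghom K E S a \<and> s \<le> card S)"

text \<open>The numbers s and t stand for lower bounds of t_a and t_b. Positivity of a and b
  matters, because \<open>linear_or_ghom\<close> allows s = a + 1, which would be wrong for t_0 =
  0.\<close>

definition ghom_subadditive :: "'k::field itself \<Rightarrow> 'v set set \<Rightarrow> 'v set \<Rightarrow> bool" where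
  "ghom_subadditive K E V \<longleftrightarrow> (\<forall>S\<subseteq>V. \<forall>a>0. \<forall>b>0. ghom K E S (a + b) \<longrightarrow>
     (\<exists>s t. card S \<le> s + t \<and> linear_or_ghom K E V a s \<and> linear_or_ghom K E V b t))"

lemma linear_or_ghomI1: "s \<le> Suc a \<Longrightarrow> linear_or_ghom K E V a s"
  by (simp add: linear_or_ghom_def)

lemma linear_or_ghomI2: "S \<subseteq> V \<Longrightarrow> ghom K E S a \<Longrightarrow> s \<le> card S \<Longrightarrow> linear_or_ghom K E V a s"
  by (auto simp: linear_or_ghom_def)

lemma ghom_subadditiveD:
  assumes "ghom_subadditive K E V" "S \<subseteq> V" "0 < a" "0 < b" "ghom K E S (a + b)"
  obtains s t where "card S \<le> s + t" "linear_or_ghom K E V a s" "linear_or_ghom K E V b t"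
  using assms unfolding ghom_subadditive_def by metis

lemma linear_or_ghom_cong:
  assumes "linear_or_ghom K E V a s" "V \<subseteq> V'" "\<And>e. e \<subseteq> V \<Longrightarrow> e \<in> E \<longleftrightarrow> e \<in> E'"
  shows "linear_or_ghom K E' V' a s"
proof -
  have "ghom K E S a \<longleftrightarrow> ghom K E' S a" if "S \<subseteq> V" for S
    using that assms(3) by (intro ghom_cong) blast
  thus ?thesis using assms(1,2) unfolding linear_or_ghom_def by (meson subset_trans)
qed

text \<open>A set containing the apex either lies on the linear strand or has degree and size one
  more than its trace on the base. In the second case the apex is charged to the first
  summand.\<close>

lemma ghom_subadditive_cone:
  assumes sub: "ghom_subadditive TYPE('k::field) E V" and fin: "finite V" and x: "x \<notin> V"
    and ind: "edge_free E (V - U)" and U: "U \<subseteq> V" and E': "E' = E \<union> {{x, u} |u. u \<in> U}"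
    and card: "\<And>e. e \<in> E' \<Longrightarrow> card e = 2" and EV: "\<And>e. e \<in> E \<Longrightarrow> e \<subseteq> V"
  shows "ghom_subadditive TYPE('k) E' (insert x V)"
  unfolding ghom_subadditive_def
proof (intro allI impI)
  interpret edge_set E' using card by unfold_locales
  have EE: "e \<in> E \<longleftrightarrow> e \<in> E'" if "e \<subseteq> V" for e using that x by (auto simp: E')
  have cong: "ghom TYPE('k) E S p \<longleftrightarrow> ghom TYPE('k) E' S p" if "S \<subseteq> V" for S p
    using that EE by (intro ghom_cong) auto
  have lin: "linear_or_ghom TYPE('k) E' (insert x V) c s" if "linear_or_ghom TYPE('k) E V c s" for c s
    using that by (rule linear_or_ghom_cong) (auto simp: EE)
  have indx: "edge_free E' (S - {x} - nbrs E' S x)" if "S \<subseteq> insert x V" for S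
  proof -
    have "S - {x} - nbrs E' S x \<subseteq> V - U" using that by (auto simp: nbrs_def E' insert_commute)
    moreover have "edge_free E' (V - U)"
      using ind EE unfolding edge_free_def by blast
    ultimately show ?thesis using edge_free_mono by blast
  qed
  fix S a b assume S: "S \<subseteq> insert x V" and a: "0 < a" and b: "0 < b" and g: "ghom TYPE('k) E' S (a + b)"
  have finS: "finite S" using S fin finite_subset by blast
  show "\<exists>s t. card S \<le> s + t \<and> linear_or_ghom TYPE('k) E' (insert x V) a s \<and>
      linear_or_ghom TYPE('k) E' (insert x V) b t"
  proof (cases "x \<in> S")
    case False
    hence SV: "S \<subseteq> V" using S by auto
    hence "ghom TYPE('k) E S (a + b)" using g cong by simp
    from ghom_subadditiveD[OF sub SV a b this] lin show ?thesis by metis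
  next
    case True
    define S0 where "S0 = S - {x}"
    have S0: "S = insert x S0" "x \<notin> S0" "S0 \<subseteq> V" "finite S0" using True S finS by (auto simp: S0_def)
    have "card S \<le> Suc (a + b) \<or> (\<exists>q. a + b = Suc q \<and> ghom TYPE('k) E S0 q)"
      using ghom_cone_cases[OF finS True indx[OF S] g] cong[OF S0(3)]
      unfolding S0_def[symmetric] by simp
    then consider "card S \<le> Suc (a + b)" | q where "a + b = Suc q" "ghom TYPE('k) E S0 q"
      by blast
    thus ?thesis
    proof cases
      case 1
      thus ?thesis
        by (intro exI[of _ a] exI[of _ "Suc b"] conjI linear_or_ghomI1) simp_all
    next
      case 2
      show ?thesis
      proof (cases "a = 1")
        \<comment> \<open>Subadditivity of the base says nothing for a - 1 = 0. The whole trace goes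
          to b, and the apex is paid for by the linear bound for a = 1.\<close>
        case True
        hence "ghom TYPE('k) E' S0 b" using 2 cong S0 by simp
        thus ?thesis using S0
          by (intro exI[of _ 1] exI[of _ "card S0"] conjI linear_or_ghomI1[of 1]
              linear_or_ghomI2[of S0]) auto
      next
        case False
        \<comment> \<open>The base is split for a - 1 and b; then x is added to the witness for a -
          1. If that witness is only a linear bound, the bound grows by one as well.\<close>
        define a' where "a' = a - 1"
        have a': "a = Suc a'" "0 < a'" using False a by (auto simp: a'_def)
        have "ghom TYPE('k) E S0 (a' + b)" using 2 a' by simp
        from ghom_subadditiveD[OF sub S0(3) a'(2) b this] obtain s t where
          st: "card S0 \<le> s + t" "linear_or_ghom TYPE('k) E V a' s" "linear_or_ghom TYPE('k) E V b t" .
        have "linear_or_ghom TYPE('k) E' (insert x V) a (Suc s)"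
          using st(2)
        proof (unfold linear_or_ghom_def, elim disjE exE conjE)
          fix S1 assume S1: "S1 \<subseteq> V" "ghom TYPE('k) E S1 a'" "s \<le> card S1"
          have fin1: "finite S1" using S1 fin finite_subset by blast
          have g1: "ghom TYPE('k) E' S1 a'" using S1 cong by blast
          have "S1 \<noteq> {}"
          proof
            assume "S1 = {}"
            thus False using g1 a'(2) by (simp add: ghom_empty)
          qed
          hence "a' < card S1" using fin1 g1 ghom_less_card by blast
          moreover have "insert x S1 - {x} = S1" "x \<notin> S1" using S1 x by auto
          ultimately have "ghom TYPE('k) E' (insert x S1) a"
            unfolding a' using indx[of "insert x S1"] g1 fin1 S1
            by (intro ghom_coneI[of _ x]) auto
          thus "Suc s \<le> Suc a \<or> (\<exists>S\<subseteq>insert x V. ghom TYPE('k) E' S a \<and> Suc s \<le> card S)"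
            using S1 \<open>x \<notin> S1\<close> fin1 by (intro disjI2 exI[of _ "insert x S1"]) auto
        qed (use a' in auto)
        moreover have "linear_or_ghom TYPE('k) E' (insert x V) b t"
          using st(3) lin by blast
        moreover have "card S \<le> Suc s + t" using S0 st(1) by simp
        ultimately show ?thesis by blast
      qed
    qed
  qed
qed

section \<open>Paths\<close>

text \<open>The path is an induced part of a possibly larger graph, so the same lemmas apply to a
  cycle with one vertex removed.\<close>

locale induced_path = edge_set +
  fixes w :: "nat \<Rightarrow> 'a" and m :: nat
  assumes inj: "inj_on w {..<m}"
    and adj: "i < m \<Longrightarrow> j < m \<Longrightarrow> {w i, w j} \<in> E \<longleftrightarrow> j = Suc i \<or> i = Suc j"
begin

lemma nbrs_image:
  assumes "T \<subseteq> {..<m}" "i < m"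
  shows "nbrs E (w ` T) (w i) = w ` {j \<in> T. j = Suc i \<or> i = Suc j}"
  using assms adj[OF _ assms(2)] by (auto simp: nbrs_def)

lemma image_Diff:
  assumes "T \<subseteq> {..<m}" "T' \<subseteq> {..<m}"
  shows "w ` T - w ` T' = w ` (T - T')"
  using inj_on_image_set_diff[OF inj, of T T'] assms by auto

lemma ghom_isolated_start:
  assumes "T \<subseteq> {..<m}" "x \<in> T" "\<And>y. y \<in> T \<Longrightarrow> x \<le> y" "Suc x \<notin> T"
  shows "\<not> ghom TYPE('k::field) E (w ` T) p"
proof (rule ghom_isolated[of _ "w x"])
  have "{j \<in> T. j = Suc x \<or> x = Suc j} = {}" using assms(3,4) by force
  thus "nbrs E (w ` T) (w x) = {}" using assms nbrs_image[of T x] by auto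
qed (use assms finite_subset[OF assms(1)] in auto)

lemma ghom_edge_start:
  assumes T: "T \<subseteq> {..<m}" "x \<in> T" "Suc x \<in> T" "Suc (Suc x) \<notin> T" and min: "\<And>y. y \<in> T \<Longrightarrow> x \<le> y"
  shows "ghom TYPE('k::field) E (w ` T) p \<longleftrightarrow>
    (\<exists>q. p = Suc q \<and> ghom TYPE('k) E (w ` (T - {x, Suc x})) q)"
proof -
  have "{j \<in> T. j = Suc x \<or> x = Suc j} = {Suc x}" "{j \<in> T. j = Suc (Suc x) \<or> Suc x = Suc j} = {x}"
    using T min by force+
  hence "nbrs E (w ` T) (w x) = {w (Suc x)}" "nbrs E (w ` T) (w (Suc x)) = {w x}"
    using T nbrs_image[of T x] nbrs_image[of T "Suc x"] by auto
  moreover have "w ` (T - {x, Suc x}) = w ` T - {w x, w (Suc x)}"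
    using image_Diff[of T "{x, Suc x}"] T by auto
  ultimately show ?thesis
    using T ghom_edge[of "w ` T" "w x" "w (Suc x)"] finite_subset[OF T(1)] by simp
qed

text \<open>If the third vertex is present, the fold lemma deletes it, because the first is a leaf
  at the second; what remains in front is an isolated edge. So three vertices cost degree 2 and two
  vertices cost degree 1, that is, \<open>card D - 1\<close> in both cases.\<close>

lemma ghom_start:
  assumes T: "T \<subseteq> {..<m}" "x \<in> T" "Suc x \<in> T" and min: "\<And>y. y \<in> T \<Longrightarrow> x \<le> y"
    and D: "D = T \<inter> {x, Suc x, Suc (Suc x)}"
  shows "ghom TYPE('k::field) E (w ` T) p \<longleftrightarrow>
    (\<exists>q. Suc p = q + card D \<and> ghom TYPE('k) E (w ` (T - D)) q)"
proof (cases "Suc (Suc x) \<in> T")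
  case False
  hence "D = {x, Suc x}" using T by (auto simp: D)
  thus ?thesis using ghom_edge_start[OF T False min] by auto
next
  case True
  let ?u = "Suc (Suc x)"
  have D3: "D = {x, Suc x, ?u}" using T True by (auto simp: D)
  have "{j \<in> T. j = Suc x \<or> x = Suc j} = {Suc x}"
    using T min by force
  hence "nbrs E (w ` T) (w x) = {w (Suc x)}" using T nbrs_image[of T x] by auto
  moreover have "{w ?u, w (Suc x)} \<in> E" using T True adj[of ?u "Suc x"] by auto
  moreover have "w ?u \<noteq> w x"
  proof
    assume "w ?u = w x"
    hence "?u = x" using inj_onD[OF inj, of ?u x] T True by auto
    thus False by simp
  qed
  ultimately have "ghom TYPE('k::field) E (w ` T) p \<longleftrightarrow>
      (\<exists>q. p = Suc q \<and> ghom TYPE('k) E (w ` T - {w ?u}) q)"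
    using T True finite_subset[OF T(1)] by (intro ghom_leaf[of _ "w x" "w (Suc x)"]) auto
  also have "w ` T - {w ?u} = w ` (T - {?u})"
    using image_Diff[of T "{?u}"] T True by auto
  also have "(\<exists>q. p = Suc q \<and> ghom TYPE('k) E (w ` (T - {?u})) q) \<longleftrightarrow>
    (\<exists>q. Suc p = q + card D \<and> ghom TYPE('k) E (w ` (T - D)) q)"
  proof -
    have "T - {?u} - {x, Suc x} = T - D" using D3 by auto
    moreover have "ghom TYPE('k::field) E (w ` (T - {?u})) r \<longleftrightarrow>
        (\<exists>q. r = Suc q \<and> ghom TYPE('k) E (w ` (T - {?u} - {x, Suc x})) q)" for r
      using T min by (intro ghom_edge_start) auto
    ultimately show ?thesis using D3 by auto
  qed
  finally show ?thesis .
qed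

text \<open>The first piece D goes to whichever side still has enough degree, and induction splits
  the rest. One case resists: a = b = 1 with a piece of degree 2.\<close>

lemma ghom_split:
  assumes "T \<subseteq> {..<m}" "ghom TYPE('k::field) E (w ` T) (a + b)"
  shows "\<exists>T1\<subseteq>T. \<exists>T2\<subseteq>T. ghom TYPE('k) E (w ` T1) a \<and> ghom TYPE('k) E (w ` T2) b \<and>
    card T \<le> card T1 + card T2"
  using assms
proof (induction "card T" arbitrary: T a b rule: less_induct)
  case less
  have finT: "finite T" using less.prems finite_subset by blast
  show ?case
  proof (cases "T = {}")
    case True
    thus ?thesis using less.prems by (auto simp: ghom_empty)
  next
    case False
    define x where "x = Min T"
    have x: "x \<in> T" and min: "\<And>y. y \<in> T \<Longrightarrow> x \<le> y" using False finT by (auto simp: x_def)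
    have Sx: "Suc x \<in> T" using ghom_isolated_start[OF less.prems(1) x min] less.prems(2) by blast
    define D where "D = T \<inter> {x, Suc x, Suc (Suc x)}"
    obtain q where q: "Suc (a + b) = q + card D" "ghom TYPE('k) E (w ` (T - D)) q"
      using ghom_start[OF less.prems(1) x Sx min D_def] less.prems(2) by blast
    have Dle: "D \<subseteq> T" "x \<in> D" "Suc x \<in> D" "finite D" using x Sx finT by (auto simp: D_def)
    have "card D \<in> {2, 3}"
      using x Sx by (cases "Suc (Suc x) \<in> T") (auto simp: D_def)
    then obtain c where c: "card D = Suc c" "c = 1 \<or> c = 2" by auto
    have cardT: "card T = card (T - D) + Suc c"
      using c Dle finT by (metis add.commute card_Diff_subset card_mono le_add_diff_inverse)
    \<comment> \<open>D can be put back in front of any subset of the rest: x stays the minimum, and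
      the subset contains none of the three starting positions.\<close>
    have ext: "ghom TYPE('k) E (w ` (T' \<union> D)) (r + c)" "card (T' \<union> D) = card T' + Suc c"
      if "T' \<subseteq> T - D" "ghom TYPE('k) E (w ` T') r" for T' r
    proof -
      have "T' \<union> D - D = T'" using that by auto
      moreover have "D = (T' \<union> D) \<inter> {x, Suc x, Suc (Suc x)}" using that by (auto simp: D_def)
      ultimately show "ghom TYPE('k) E (w ` (T' \<union> D)) (r + c)"
      proof -
        assume eq: "T' \<union> D - D = T'" and D: "D = (T' \<union> D) \<inter> {x, Suc x, Suc (Suc x)}"
        have sub: "T' \<union> D \<subseteq> T" using that Dle by auto
        have "Suc (r + c) = r + card D" using c by simp
        with that(2) eq have "\<exists>q. Suc (r + c) = q + card D \<and> ghom TYPE('k) E (w ` (T' \<union> D - D)) q"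
          by metis
        thus ?thesis
          using sub less.prems(1) Dle min by (subst ghom_start[OF _ _ _ _ D]) blast+
      qed
      show "card (T' \<union> D) = card T' + Suc c"
        using that Dle finT c finite_subset[of T' T] by (subst card_Un_disjoint) auto
    qed
    have smaller: "card (T - D) < card T" using cardT by simp
    have TD: "T - D \<subseteq> {..<m}" using less.prems by auto
    \<comment> \<open>If D fits on neither side, then c = 2 and a, b <= 1, while c <= a + b by the
      degree equation; this leaves a = b = 1.\<close>
    consider "c \<le> a" | "c \<le> b" | "a = 1" "b = 1" "q = 0" using c q by fastforce
    thus ?thesis
    proof cases
      case 1
      hence "ghom TYPE('k) E (w ` (T - D)) ((a - c) + b)" using q c by (simp add: algebra_simps)
      from less.hyps[OF smaller TD this] obtain T1 T2 where
        "T1 \<subseteq> T - D" "T2 \<subseteq> T - D" "ghom TYPE('k) E (w ` T1) (a - c)" "ghom TYPE('k) E (w ` T2) b"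
        "card (T - D) \<le> card T1 + card T2" by blast
      thus ?thesis using ext[of T1 "a - c"] 1 cardT Dle
        by (intro exI[of _ "T1 \<union> D"] exI[of _ T2] conjI) auto
    next
      case 2
      hence "ghom TYPE('k) E (w ` (T - D)) (a + (b - c))" using q c by (simp add: algebra_simps)
      from less.hyps[OF smaller TD this] obtain T1 T2 where
        "T1 \<subseteq> T - D" "T2 \<subseteq> T - D" "ghom TYPE('k) E (w ` T1) a" "ghom TYPE('k) E (w ` T2) (b - c)"
        "card (T - D) \<le> card T1 + card T2" by blast
      thus ?thesis using ext[of T2 "b - c"] 2 cardT Dle
        by (intro exI[of _ "T1"] exI[of _ "T2 \<union> D"] conjI) auto
    next
      case 3
      \<comment> \<open>The rest has degree 0. If it were nonempty, its first piece would have at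
        least two vertices and force positive degree.\<close>
      have "w ` (T - D) = {}"
      proof (rule ccontr)
        assume "w ` (T - D) \<noteq> {}"
        hence ne: "T - D \<noteq> {}" by auto
        define y where "y = Min (T - D)"
        have y: "y \<in> T - D" "\<And>z. z \<in> T - D \<Longrightarrow> y \<le> z"
          using ne finT Min_in[of "T - D"] Min_le[of "T - D"] by (simp_all add: y_def)
        have "Suc y \<in> T - D" using ghom_isolated_start[OF TD y] q by blast
        then obtain r where "Suc 0 = r + card ((T - D) \<inter> {y, Suc y, Suc (Suc y)})"
          using ghom_start[OF TD y(1) _ y(2) refl] q 3 by blast
        moreover have "card {y, Suc y} \<le> card ((T - D) \<inter> {y, Suc y, Suc (Suc y)})"
          using y \<open>Suc y \<in> T - D\<close> by (intro card_mono) auto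
        ultimately show False by simp
      qed
      hence "T - D = {}" by (simp only: image_is_empty)
      hence "card (T - D) = 0" by (simp only: card.empty)
      hence "card T \<le> 4" using cardT c by linarith
      \<comment> \<open>One edge is used for both sides: 2 + 2 vertices cover the three of
        D.\<close>
      moreover have "ghom TYPE('k) E (w ` {x, Suc x}) 1"
      proof -
        have "{x, Suc x} \<subseteq> {..<m}" using less.prems(1) x Sx by auto
        hence "ghom TYPE('k) E (w ` {x, Suc x}) 1 \<longleftrightarrow>
            (\<exists>q. 1 = Suc q \<and> ghom TYPE('k) E (w ` ({x, Suc x} - {x, Suc x})) q)"
          by (rule ghom_edge_start) auto
        thus ?thesis by (simp add: ghom_empty)
      qed
      ultimately show ?thesis using 3 x Sx
        by (intro exI[of _ "{x, Suc x}"] conjI) auto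
    qed
  qed
qed

text \<open>Peeling three vertices lowers the degree by 2 until 0, 1 or 2 vertices are left; a
  single vertex has no homology. This is the known pattern of path independence complexes:
  contractible for l = 1 mod 3, a sphere otherwise.\<close>

lemma ghom_interval:
  assumes "k + l \<le> m"
  shows "ghom TYPE('k::field) E (w ` {k..<k + l}) p \<longleftrightarrow>
    (\<exists>c. l = 3 * c \<and> p = 2 * c \<or> l = 3 * c + 2 \<and> p = 2 * c + 1)"
  using assms
proof (induction l arbitrary: k p rule: less_induct)
  case (less l)
  consider "l = 0" | "l = 1" | "l = 2" | "l \<ge> 3" by linarith
  thus ?case
  proof cases
    case 1
    thus ?thesis by (auto simp: ghom_empty)
  next
    case 2
    hence "\<not> ghom TYPE('k) E (w ` {k..<k + l}) p"
      using less.prems by (intro ghom_isolated_start[of _ k]) auto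
    moreover have "l \<noteq> 3 * c" "l \<noteq> 3 * c + 2" for c using 2 by presburger+
    ultimately show ?thesis by simp
  next
    case 3
    have *: "{k..<k + l} - {k, Suc k} = {}" using 3 by auto
    have "ghom TYPE('k) E (w ` {k..<k + l}) p \<longleftrightarrow>
        (\<exists>q. p = Suc q \<and> ghom TYPE('k) E (w ` ({k..<k + l} - {k, Suc k})) q)"
      using less.prems 3 by (intro ghom_edge_start) auto
    hence "ghom TYPE('k) E (w ` {k..<k + l}) p \<longleftrightarrow> p = 1"
      unfolding * by (simp add: ghom_empty)
    moreover have "l \<noteq> 3 * c" "l = 3 * c + 2 \<longleftrightarrow> c = 0" for c using 3 by presburger+
    ultimately show ?thesis by simp
  next
    case 4
    have *: "{k..<k + l} - {k, Suc k, Suc (Suc k)} = {k + 3..<k + 3 + (l - 3)}" using 4 by auto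
    have **: "card {k, Suc k, Suc (Suc k)} = 3" by simp
    have "ghom TYPE('k) E (w ` {k..<k + l}) p \<longleftrightarrow> (\<exists>q. Suc p = q + card {k, Suc k, Suc (Suc k)} \<and>
        ghom TYPE('k) E (w ` ({k..<k + l} - {k, Suc k, Suc (Suc k)})) q)"
      using less.prems 4 by (intro ghom_start[where x = k]) auto
    also have "\<dots> \<longleftrightarrow> (\<exists>q. Suc p = q + 3 \<and>
        (\<exists>c. l - 3 = 3 * c \<and> q = 2 * c \<or> l - 3 = 3 * c + 2 \<and> q = 2 * c + 1))"
      unfolding * ** using less.IH[of "l - 3" "k + 3"] less.prems 4 by simp
    also have "\<dots> \<longleftrightarrow> (\<exists>c. l = 3 * c \<and> p = 2 * c \<or> l = 3 * c + 2 \<and> p = 2 * c + 1)"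
    proof
      assume "\<exists>q. Suc p = q + 3 \<and> (\<exists>c. l - 3 = 3 * c \<and> q = 2 * c \<or> l - 3 = 3 * c + 2 \<and> q = 2 * c + 1)"
      then obtain q c where "Suc p = q + 3" "l - 3 = 3 * c \<and> q = 2 * c \<or> l - 3 = 3 * c + 2 \<and> q = 2 * c + 1"
        by blast
      thus "\<exists>c. l = 3 * c \<and> p = 2 * c \<or> l = 3 * c + 2 \<and> p = 2 * c + 1"
        using 4 by (intro exI[of _ "Suc c"]) auto
    next
      assume "\<exists>c. l = 3 * c \<and> p = 2 * c \<or> l = 3 * c + 2 \<and> p = 2 * c + 1"
      then obtain c where c: "l = 3 * c \<and> p = 2 * c \<or> l = 3 * c + 2 \<and> p = 2 * c + 1" ..
      then obtain d where "c = Suc d" using 4 by (cases c) auto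
      thus "\<exists>q. Suc p = q + 3 \<and> (\<exists>c. l - 3 = 3 * c \<and> q = 2 * c \<or> l - 3 = 3 * c + 2 \<and> q = 2 * c + 1)"
        using c by (intro exI[of _ "p - 2"] conjI exI[of _ d]) auto
    qed
    finally show ?thesis .
  qed
qed

lemma linear_or_ghom_image:
  assumes "T \<subseteq> {..<m}" "w ` {..<m} \<subseteq> V" "ghom TYPE('k::field) E (w ` T) a"
  shows "linear_or_ghom TYPE('k) E V a (card T)"
  unfolding linear_or_ghom_def using assms card_image[OF inj_on_subset[OF inj assms(1)]]
  by (intro disjI2 exI[of _ "w ` T"]) auto

lemma ghom_split':
  assumes "S \<subseteq> w ` {..<m}" "w ` {..<m} \<subseteq> V" "ghom TYPE('k::field) E S (a + b)"
  shows "\<exists>s t. card S \<le> s + t \<and> linear_or_ghom TYPE('k) E V a s \<and> linear_or_ghom TYPE('k) E V b t"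
proof -
  obtain T where T: "T \<subseteq> {..<m}" "S = w ` T" using assms(1) by (meson subset_imageE)
  have "ghom TYPE('k) E (w ` T) (a + b)" using assms(3) T(2) by simp
  from ghom_split[OF T(1) this] obtain T1 T2 where
    T12: "T1 \<subseteq> T" "T2 \<subseteq> T" "ghom TYPE('k) E (w ` T1) a" "ghom TYPE('k) E (w ` T2) b"
    "card T \<le> card T1 + card T2" by blast
  have "card S = card T" using T card_image[OF inj_on_subset[OF inj T(1)]] by simp
  moreover have "linear_or_ghom TYPE('k) E V a (card T1)" "linear_or_ghom TYPE('k) E V b (card T2)"
    using T(1) T12 assms(2) by (intro linear_or_ghom_image; auto)+
  ultimately show ?thesis using T12(5) by (intro exI conjI) auto
qed

lemma ghom_subadditive_path: "ghom_subadditive TYPE('k::field) E (w ` {..<m})"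
  unfolding ghom_subadditive_def using ghom_split'[OF _ order_refl] by blast

end

section \<open>Cycles\<close>

locale induced_cycle = edge_set +
  fixes v :: "nat \<Rightarrow> 'a" and n :: nat
  assumes inj: "inj_on v {..<n}" and n3: "n \<ge> 3"
    and adj: "i < n \<Longrightarrow> j < n \<Longrightarrow> {v i, v j} \<in> E \<longleftrightarrow> j = Suc i mod n \<or> i = Suc j mod n"
begin

text \<open>The numbering \<open>w\<close> starts just after k and runs once around; index n - 1 is
  k itself and is left out.\<close>

lemma remove_vertex:
  assumes "k < n" and w: "w = (\<lambda>i. v (Suc (i + k) mod n))"
  shows "induced_path E w (n - 1)" "w ` {..<n - 1} = v ` {..<n} - {v k}"
proof -
  define r where "r i = Suc (i + k) mod n" for i
  have r_less: "r i < n" for i using n3 by (simp add: r_def)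
  have r_explicit: "r i = (if i + Suc k < n then i + Suc k else i + Suc k - n)" if "i < n" for i
  proof (cases "i + Suc k < n")
    case False
    hence "r i = (i + Suc k - n) mod n" by (simp add: r_def le_mod_geq)
    thus ?thesis using False that assms(1) by simp
  qed (simp add: r_def)
  have inj_r: "inj_on r {..<n}"
    by (rule inj_onI) (auto simp: r_explicit split: if_splits)
  have r_Suc: "r (Suc i) = Suc (r i) mod n" for i
    by (simp add: r_def mod_Suc_eq)
  have wr: "w = v \<circ> r" by (auto simp: w r_def)
  have r_k: "r i = k \<longleftrightarrow> i = n - 1" if "i < n" for i
    using that assms(1) by (auto simp: r_explicit)
  have inj_w: "inj_on w {..<n}"
    unfolding wr using inj_r inj r_less by (intro comp_inj_on) (auto intro: inj_on_subset)
  show "induced_path E w (n - 1)"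
  proof
    show "inj_on w {..<n - 1}" using inj_w by (rule inj_on_subset) auto
    fix i j assume ij: "i < n - 1" "j < n - 1"
    have "{w i, w j} \<in> E \<longleftrightarrow> r j = r (Suc i) \<or> r i = r (Suc j)"
      using adj[OF r_less r_less, of i j] by (simp add: wr r_Suc)
    also have "\<dots> \<longleftrightarrow> j = Suc i \<or> i = Suc j"
      using inj_r ij by (auto dest: inj_onD)
    finally show "{w i, w j} \<in> E \<longleftrightarrow> j = Suc i \<or> i = Suc j" .
  qed
  have "r ` {..<n} = {..<n}"
    using inj_r r_less by (intro endo_inj_surj) auto
  have "r ` {..<n - 1} = {..<n} - {k}"
  proof
    show "r ` {..<n - 1} \<subseteq> {..<n} - {k}" using r_less r_k by force
    show "{..<n} - {k} \<subseteq> r ` {..<n - 1}"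
    proof
      fix j assume j: "j \<in> {..<n} - {k}"
      then obtain i where "i < n" "r i = j" using \<open>r ` {..<n} = {..<n}\<close> by (metis DiffD1 imageE lessThan_iff)
      moreover have "i \<noteq> n - 1" using r_k[of i] calculation j by auto
      ultimately show "j \<in> r ` {..<n - 1}" by force
    qed
  qed
  hence "w ` {..<n - 1} = v ` ({..<n} - {k})" by (simp only: wr image_comp[symmetric])
  also have "\<dots> = v ` {..<n} - {v k}"
    using inj_on_image_set_diff[OF inj, of "{..<n}" "{k}"] assms(1) by auto
  finally show "w ` {..<n - 1} = v ` {..<n} - {v k}" .
qed

text \<open>A proper subset misses a vertex and therefore lies in a path. For the full vertex set no
  splitting is attempted: the exact sequence at one vertex bounds n in terms of a + b, and intervals
  are supplied as witnesses.\<close>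

lemma ghom_subadditive_cycle: "ghom_subadditive TYPE('k::field) E (v ` {..<n})"
  unfolding ghom_subadditive_def
proof (intro allI impI)
  fix S a b assume S: "S \<subseteq> v ` {..<n}" and ab: "0 < a" "0 < b" and g: "ghom TYPE('k) E S (a + b)"
  let ?V = "v ` {..<n}"
  show "\<exists>s t. card S \<le> s + t \<and> linear_or_ghom TYPE('k) E ?V a s \<and> linear_or_ghom TYPE('k) E ?V b t"
  proof (cases "S = ?V")
    case False
    then obtain k where k: "k < n" "v k \<notin> S" using S by auto
    define w where "w = (\<lambda>i. v (Suc (i + k) mod n))"
    interpret P: induced_path E w "n - 1" using remove_vertex(1)[OF k(1) w_def] .
    have "S \<subseteq> w ` {..<n - 1}" "w ` {..<n - 1} \<subseteq> ?V"
      unfolding remove_vertex(2)[OF k(1) w_def] using S k by auto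
    thus ?thesis using g by (rule P.ghom_split')
  next
    case True
    define w where "w = (\<lambda>i. v (Suc (i + 0) mod n))"
    have n0: "0 < n" using n3 by simp
    interpret P: induced_path E w "n - 1" using remove_vertex(1)[OF n0 w_def] .
    have wV: "w ` {..<n - 1} = ?V - {v 0}" using remove_vertex(2)[OF n0 w_def] .
    have nb: "nbrs E ?V (v 0) = {w 0, w (n - 2)}"
    proof -
      have "nbrs E ?V (v 0) = v ` {i \<in> {..<n}. 0 = Suc i mod n \<or> i = Suc 0 mod n}"
        using adj[OF _ n0] by (auto simp: nbrs_def)
      also have "{i \<in> {..<n}. 0 = Suc i mod n \<or> i = Suc 0 mod n} = {1, n - 1}"
        using n3 by (auto simp: mod_Suc split: if_splits)
      also have "v ` {1, n - 1} = {w 0, w (n - 2)}"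
      proof -
        have "Suc (n - 2 + 0) mod n = n - 1" "Suc (0 + 0) mod n = 1" using n3 by auto
        thus ?thesis unfolding w_def by simp
      qed
      finally show ?thesis .
    qed
    have "w 0 \<noteq> w (n - 2)"
    proof
      assume "w 0 = w (n - 2)"
      moreover have "0 \<in> {..<n - 1}" "n - 2 \<in> {..<n - 1}" unfolding lessThan_iff using n3 by arith+
      ultimately have "0 = n - 2" by (rule inj_onD[OF P.inj])
      thus False using n3 by simp
    qed
    hence card2: "card (nbrs E ?V (v 0)) = 2" by (simp add: nb)
    have "{w 0, w (n - 2)} = w ` {0, n - 2}" by simp
    hence "?V - {v 0} - nbrs E ?V (v 0) = w ` ({..<n - 1} - {0, n - 2})"
    proof -
      have "{0, n - 2} \<subseteq> {..<n - 1}" using n3 by force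
      from P.image_Diff[OF order_refl this] show ?thesis unfolding wV[symmetric] nb by simp
    qed
    also have "{..<n - 1} - {0, n - 2} = {1..<1 + (n - 3)}" using n3 by force
    finally have link: "?V - {v 0} - nbrs E ?V (v 0) = w ` {1..<1 + (n - 3)}" .
    have del: "?V - {v 0} = w ` {0..<0 + (n - 1)}" by (simp only: wV add_0 flip: lessThan_atLeast0)
    \<comment> \<open>The length of the interval with homology in degree a, by
      \<open>ghom_interval\<close>: 3c for a = 2c and 3c + 2 for a = 2c + 1.\<close>
    define f where "f a = a + (a + 1) div 2" for a :: nat
    have f: "linear_or_ghom TYPE('k) E ?V a (f a)" if "f a \<le> n - 1" for a
    proof -
      have "\<exists>c. f a = 3 * c \<and> a = 2 * c \<or> f a = 3 * c + 2 \<and> a = 2 * c + 1"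
        unfolding f_def by presburger
      hence "ghom TYPE('k) E (w ` {0..<0 + f a}) a" using that by (subst P.ghom_interval) auto
      moreover have "{0..<0 + f a} \<subseteq> {..<n - 1}" using that by auto
      moreover have "w ` {..<n - 1} \<subseteq> ?V" unfolding wV by auto
      ultimately have "linear_or_ghom TYPE('k) E ?V a (card {0..<0 + f a})"
        using P.linear_or_ghom_image by blast
      thus ?thesis by simp
    qed
    have "ghom TYPE('k) E ?V (a + b)" using g True by simp
    \<comment> \<open>Deleting a vertex leaves an interval of n - 1 vertices and yields the first
      two alternatives. The link is an interval of n - 3 vertices with shift 2 and yields the last
      two.\<close>
    hence "\<exists>c. a + b = 2 * c + 1 \<and> n = 3 * c + 1 \<or> a + b = 2 * c + 2 \<and> n = 3 * c + 3 \<or>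
        a + b = 2 * c + 3 \<and> n = 3 * c + 5"
    proof (cases rule: ghom_cases[where v = "v 0", consumes 1, case_names fin mem deletion link])
      case (deletion q)
      hence "\<exists>c. n - 1 = 3 * c \<and> q = 2 * c \<or> n - 1 = 3 * c + 2 \<and> q = 2 * c + 1"
        using P.ghom_interval[where 'k = 'k, of 0 "n - 1" q] unfolding del by simp
      then obtain c where "n - 1 = 3 * c \<and> q = 2 * c \<or> n - 1 = 3 * c + 2 \<and> q = 2 * c + 1" ..
      thus ?thesis using deletion(1) n3 by (intro exI[of _ c]) auto
    next
      case link': link
      have "1 + (n - 3) \<le> n - 1" using n3 by simp
      hence "\<exists>c. n - 3 = 3 * c \<and> a + b - 2 = 2 * c \<or> n - 3 = 3 * c + 2 \<and> a + b - 2 = 2 * c + 1"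
        using link'(2) P.ghom_interval[where 'k = 'k, of 1 "n - 3" "a + b - 2"] unfolding link card2 by simp
      then obtain c where
        "n - 3 = 3 * c \<and> a + b - 2 = 2 * c \<or> n - 3 = 3 * c + 2 \<and> a + b - 2 = 2 * c + 1" ..
      thus ?thesis using link'(1) n3 card2 by (intro exI[of _ c]) auto
    qed (use n0 in auto)
    then obtain c where c: "a + b = 2 * c + 1 \<and> n = 3 * c + 1 \<or> a + b = 2 * c + 2 \<and> n = 3 * c + 3 \<or>
        a + b = 2 * c + 3 \<and> n = 3 * c + 5" ..
    \<comment> \<open>The upper bounds need both a and b positive, so that neither interval wraps
      around the cycle. The lower bound is 3(a + b)/2, rounded up to an integer.\<close>
    have "f a \<le> n - 1" "f b \<le> n - 1" "n \<le> f a + f b"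
    proof -
      have f2: "3 * a \<le> 2 * f a" "2 * f a \<le> 3 * a + 1" for a unfolding f_def by presburger+
      show "f a \<le> n - 1" "f b \<le> n - 1" "n \<le> f a + f b"
        using c ab f2[of a] f2[of b] by linarith+
    qed
    moreover have "card S = n" using True card_image[OF inj] by simp
    ultimately show ?thesis using f by (intro exI[of _ "f a"] exI[of _ "f b"]) simp
  qed
qed

end

section \<open>The Koszul complex over the polynomial ring\<close>

lemma sum_single_lookup:
  "q = (\<Sum>m\<in>Poly_Mapping.keys q. Poly_Mapping.single m (Poly_Mapping.lookup q m))"
proof (rule poly_mapping_eqI)
  fix k
  have "(\<Sum>m\<in>Poly_Mapping.keys q. Poly_Mapping.lookup (Poly_Mapping.single m (Poly_Mapping.lookup q m)) k) =
      (\<Sum>m\<in>Poly_Mapping.keys q. if m = k then Poly_Mapping.lookup q m else 0)"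
    by (intro sum.cong) (auto simp: lookup_single when_def)
  thus "Poly_Mapping.lookup q k = Poly_Mapping.lookup
      (\<Sum>m\<in>Poly_Mapping.keys q. Poly_Mapping.single m (Poly_Mapping.lookup q m)) k"
    by (simp add: lookup_sum in_keys_iff)
qed

lemma lookup_single_mult:
  fixes q :: "('v, 'k::field) mpoly"
  shows "Poly_Mapping.lookup (Poly_Mapping.single s c * q) k =
    (\<Sum>m\<in>Poly_Mapping.keys q. if s + m = k then c * Poly_Mapping.lookup q m else 0)"
proof -
  have "Poly_Mapping.single s c * q =
      (\<Sum>m\<in>Poly_Mapping.keys q. Poly_Mapping.single (s + m) (c * Poly_Mapping.lookup q m))"
    by (subst sum_single_lookup[of q]) (simp only: sum_distrib_left mult_single)
  thus ?thesis by (simp add: lookup_sum lookup_single when_def)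
qed

lemma lookup_pvar_mult:
  fixes q :: "('v, 'k::field) mpoly"
  shows "Poly_Mapping.lookup (pvar v * q) m =
    (if v \<in> Poly_Mapping.keys m then Poly_Mapping.lookup q (m - Poly_Mapping.single v 1) else 0)"
proof (cases "v \<in> Poly_Mapping.keys m")
  case True
  have "m = Poly_Mapping.single v 1 + (m - Poly_Mapping.single v 1)"
  proof (rule poly_mapping_eqI)
    fix u
    show "Poly_Mapping.lookup m u =
        Poly_Mapping.lookup (Poly_Mapping.single v 1 + (m - Poly_Mapping.single v 1)) u"
      using True by (auto simp: lookup_add lookup_minus lookup_single when_def in_keys_iff)
  qed
  hence "Poly_Mapping.single v 1 + r = m \<longleftrightarrow> r = m - Poly_Mapping.single v 1" for r
    by (metis add_diff_cancel_left')
  hence "Poly_Mapping.lookup (pvar v * q) m =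
      (\<Sum>r\<in>Poly_Mapping.keys q. if r = m - Poly_Mapping.single v 1 then Poly_Mapping.lookup q r else 0)"
    unfolding pvar_def lookup_single_mult by simp
  thus ?thesis using True by (simp add: in_keys_iff)
next
  case False
  have "Poly_Mapping.single v 1 + r \<noteq> m" for r
  proof
    assume m: "Poly_Mapping.single v 1 + r = m"
    hence "Poly_Mapping.lookup m v = 1 + Poly_Mapping.lookup r v"
      by (simp add: lookup_add flip: m)
    thus False using False by (simp add: in_keys_iff)
  qed
  thus ?thesis unfolding pvar_def lookup_single_mult using False by simp
qed

lemma ksign_parity: "(ksign u t :: 'a::comm_ring_1) = (if even (card {w \<in> t. (w, u) \<in> vorder}) then 1 else -1)"
  by (simp add: ksign_def)

lemma lookup_ksign_mult:
  fixes q :: "('v, 'k::field) mpoly"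
  shows "Poly_Mapping.lookup (ksign u t * q) m = ksign u t * Poly_Mapping.lookup q m"
  unfolding ksign_parity by simp

lemma polys_zero [simp]: "0 \<in> polys V"
  by (simp add: polys_def)

lemma polys_add: "p \<in> polys V \<Longrightarrow> q \<in> polys V \<Longrightarrow> p + q \<in> polys V"
  using Poly_Mapping.keys_add[of p q] by (auto simp: polys_def)

lemma polys_uminus: "p \<in> polys V \<Longrightarrow> - p \<in> polys V"
  by (auto simp: polys_def in_keys_iff)

lemma polys_diff: "p \<in> polys V \<Longrightarrow> q \<in> polys V \<Longrightarrow> p - q \<in> polys V"
  using polys_add[of p V "- q"] polys_uminus[of q V] by simp

lemma polys_mult:
  assumes "p \<in> polys V" "q \<in> polys V"
  shows "p * q \<in> polys V"
  unfolding polys_def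
proof (intro CollectI ballI)
  fix m assume "m \<in> Poly_Mapping.keys (p * q)"
  then obtain a b where "a \<in> Poly_Mapping.keys p" "b \<in> Poly_Mapping.keys q" "m = a + b"
    using keys_mult[of p q] by auto
  thus "Poly_Mapping.keys m \<subseteq> V"
    using assms Poly_Mapping.keys_add[of a b] unfolding polys_def by blast
qed

lemma polys_sum: "(\<And>i. i \<in> A \<Longrightarrow> f i \<in> polys V) \<Longrightarrow> (\<Sum>i\<in>A. f i) \<in> polys V"
  by (induction A rule: infinite_finite_induct) (auto intro: polys_add)

lemma polys_single: "Poly_Mapping.keys m \<subseteq> V \<Longrightarrow> Poly_Mapping.single m c \<in> polys V"
  by (auto simp: polys_def)

lemma polys_pvar: "v \<in> V \<Longrightarrow> pvar v \<in> polys V"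
  unfolding pvar_def by (rule polys_single) auto

lemma polys_one [simp]: "1 \<in> polys V"
  by (simp add: polys_def)

lemma polys_ksign_mult: "p \<in> polys V \<Longrightarrow> ksign u t * p \<in> polys V"
  unfolding ksign_parity by (auto intro: polys_uminus)

lemma polys_koszul:
  assumes "\<And>u. u \<in> V - t \<Longrightarrow> c (insert u t) \<in> polys V"
  shows "koszul pvar V c t \<in> polys V"
  unfolding koszul_def using assms
  by (intro polys_sum) (auto simp: mult.assoc intro!: polys_ksign_mult polys_mult polys_pvar)

lemma lookup_koszul:
  fixes c :: "'v set \<Rightarrow> ('v, 'k::field) mpoly"
  assumes "finite V"
  shows "Poly_Mapping.lookup (koszul pvar V c t) m =
    (\<Sum>v\<in>V \<inter> Poly_Mapping.keys m - t. ksign v t * Poly_Mapping.lookup (c (insert v t)) (m - Poly_Mapping.single v 1))"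
proof -
  have "Poly_Mapping.lookup (koszul pvar V c t) m = (\<Sum>v\<in>V - t. ksign v t *
      (if v \<in> Poly_Mapping.keys m then Poly_Mapping.lookup (c (insert v t)) (m - Poly_Mapping.single v 1) else 0))"
    unfolding koszul_def lookup_sum by (simp only: mult.assoc lookup_ksign_mult lookup_pvar_mult)
  also have "\<dots> = (\<Sum>v\<in>V \<inter> Poly_Mapping.keys m - t.
      ksign v t * Poly_Mapping.lookup (c (insert v t)) (m - Poly_Mapping.single v 1))"
    using assms by (intro sum.mono_neutral_cong_right) auto
  finally show ?thesis .
qed

section \<open>Multidegrees of the Koszul complex\<close>

definition sqfree_mon :: "'v set \<Rightarrow> 'v \<Rightarrow>\<^sub>0 nat" where
  "sqfree_mon t = (\<Sum>v\<in>t. Poly_Mapping.single v 1)"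

lemma lookup_sqfree_mon: "finite t \<Longrightarrow> Poly_Mapping.lookup (sqfree_mon t) v = (if v \<in> t then 1 else 0)"
  by (simp add: sqfree_mon_def lookup_sum lookup_single when_def)

lemma keys_sqfree_mon [simp]: "finite t \<Longrightarrow> Poly_Mapping.keys (sqfree_mon t) = t"
  by (auto simp: in_keys_iff lookup_sqfree_mon split: if_splits)

lemma sqfree_mon_insert: "finite t \<Longrightarrow> v \<notin> t \<Longrightarrow> sqfree_mon (insert v t) = Poly_Mapping.single v 1 + sqfree_mon t"
  by (simp add: sqfree_mon_def)

lemma keys_add_nat: "Poly_Mapping.keys (a + b :: 'v \<Rightarrow>\<^sub>0 nat) = Poly_Mapping.keys a \<union> Poly_Mapping.keys b"
  by (auto simp: in_keys_iff lookup_add)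

lemma minus_sqfree_mon_add:
  assumes "finite t" "t \<subseteq> Poly_Mapping.keys m"
  shows "m - sqfree_mon t + sqfree_mon t = m"
proof (rule poly_mapping_eqI)
  fix u
  show "Poly_Mapping.lookup (m - sqfree_mon t + sqfree_mon t) u = Poly_Mapping.lookup m u"
    using assms by (auto simp: lookup_add lookup_minus lookup_sqfree_mon in_keys_iff subset_iff)
qed

lemma minus_sqfree_mon_insert:
  assumes "finite t" "v \<notin> t"
  shows "m - sqfree_mon t - Poly_Mapping.single v 1 = m - sqfree_mon (insert v t)"
  using assms by (simp add: sqfree_mon_insert diff_diff_add add.commute)

text \<open>The differential preserves multidegrees. In multidegree mu the coefficient at t is a
  scalar multiple of the monomial mu/x^t, so a chain of polynomials is a family of scalar chains on
  the subsets of the support of mu. Working modulo the monomials with \<open>P\<close> restricts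
  this to the sets t where \<open>P\<close> fails for mu/x^t.\<close>

lemma koszul_exact_of_multidegrees:
  fixes c :: "'v set \<Rightarrow> ('v, 'k::field) mpoly"
  assumes fin: "finite V"
    and c: "\<And>t. t \<subseteq> V \<Longrightarrow> card t = p \<Longrightarrow> c t \<in> polys V"
    and cyc: "\<And>t m. t \<subseteq> V \<Longrightarrow> Suc (card t) = p \<Longrightarrow> m \<in> Poly_Mapping.keys (koszul pvar V c t) \<Longrightarrow> P m"
    and ac: "\<And>t m. t \<subseteq> V \<Longrightarrow> card t = p \<Longrightarrow> m \<in> Poly_Mapping.keys (c t) \<Longrightarrow>
      \<not> khom TYPE('k) (Poly_Mapping.keys (m + sqfree_mon t)) (\<lambda>s. \<not> P (m + sqfree_mon t - sqfree_mon s)) p"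
  shows "\<exists>b. (\<forall>t. b t \<in> polys V) \<and> (\<forall>t. t \<subseteq> V \<longrightarrow> card t = p \<longrightarrow>
    (\<forall>m\<in>Poly_Mapping.keys (c t - koszul pvar V b t). P m))"
proof -
  \<comment> \<open>The multidegrees that occur in the chain; finitely many, so the scalar solutions
    can be summed to polynomials.\<close>
  define M where "M = (\<Union>t\<in>{t. t \<subseteq> V \<and> card t = p}. (\<lambda>m. m + sqfree_mon t) ` Poly_Mapping.keys (c t))"
  have finM: "finite M" using fin by (auto simp: M_def)
  have finV: "finite t" if "t \<subseteq> V" for t using that fin finite_subset by blast
  have keysM: "Poly_Mapping.keys \<mu> \<subseteq> V" if \<mu>: "\<mu> \<in> M" for \<mu>
  proof -
    obtain t m where t: "t \<subseteq> V" "card t = p" "m \<in> Poly_Mapping.keys (c t)" "\<mu> = m + sqfree_mon t"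
      using \<mu> unfolding M_def by blast
    thus ?thesis using c[OF t(1,2)] finV[OF t(1)] by (auto simp: keys_add_nat polys_def)
  qed
  define g where "g \<mu> t = Poly_Mapping.lookup (c t) (\<mu> - sqfree_mon t)" for \<mu> t
  have "\<exists>h. \<forall>t. t \<subseteq> Poly_Mapping.keys \<mu> \<longrightarrow> \<not> P (\<mu> - sqfree_mon t) \<longrightarrow> card t = p \<longrightarrow>
      g \<mu> t = bd (Poly_Mapping.keys \<mu>) h t" if \<mu>: "\<mu> \<in> M" for \<mu>
  proof (rule not_khomD)
    show "\<not> khom TYPE('k) (Poly_Mapping.keys \<mu>) (\<lambda>t. \<not> P (\<mu> - sqfree_mon t)) p"
      using \<mu> ac unfolding M_def by blast
    fix t assume t: "t \<subseteq> Poly_Mapping.keys \<mu>" "\<not> P (\<mu> - sqfree_mon t)" "Suc (card t) = p"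
    have tV: "t \<subseteq> V" "finite t" using t keysM[OF \<mu>] finV by auto
    have "Poly_Mapping.lookup (koszul pvar V c t) (\<mu> - sqfree_mon t) = 0"
      using cyc[OF tV(1) t(3)] t(2) by (meson in_keys_iff)
    hence "(\<Sum>v\<in>V \<inter> Poly_Mapping.keys (\<mu> - sqfree_mon t) - t. ksign v t *
        Poly_Mapping.lookup (c (insert v t)) (\<mu> - sqfree_mon t - Poly_Mapping.single v 1)) = 0"
      unfolding lookup_koszul[OF fin] .
    also have "V \<inter> Poly_Mapping.keys (\<mu> - sqfree_mon t) - t = Poly_Mapping.keys \<mu> - t"
      using keysM[OF \<mu>] tV by (auto simp: in_keys_iff lookup_minus lookup_sqfree_mon)
    also have "(\<Sum>v\<in>Poly_Mapping.keys \<mu> - t. ksign v t *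
        Poly_Mapping.lookup (c (insert v t)) (\<mu> - sqfree_mon t - Poly_Mapping.single v 1)) =
        bd (Poly_Mapping.keys \<mu>) (g \<mu>) t"
      unfolding koszul_def g_def using tV by (intro sum.cong) (auto simp: minus_sqfree_mon_insert simp del: One_nat_def)
    finally show "bd (Poly_Mapping.keys \<mu>) (g \<mu>) t = 0" .
  qed
  then obtain h where h: "\<And>\<mu> t. \<mu> \<in> M \<Longrightarrow> t \<subseteq> Poly_Mapping.keys \<mu> \<Longrightarrow> \<not> P (\<mu> - sqfree_mon t) \<Longrightarrow>
      card t = p \<Longrightarrow> g \<mu> t = bd (Poly_Mapping.keys \<mu>) (h \<mu>) t"
    by metis
  \<comment> \<open>Subtraction of exponents is truncated; without the restriction to t inside the
    support of mu it would produce monomials of the wrong multidegree.\<close>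
  define b where "b t = (\<Sum>\<mu>\<in>{\<mu> \<in> M. t \<subseteq> Poly_Mapping.keys \<mu>}. Poly_Mapping.single (\<mu> - sqfree_mon t) (h \<mu> t))" for t
  have b_polys: "b t \<in> polys V" for t
  proof -
    have "Poly_Mapping.keys (\<mu> - sqfree_mon t) \<subseteq> V" if "\<mu> \<in> M" for \<mu>
      using keysM[OF that] by (auto simp: in_keys_iff lookup_minus subset_iff)
    thus ?thesis unfolding b_def by (intro polys_sum polys_single) auto
  qed
  have lookup_b: "Poly_Mapping.lookup (b t) m = (if m + sqfree_mon t \<in> M then h (m + sqfree_mon t) t else 0)"
    if "finite t" for t m
  proof -
    have eq: "\<mu> - sqfree_mon t = m \<longleftrightarrow> \<mu> = m + sqfree_mon t" if "t \<subseteq> Poly_Mapping.keys \<mu>" for \<mu>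
      using minus_sqfree_mon_add[OF \<open>finite t\<close> that] by auto
    have "Poly_Mapping.lookup (b t) m =
        (\<Sum>\<mu>\<in>{\<mu> \<in> M. t \<subseteq> Poly_Mapping.keys \<mu>}. if \<mu> = m + sqfree_mon t then h (m + sqfree_mon t) t else 0)"
      unfolding b_def lookup_sum by (intro sum.cong) (auto simp: lookup_single when_def eq)
    also have "\<dots> = (if m + sqfree_mon t \<in> M then h (m + sqfree_mon t) t else 0)"
      using finM that by (auto simp: sum.delta keys_add_nat)
    finally show ?thesis .
  qed
  have "P m" if t: "t \<subseteq> V" "card t = p" and m: "m \<in> Poly_Mapping.keys (c t - koszul pvar V b t)" for t m
  proof (rule ccontr)
    assume nP: "\<not> P m"
    define \<mu> where "\<mu> = m + sqfree_mon t"
    have ft: "finite t" using finV t by blast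
    have "m - Poly_Mapping.single v 1 + sqfree_mon (insert v t) = \<mu>"
      if "v \<in> Poly_Mapping.keys m" "v \<notin> t" for v
    proof -
      have "m - Poly_Mapping.single v 1 + Poly_Mapping.single v 1 = m"
        using minus_sqfree_mon_add[of "{v}" m] that by (simp add: sqfree_mon_def)
      thus ?thesis using ft that by (simp add: sqfree_mon_insert \<mu>_def add.assoc[symmetric])
    qed
    hence "Poly_Mapping.lookup (koszul pvar V b t) m = (\<Sum>v\<in>V \<inter> Poly_Mapping.keys m - t.
        ksign v t * (if \<mu> \<in> M then h \<mu> (insert v t) else 0))"
      unfolding lookup_koszul[OF fin] using ft by (intro sum.cong) (auto simp: lookup_b)
    moreover have "\<mu> - sqfree_mon t = m" by (simp add: \<mu>_def)
    ultimately have "Poly_Mapping.lookup (koszul pvar V b t) m = Poly_Mapping.lookup (c t) m"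
    proof (cases "\<mu> \<in> M")
      case True
      have "V \<inter> Poly_Mapping.keys m - t = Poly_Mapping.keys \<mu> - t" "t \<subseteq> Poly_Mapping.keys \<mu>"
        using keysM[OF True] ft by (auto simp: \<mu>_def keys_add_nat)
      with \<open>Poly_Mapping.lookup (koszul pvar V b t) m = _\<close>
      have "Poly_Mapping.lookup (koszul pvar V b t) m = bd (Poly_Mapping.keys \<mu>) (h \<mu>) t"
        using True by (simp add: koszul_def)
      also have "\<dots> = g \<mu> t"
        using h[OF True] \<open>t \<subseteq> Poly_Mapping.keys \<mu>\<close> \<open>\<mu> - sqfree_mon t = m\<close> nP t(2) by simp
      finally show ?thesis using \<open>\<mu> - sqfree_mon t = m\<close> by (simp add: g_def)
    next
      case False
      have "m \<notin> Poly_Mapping.keys (c t)" using False t by (auto simp: M_def \<mu>_def)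
      thus ?thesis
        using False \<open>Poly_Mapping.lookup (koszul pvar V b t) m = _\<close> by (simp add: in_keys_iff)
    qed
    thus False using m by (simp add: in_keys_iff lookup_minus)
  qed
  thus ?thesis using b_polys by blast
qed

text \<open>In a nonzero multidegree all subsets of the support are allowed, which is a cone.
  Multidegree 0 occurs only for p = 0 and is excluded by the condition on the constant term. So the
  Koszul complex of the variables resolves the residue field.\<close>

lemma koszul_exact:
  fixes c :: "'v set \<Rightarrow> ('v, 'k::field) mpoly"
  assumes fin: "finite V"
    and c: "\<And>t. t \<subseteq> V \<Longrightarrow> card t = p \<Longrightarrow> c t \<in> polys V"
    and cyc: "\<And>t. t \<subseteq> V \<Longrightarrow> Suc (card t) = p \<Longrightarrow> koszul pvar V c t = 0"
    and 0: "p = 0 \<Longrightarrow> Poly_Mapping.lookup (c {}) 0 = 0"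
  shows "\<exists>b. (\<forall>t. b t \<in> polys V) \<and> (\<forall>t. t \<subseteq> V \<longrightarrow> card t = p \<longrightarrow> c t = koszul pvar V b t)"
proof -
  have "\<exists>b. (\<forall>t. b t \<in> polys V) \<and> (\<forall>t. t \<subseteq> V \<longrightarrow> card t = p \<longrightarrow>
    (\<forall>m\<in>Poly_Mapping.keys (c t - koszul pvar V b t). False))"
  proof (rule koszul_exact_of_multidegrees[OF fin c])
    fix t m assume t: "t \<subseteq> V" "card t = p" "m \<in> Poly_Mapping.keys (c t)"
    have ft: "finite t" using t fin finite_subset by blast
    have "Poly_Mapping.keys (m + sqfree_mon t) \<noteq> {}"
    proof (cases "p = 0")
      case True
      hence "t = {}" using t ft by simp
      hence "m \<noteq> 0" using t(3) 0[OF True] by (auto simp: in_keys_iff)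
      thus ?thesis by (auto simp: keys_add_nat)
    next
      case False
      hence "t \<noteq> {}" using t by auto
      thus ?thesis using ft by (auto simp: keys_add_nat)
    qed
    then obtain v where "v \<in> Poly_Mapping.keys (m + sqfree_mon t)" by blast
    thus "\<not> khom TYPE('k) (Poly_Mapping.keys (m + sqfree_mon t)) (\<lambda>s. \<not> False) p"
      by (intro not_khom_cone) auto
  qed (use cyc in auto)
  thus ?thesis by auto
qed

section \<open>Koszul homology and minimal resolutions\<close>

definition hom_part :: "int \<Rightarrow> ('v, 'k::field) mpoly \<Rightarrow> ('v, 'k) mpoly" where
  "hom_part d p = (\<Sum>m\<in>{m \<in> Poly_Mapping.keys p. int (mono_degree m) = d}.
     Poly_Mapping.single m (Poly_Mapping.lookup p m))"

lemma lookup_hom_part: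
  "Poly_Mapping.lookup (hom_part d p) m = (if int (mono_degree m) = d then Poly_Mapping.lookup p m else 0)"
proof -
  have "Poly_Mapping.lookup (hom_part d p) m =
      (\<Sum>k\<in>{k \<in> Poly_Mapping.keys p. int (mono_degree k) = d}. if k = m then Poly_Mapping.lookup p m else 0)"
    unfolding hom_part_def lookup_sum by (intro sum.cong) (auto simp: lookup_single when_def)
  thus ?thesis by (simp add: in_keys_iff)
qed

lemma mono_degree_add: "mono_degree (a + b) = mono_degree a + mono_degree b"
proof -
  have *: "mono_degree m = (\<Sum>v\<in>Poly_Mapping.keys a \<union> Poly_Mapping.keys b. Poly_Mapping.lookup m v)"
    if "Poly_Mapping.keys m \<subseteq> Poly_Mapping.keys a \<union> Poly_Mapping.keys b" for m
    unfolding mono_degree_def using that by (intro sum.mono_neutral_left) (auto simp: in_keys_iff)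
  show ?thesis
    by (simp add: *[of "a + b"] *[of a] *[of b] keys_add_nat lookup_add sum.distrib)
qed

lemma mono_degree_sqfree_mon: "finite t \<Longrightarrow> mono_degree (sqfree_mon t) = card t"
  by (simp add: mono_degree_def lookup_sqfree_mon)

lemma mono_degree_0 [simp]: "mono_degree 0 = 0"
  by (simp add: mono_degree_def)

lemma homogeneous_iff:
  "homogeneous d p \<longleftrightarrow> (\<forall>m. Poly_Mapping.lookup p m \<noteq> 0 \<longrightarrow> int (mono_degree m) = d)"
  by (auto simp: homogeneous_def in_keys_iff)

lemma hom_part_homogeneous: "homogeneous d p \<Longrightarrow> hom_part d p = p"
  by (rule poly_mapping_eqI) (auto simp: lookup_hom_part homogeneous_iff)

lemma homogeneous_hom_part: "homogeneous d (hom_part d p)"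
  by (simp add: lookup_hom_part homogeneous_iff)

lemma hom_part_add: "hom_part d (p + q) = hom_part d p + hom_part d q"
  by (rule poly_mapping_eqI) (simp add: lookup_hom_part lookup_add)

lemma hom_part_diff: "hom_part d (p - q) = hom_part d p - hom_part d q"
  by (rule poly_mapping_eqI) (simp add: lookup_hom_part lookup_minus)

lemma hom_part_0 [simp]: "hom_part d 0 = 0"
  by (rule poly_mapping_eqI) (simp add: lookup_hom_part)

lemma hom_part_sum: "hom_part d (\<Sum>i\<in>A. f i) = (\<Sum>i\<in>A. hom_part d (f i))"
  by (induction A rule: infinite_finite_induct) (auto simp: hom_part_add)

lemma hom_part_ksign_mult: "hom_part d (ksign u t * p) = ksign u t * hom_part d p"
  by (rule poly_mapping_eqI) (simp add: lookup_hom_part lookup_ksign_mult)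

lemma keys_hom_part: "m \<in> Poly_Mapping.keys (hom_part d p) \<Longrightarrow> m \<in> Poly_Mapping.keys p"
  by (auto simp: in_keys_iff lookup_hom_part split: if_splits)

lemma polys_hom_part: "p \<in> polys V \<Longrightarrow> hom_part d p \<in> polys V"
  using keys_hom_part by (fastforce simp: polys_def)

lemma homogeneous_zero [simp]: "homogeneous d 0"
  by (simp add: homogeneous_def)

lemma homogeneous_one: "homogeneous 0 1"
  by (simp add: homogeneous_def)

lemma homogeneous_add: "homogeneous d p \<Longrightarrow> homogeneous d q \<Longrightarrow> homogeneous d (p + q)"
  unfolding homogeneous_def using Poly_Mapping.keys_add[of p q] by blast

lemma homogeneous_sum: "(\<And>i. i \<in> A \<Longrightarrow> homogeneous d (f i)) \<Longrightarrow> homogeneous d (\<Sum>i\<in>A. f i)"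
  by (induction A rule: infinite_finite_induct) (auto intro: homogeneous_add)

lemma homogeneous_mult:
  assumes "homogeneous d p" "homogeneous e q"
  shows "homogeneous (d + e) (p * q)"
  unfolding homogeneous_def
proof
  fix m assume "m \<in> Poly_Mapping.keys (p * q)"
  then obtain a b where "a \<in> Poly_Mapping.keys p" "b \<in> Poly_Mapping.keys q" "m = a + b"
    using keys_mult[of p q] by blast
  thus "int (mono_degree m) = d + e" using assms by (simp add: homogeneous_def mono_degree_add)
qed

lemma homogeneous_pvar: "homogeneous 1 (pvar v)"
  unfolding pvar_def homogeneous_def by (simp add: mono_degree_def)

lemma homogeneous_ksign_mult: "homogeneous d p \<Longrightarrow> homogeneous d (ksign u t * p)"
  by (simp add: homogeneous_iff lookup_ksign_mult)

lemma hom_part_mult: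
  assumes p: "homogeneous e p"
  shows "hom_part (e + d) (p * q) = p * hom_part d q"
proof -
  define r where "r = q - hom_part d q"
  have "hom_part (e + d) (p * r) = 0"
  proof (rule poly_mapping_eqI)
    fix m
    show "Poly_Mapping.lookup (hom_part (e + d) (p * r)) m = Poly_Mapping.lookup 0 m"
    proof (cases "m \<in> Poly_Mapping.keys (p * r)")
      case True
      then obtain a b where ab: "a \<in> Poly_Mapping.keys p" "b \<in> Poly_Mapping.keys r" "m = a + b"
        using keys_mult[of p r] by blast
      have "int (mono_degree a) = e" using ab p by (simp add: homogeneous_def)
      moreover have "int (mono_degree b) \<noteq> d"
        using ab(2) by (auto simp: r_def in_keys_iff lookup_minus lookup_hom_part)
      ultimately show ?thesis using ab by (simp add: lookup_hom_part mono_degree_add)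
    qed (simp add: lookup_hom_part in_keys_iff)
  qed
  moreover have "p * q = p * hom_part d q + p * r" by (simp add: r_def algebra_simps)
  moreover have "homogeneous (e + d) (p * hom_part d q)"
    by (intro homogeneous_mult p homogeneous_hom_part)
  ultimately show ?thesis by (simp add: hom_part_add hom_part_homogeneous)
qed

lemma homogeneous_koszul:
  assumes "\<And>u. u \<in> V - t \<Longrightarrow> homogeneous d (c (insert u t))"
  shows "homogeneous (1 + d) (koszul pvar V c t)"
  unfolding koszul_def using assms
  by (intro homogeneous_sum) (auto simp: mult.assoc intro!: homogeneous_ksign_mult homogeneous_mult homogeneous_pvar)

lemma hom_part_koszul: "hom_part (1 + d) (koszul pvar V c t) = koszul pvar V (\<lambda>t. hom_part d (c t)) t"
  unfolding koszul_def hom_part_sum mult.assoc hom_part_ksign_mult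
  by (simp add: hom_part_mult homogeneous_pvar)

lemma lookup_mult_zero:
  fixes p q :: "('v, 'k::field) mpoly"
  assumes "Poly_Mapping.lookup p 0 = 0"
  shows "Poly_Mapping.lookup (p * q) 0 = 0"
proof (rule ccontr)
  assume "Poly_Mapping.lookup (p * q) 0 \<noteq> 0"
  hence "0 \<in> Poly_Mapping.keys (p * q)" by (simp add: in_keys_iff)
  then obtain a b where ab: "a \<in> Poly_Mapping.keys p" "0 = a + b"
    using keys_mult[of p q] by blast
  have "a = 0"
  proof (rule poly_mapping_eqI)
    fix v
    have "Poly_Mapping.lookup (a + b) v = 0" using ab(2) by (metis lookup_zero)
    thus "Poly_Mapping.lookup a v = Poly_Mapping.lookup 0 v" by (simp add: lookup_add)
  qed
  thus False using ab assms by (simp add: in_keys_iff)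
qed

text \<open>\<open>I\<close> consists of the polynomials all of whose monomials satisfy \<open>P\<close>, and \<open>Z i\<close> is the kernel of
  \<open>F\<^sub>i \<rightarrow> F\<^sub>i\<^sub>-\<^sub>1\<close>, where for \<open>i = 0\<close> the target is \<open>R/I\<close>.\<close>

locale minimal_resolution =
  fixes V :: "'v set" and P :: "('v \<Rightarrow>\<^sub>0 nat) \<Rightarrow> bool"
    and n :: "nat \<Rightarrow> nat" and dg :: "nat \<Rightarrow> nat \<Rightarrow> int"
    and D :: "nat \<Rightarrow> nat \<Rightarrow> nat \<Rightarrow> ('v, 'k::field) mpoly" and al :: "nat \<Rightarrow> ('v, 'k) mpoly"
    and I :: "('v, 'k) mpoly set" and Z :: "nat \<Rightarrow> (nat \<Rightarrow> ('v, 'k) mpoly) \<Rightarrow> bool"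
  assumes finV: "finite V"
    and P_add: "P m \<Longrightarrow> P (m + m')"
    and I_def: "I = {p \<in> polys V. \<forall>m\<in>Poly_Mapping.keys p. P m}"
    and al_polys: "s < n 0 \<Longrightarrow> al s \<in> polys V"
    and al_hom: "s < n 0 \<Longrightarrow> homogeneous (dg 0 s) (al s)"
    and D_polys: "r < n i \<Longrightarrow> s < n (Suc i) \<Longrightarrow> D i r s \<in> polys V"
    and D_hom: "r < n i \<Longrightarrow> s < n (Suc i) \<Longrightarrow> homogeneous (dg (Suc i) s - dg i r) (D i r s)"
    and D_min: "r < n i \<Longrightarrow> s < n (Suc i) \<Longrightarrow> Poly_Mapping.lookup (D i r s) 0 = 0"
    and surj: "p \<in> polys V \<Longrightarrow> \<exists>w. (\<forall>s<n 0. w s \<in> polys V) \<and> p - (\<Sum>s<n 0. al s * w s) \<in> I"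
    and Z_0: "Z 0 w \<longleftrightarrow> (\<Sum>s<n 0. al s * w s) \<in> I"
    and Z_Suc: "Z (Suc i) w \<longleftrightarrow> (\<forall>r<n i. (\<Sum>s<n (Suc i). D i r s * w s) = 0)"
    and exact: "(\<And>s. s < n i \<Longrightarrow> w s \<in> polys V) \<Longrightarrow> Z i w \<longleftrightarrow>
      (\<exists>w'. (\<forall>s<n (Suc i). w' s \<in> polys V) \<and> (\<forall>r<n i. w r = (\<Sum>s<n (Suc i). D i r s * w' s)))"
begin

definition app :: "nat \<Rightarrow> (nat \<Rightarrow> ('v, 'k) mpoly) \<Rightarrow> nat \<Rightarrow> ('v, 'k) mpoly" where
  "app i w r = (\<Sum>s<n (Suc i). D i r s * w s)"

abbreviation kz :: "('v set \<Rightarrow> ('v, 'k) mpoly) \<Rightarrow> 'v set \<Rightarrow> ('v, 'k) mpoly" where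
  "kz \<equiv> koszul pvar V"

text \<open>Nonvanishing in degree \<open>j\<close> of the \<open>p\<close>-th Koszul homology of \<open>F\<^sub>i / Z\<^sub>i\<close>, the \<open>i\<close>-th syzygy module.\<close>

definition syz_hom :: "nat \<Rightarrow> nat \<Rightarrow> int \<Rightarrow> bool" where
  "syz_hom i p j \<longleftrightarrow> (\<exists>c.
     (\<forall>t s. t \<subseteq> V \<longrightarrow> card t = p \<longrightarrow> s < n i \<longrightarrow> c t s \<in> polys V \<and> homogeneous (j - int p - dg i s) (c t s)) \<and>
     (\<forall>t. t \<subseteq> V \<longrightarrow> Suc (card t) = p \<longrightarrow> Z i (\<lambda>s. kz (\<lambda>t. c t s) t)) \<and>
     \<not> (\<exists>b. (\<forall>t s. b t s \<in> polys V) \<and>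
        (\<forall>t. t \<subseteq> V \<longrightarrow> card t = p \<longrightarrow> Z i (\<lambda>s. c t s - kz (\<lambda>t. b t s) t))))"

text \<open>Nonvanishing of Tor_p(R/I, k) in degree j, computed from the Koszul resolution of k;
  elements of R/I are represented by polynomials.\<close>

definition ideal_hom :: "nat \<Rightarrow> int \<Rightarrow> bool" where
  "ideal_hom p j \<longleftrightarrow> (\<exists>c.
     (\<forall>t. t \<subseteq> V \<longrightarrow> card t = p \<longrightarrow> c t \<in> polys V \<and> homogeneous (j - int p) (c t)) \<and>
     (\<forall>t. t \<subseteq> V \<longrightarrow> Suc (card t) = p \<longrightarrow> kz c t \<in> I) \<and>
     \<not> (\<exists>b. (\<forall>t. b t \<in> polys V) \<and> (\<forall>t. t \<subseteq> V \<longrightarrow> card t = p \<longrightarrow> c t - kz b t \<in> I)))"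

lemma app_polys: "r < n i \<Longrightarrow> (\<And>s. s < n (Suc i) \<Longrightarrow> w s \<in> polys V) \<Longrightarrow> app i w r \<in> polys V"
  unfolding app_def by (intro polys_sum polys_mult D_polys) auto

lemma app_diff: "app i (\<lambda>s. w s - w' s) r = app i w r - app i w' r"
  by (simp add: app_def algebra_simps sum_subtractf)

lemma app_kz: "app i (\<lambda>s. kz (\<lambda>t. c t s) t) r = kz (\<lambda>t. app i (c t) r) t"
  by (simp add: app_def koszul_sum koszul_mult)

lemma app_hom_part:
  assumes "r < n i"
  shows "app i (\<lambda>s. hom_part (j - dg (Suc i) s) (w s)) r = hom_part (j - dg i r) (app i w r)"
proof -
  have "D i r s * hom_part (j - dg (Suc i) s) (w s) = hom_part (j - dg i r) (D i r s * w s)"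
    if "s < n (Suc i)" for s
    using hom_part_mult[OF D_hom[OF assms that], of "j - dg (Suc i) s" "w s"] by simp
  thus ?thesis by (simp add: app_def hom_part_sum)
qed

lemma lookup_app_0: "r < n i \<Longrightarrow> Poly_Mapping.lookup (app i w r) 0 = 0"
  unfolding app_def lookup_sum by (intro sum.neutral) (auto intro: lookup_mult_zero D_min)

lemma Z_SucD: "Z (Suc i) w \<Longrightarrow> r < n i \<Longrightarrow> app i w r = 0"
  by (simp add: Z_Suc app_def)

lemma Z_SucI: "(\<And>r. r < n i \<Longrightarrow> app i w r = 0) \<Longrightarrow> Z (Suc i) w"
  by (simp add: Z_Suc app_def)

lemma Z_exactD:
  assumes "Z i w" "\<And>s. s < n i \<Longrightarrow> w s \<in> polys V"
  shows "\<exists>w'. (\<forall>s. w' s \<in> polys V) \<and> (\<forall>r<n i. w r = app i w' r)"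
proof -
  obtain w' where w': "\<forall>s<n (Suc i). w' s \<in> polys V" "\<forall>r<n i. w r = app i w' r"
    using exact[of i w] assms unfolding app_def by blast
  \<comment> \<open>Extension by zero puts all values into the ring, so that no index bound has to
    be carried along later.\<close>
  define w'' where "w'' s = (if s < n (Suc i) then w' s else 0)" for s
  have "app i w' r = app i w'' r" for r by (simp add: app_def w''_def)
  moreover have "\<forall>s. w'' s \<in> polys V" using w'(1) by (simp add: w''_def)
  ultimately show ?thesis using w'(2) by metis
qed

lemma Z_exactI:
  assumes "\<And>s. s < n (Suc i) \<Longrightarrow> w' s \<in> polys V" "\<And>r. r < n i \<Longrightarrow> w r = app i w' r"
  shows "Z i w"
proof -
  have "\<And>s. s < n i \<Longrightarrow> w s \<in> polys V" using assms by (simp add: app_polys)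
  thus ?thesis using exact[of i w] assms unfolding app_def by blast
qed

lemma finite_subset_V: "t \<subseteq> V \<Longrightarrow> finite t"
  using finV finite_subset by blast

lemma card_insert_V: "t \<subseteq> V \<Longrightarrow> u \<in> V - t \<Longrightarrow> card (insert u t) = Suc (card t)"
  using finite_subset_V by simp

section \<open>Dimension shifting\<close>

text \<open>Exactness identifies Z_i with F_(i+1)/Z_(i+1). The connecting homomorphism from Koszul
  degree p + 1 of F_i/Z_i to degree p of Z_i is injective, because the Koszul homology of the free
  module F_i vanishes in positive degrees.\<close>

lemma syz_hom_Suc_imp:
  assumes "syz_hom i (Suc p) j"
  shows "syz_hom (Suc i) p j"
proof -
  obtain c where
    c: "\<And>t s. t \<subseteq> V \<Longrightarrow> card t = Suc p \<Longrightarrow> s < n i \<Longrightarrow>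
      c t s \<in> polys V \<and> homogeneous (j - int (Suc p) - dg i s) (c t s)" and
    cyc: "\<And>t. t \<subseteq> V \<Longrightarrow> Suc (card t) = Suc p \<Longrightarrow> Z i (\<lambda>s. kz (\<lambda>t. c t s) t)" and
    nb: "\<not> (\<exists>b. (\<forall>t s. b t s \<in> polys V) \<and>
        (\<forall>t. t \<subseteq> V \<longrightarrow> card t = Suc p \<longrightarrow> Z i (\<lambda>s. c t s - kz (\<lambda>t. b t s) t)))"
    using assms unfolding syz_hom_def by blast
  have kz_polys: "kz (\<lambda>t. c t s) t \<in> polys V" if "t \<subseteq> V" "card t = p" "s < n i" for t s
    using that c[of "insert _ t" s] by (intro polys_koszul) (auto simp: card_insert_V)
  have "\<exists>w. (\<forall>s. w s \<in> polys V) \<and> (\<forall>r<n i. kz (\<lambda>t. c t r) t = app i w r)"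
    if "t \<subseteq> V" "card t = p" for t
    using that cyc[of t] kz_polys by (intro Z_exactD) auto
  then obtain w where w: "\<And>t s. t \<subseteq> V \<Longrightarrow> card t = p \<Longrightarrow> w t s \<in> polys V"
    "\<And>t r. t \<subseteq> V \<Longrightarrow> card t = p \<Longrightarrow> r < n i \<Longrightarrow> kz (\<lambda>t. c t r) t = app i (w t) r"
    by metis
  \<comment> \<open>A lift of a homogeneous element need not be homogeneous, but its component of
    the right degree is again a lift.\<close>
  define c' where "c' t s = hom_part (j - int p - dg (Suc i) s) (w t s)" for t s
  have c': "kz (\<lambda>t. c t r) t = app i (c' t) r" if "t \<subseteq> V" "card t = p" "r < n i" for t r
  proof -
    have "homogeneous (1 + (j - int (Suc p) - dg i r)) (kz (\<lambda>t. c t r) t)"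
      using that c[of "insert _ t" r] by (intro homogeneous_koszul) (auto simp: card_insert_V)
    hence "homogeneous (j - int p - dg i r) (kz (\<lambda>t. c t r) t)"
      by (simp add: algebra_simps)
    hence "kz (\<lambda>t. c t r) t = hom_part (j - int p - dg i r) (app i (w t) r)"
      using w(2)[OF that] hom_part_homogeneous by metis
    thus ?thesis unfolding c'_def using app_hom_part[OF that(3)] by simp
  qed
  show ?thesis
    unfolding syz_hom_def
  proof (intro exI[of _ c'] conjI allI impI notI)
    fix t s assume t: "t \<subseteq> V" "card t = p"
    show "c' t s \<in> polys V" unfolding c'_def using w(1) t by (intro polys_hom_part) auto
    show "homogeneous (j - int p - dg (Suc i) s) (c' t s)"
      unfolding c'_def by (rule homogeneous_hom_part)
  next
    fix t assume t: "t \<subseteq> V" "Suc (card t) = p"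
    show "Z (Suc i) (\<lambda>s. kz (\<lambda>t. c' t s) t)"
    proof (rule Z_SucI)
      fix r assume r: "r < n i"
      have "kz (\<lambda>t. app i (c' t) r) t = kz (kz (\<lambda>t. c t r)) t"
        using t r by (intro koszul_cong) (auto simp: c' card_insert_V)
      also have "\<dots> = 0" using finV finite_subset_V[OF t(1)] by (rule koszul_koszul)
      finally show "app i (\<lambda>s. kz (\<lambda>t. c' t s) t) r = 0" unfolding app_kz .
    qed
  next
    assume "\<exists>b. (\<forall>t s. b t s \<in> polys V) \<and>
        (\<forall>t. t \<subseteq> V \<longrightarrow> card t = p \<longrightarrow> Z (Suc i) (\<lambda>s. c' t s - kz (\<lambda>t. b t s) t))"
    then obtain e where e: "\<And>t s. e t s \<in> polys V"
      "\<And>t. t \<subseteq> V \<Longrightarrow> card t = p \<Longrightarrow> Z (Suc i) (\<lambda>s. c' t s - kz (\<lambda>t. e t s) t)" by blast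
    \<comment> \<open>If \<open>e\<close> bounds \<open>c'\<close>, then \<open>c\<close> corrected
      by the image of \<open>e\<close> is a Koszul cycle of the free module, hence a boundary, and
      \<open>c\<close> itself bounds modulo Z_i.\<close>
    define d where "d r t = c t r - app i (e t) r" for r t
    have "\<exists>b. (\<forall>t. b t \<in> polys V) \<and> (\<forall>t. t \<subseteq> V \<longrightarrow> card t = Suc p \<longrightarrow> d r t = kz b t)"
      if r: "r < n i" for r
    proof (rule koszul_exact[OF finV])
      fix t assume "t \<subseteq> V" "card t = Suc p"
      thus "d r t \<in> polys V" unfolding d_def using c r e by (intro polys_diff app_polys) auto
    next
      fix t assume t: "t \<subseteq> V" "Suc (card t) = Suc p"
      have "app i (c' t) r - app i (\<lambda>s. kz (\<lambda>t. e t s) t) r = 0"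
        using Z_SucD[OF e(2) r] t by (simp add: app_diff)
      thus "kz (d r) t = 0"
        unfolding d_def koszul_diff using c' t r by (simp add: app_kz)
    qed auto
    then obtain B where B: "\<And>r t. r < n i \<Longrightarrow> B r t \<in> polys V"
      "\<And>r t. r < n i \<Longrightarrow> t \<subseteq> V \<Longrightarrow> card t = Suc p \<Longrightarrow> d r t = kz (B r) t" by metis
    define b where "b t r = (if r < n i then B r t else 0)" for t r
    have "Z i (\<lambda>s. c t s - kz (\<lambda>t. b t s) t)" if t: "t \<subseteq> V" "card t = Suc p" for t
    proof (rule Z_exactI[of i "e t"])
      fix r assume r: "r < n i"
      have "kz (\<lambda>t. b t r) t = kz (B r) t" using r by (simp add: b_def)
      also have "\<dots> = c t r - app i (e t) r" using B(2)[OF r t] by (simp add: d_def)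
      finally show "c t r - kz (\<lambda>t. b t r) t = app i (e t) r" by simp
    qed (rule e(1))
    moreover have "\<forall>t s. b t s \<in> polys V" using B(1) by (simp add: b_def)
    ultimately show False using nb by blast
  qed
qed

text \<open>Surjectivity of the connecting homomorphism: the map from the Koszul homology of Z_i to
  that of F_i must vanish. For p > 0 its target is zero; for p = 0 minimality makes it zero, since
  matrix entries have no constant term.\<close>

lemma syz_hom_Suc_rev:
  assumes "syz_hom (Suc i) p j"
  shows "syz_hom i (Suc p) j"
proof -
  obtain c' where
    c': "\<And>t s. t \<subseteq> V \<Longrightarrow> card t = p \<Longrightarrow> s < n (Suc i) \<Longrightarrow>
      c' t s \<in> polys V \<and> homogeneous (j - int p - dg (Suc i) s) (c' t s)" and
    cyc: "\<And>t. t \<subseteq> V \<Longrightarrow> Suc (card t) = p \<Longrightarrow> Z (Suc i) (\<lambda>s. kz (\<lambda>t. c' t s) t)" and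
    nb: "\<not> (\<exists>b. (\<forall>t s. b t s \<in> polys V) \<and>
        (\<forall>t. t \<subseteq> V \<longrightarrow> card t = p \<longrightarrow> Z (Suc i) (\<lambda>s. c' t s - kz (\<lambda>t. b t s) t)))"
    using assms unfolding syz_hom_def by blast
  define w where "w r t = app i (c' t) r" for r t
  have w_polys: "w r t \<in> polys V" if "t \<subseteq> V" "card t = p" "r < n i" for r t
    unfolding w_def using that c' by (intro app_polys) auto
  have w_hom: "homogeneous (j - int p - dg i r) (w r t)" if "t \<subseteq> V" "card t = p" "r < n i" for r t
  proof -
    have "app i (c' t) r = app i (\<lambda>s. hom_part (j - int p - dg (Suc i) s) (c' t s)) r"
      unfolding app_def using c' that by (intro sum.cong) (auto simp: hom_part_homogeneous)
    thus ?thesis unfolding w_def app_hom_part[OF that(3)] using homogeneous_hom_part by metis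
  qed
  have "\<exists>b. (\<forall>t. b t \<in> polys V) \<and> (\<forall>t. t \<subseteq> V \<longrightarrow> card t = p \<longrightarrow> w r t = kz b t)" if r: "r < n i" for r
  proof (rule koszul_exact[OF finV])
    fix t assume "t \<subseteq> V" "Suc (card t) = p"
    thus "kz (w r) t = 0"
      using Z_SucD[OF cyc r] unfolding app_kz w_def by blast
  next
    show "Poly_Mapping.lookup (w r {}) 0 = 0" unfolding w_def by (rule lookup_app_0[OF r])
  qed (use w_polys r in auto)
  then obtain B where B: "\<And>r t. r < n i \<Longrightarrow> B r t \<in> polys V"
    "\<And>r t. r < n i \<Longrightarrow> t \<subseteq> V \<Longrightarrow> card t = p \<Longrightarrow> w r t = kz (B r) t" by metis
  define c where "c t r = hom_part (j - int (Suc p) - dg i r) (B r t)" for t r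
  have c: "kz (\<lambda>t. c t r) t = w r t" if "t \<subseteq> V" "card t = p" "r < n i" for r t
  proof -
    have "kz (\<lambda>t. c t r) t = hom_part (j - int p - dg i r) (kz (B r) t)"
      using hom_part_koszul[of "j - int (Suc p) - dg i r" V "B r" t] by (simp add: c_def algebra_simps)
    also have "\<dots> = w r t" using B(2) w_hom that by (simp add: hom_part_homogeneous flip: B(2))
    finally show ?thesis .
  qed
  have c_polys: "c t r \<in> polys V" if "r < n i" for t r
    unfolding c_def using B(1)[OF that] by (rule polys_hom_part)
  show ?thesis
    unfolding syz_hom_def
  proof (intro exI[of _ c] conjI allI impI notI)
    fix t s assume "t \<subseteq> V" "card t = Suc p" "s < n i"
    thus "c t s \<in> polys V" by (intro c_polys)
    show "homogeneous (j - int (Suc p) - dg i s) (c t s)"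
      unfolding c_def by (rule homogeneous_hom_part)
  next
    fix t assume t: "t \<subseteq> V" "Suc (card t) = Suc p"
    show "Z i (\<lambda>s. kz (\<lambda>t. c t s) t)"
      using t c' c by (intro Z_exactI[of i "c' t"]) (auto simp: w_def)
  next
    assume "\<exists>b. (\<forall>t s. b t s \<in> polys V) \<and>
        (\<forall>t. t \<subseteq> V \<longrightarrow> card t = Suc p \<longrightarrow> Z i (\<lambda>s. c t s - kz (\<lambda>t. b t s) t))"
    then obtain b where b: "\<And>t s. b t s \<in> polys V"
      "\<And>t. t \<subseteq> V \<Longrightarrow> card t = Suc p \<Longrightarrow> Z i (\<lambda>s. c t s - kz (\<lambda>t. b t s) t)" by blast
    have "\<exists>e. (\<forall>s. e s \<in> polys V) \<and> (\<forall>r<n i. c t r - kz (\<lambda>t. b t r) t = app i e r)"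
      if t: "t \<subseteq> V" "card t = Suc p" for t
      using b(2)[OF t] by (rule Z_exactD) (intro polys_diff c_polys polys_koszul b(1))
    then obtain e0 where e0: "\<And>t s. t \<subseteq> V \<Longrightarrow> card t = Suc p \<Longrightarrow> e0 t s \<in> polys V"
      "\<And>t r. t \<subseteq> V \<Longrightarrow> card t = Suc p \<Longrightarrow> r < n i \<Longrightarrow> c t r - kz (\<lambda>t. b t r) t = app i (e0 t) r"
      by metis
    define e where "e t s = (if t \<subseteq> V \<and> card t = Suc p then e0 t s else 0)" for t s
    have "Z (Suc i) (\<lambda>s. c' t s - kz (\<lambda>t. e t s) t)" if t: "t \<subseteq> V" "card t = p" for t
    proof (rule Z_SucI)
      fix r assume r: "r < n i"
      have "app i (c' t) r = kz (\<lambda>t. c t r) t" using c t r by (simp add: w_def)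
      also have "\<dots> = kz (\<lambda>t. kz (\<lambda>t. b t r) t + app i (e t) r) t"
      proof (rule koszul_cong)
        fix u assume u: "u \<in> V - t"
        hence ut: "insert u t \<subseteq> V" "card (insert u t) = Suc p" using t by (auto simp: card_insert_V)
        hence "e (insert u t) = e0 (insert u t)" by (auto simp: e_def)
        thus "c (insert u t) r = kz (\<lambda>t. b t r) (insert u t) + app i (e (insert u t)) r"
          using e0(2)[OF ut r] by (simp add: algebra_simps)
      qed
      also have "\<dots> = kz (\<lambda>t. app i (e t) r) t"
        unfolding koszul_add using koszul_koszul[OF finV finite_subset_V[OF t(1)]] by simp
      finally show "app i (\<lambda>s. c' t s - kz (\<lambda>t. e t s) t) r = 0"
        by (simp add: app_diff app_kz)
    qed
    moreover have "\<forall>t s. e t s \<in> polys V" using e0(1) by (simp add: e_def)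
    ultimately show False using nb by blast
  qed
qed

text \<open>Koszul homology in degree 0 is the module modulo the variables. Minimality puts Z_i into
  the multiples of the variables, so this is F_i modulo the variables, with one basis vector for
  each generator.\<close>

lemma syz_hom_0:
  "syz_hom i 0 j \<longleftrightarrow> (\<exists>s<n i. dg i s = j)"
proof
  assume "\<exists>s<n i. dg i s = j"
  then obtain s where s: "s < n i" "dg i s = j" by blast
  define c :: "'v set \<Rightarrow> nat \<Rightarrow> ('v, 'k) mpoly" where "c t s' = (if s' = s then 1 else 0)" for t s'
  show "syz_hom i 0 j"
    unfolding syz_hom_def
  proof (intro exI[of _ c] conjI allI impI notI)
    fix t s'
    show "c t s' \<in> polys V" by (simp add: c_def)
    show "homogeneous (j - int 0 - dg i s') (c t s')" using s by (simp add: c_def homogeneous_one)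
  next
    assume "\<exists>b. (\<forall>t s. b t s \<in> polys V) \<and>
        (\<forall>t. t \<subseteq> V \<longrightarrow> card t = 0 \<longrightarrow> Z i (\<lambda>s. c t s - kz (\<lambda>t. b t s) t))"
    then obtain b where b0: "\<And>t s. b t s \<in> polys V"
      "\<And>t. t \<subseteq> V \<Longrightarrow> card t = 0 \<Longrightarrow> Z i (\<lambda>s. c t s - kz (\<lambda>t. b t s) t)" by blast
    have b: "\<And>t s. b t s \<in> polys V" "Z i (\<lambda>s. c {} s - kz (\<lambda>t. b t s) {})"
      using b0(1) b0(2)[of "{}"] by simp_all
    have "\<exists>w'. (\<forall>s. w' s \<in> polys V) \<and> (\<forall>r<n i. c {} r - kz (\<lambda>t. b t r) {} = app i w' r)"
      using b(2) by (rule Z_exactD) (intro polys_diff polys_koszul b(1), simp add: c_def)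
    then obtain w' where "c {} s - kz (\<lambda>t. b t s) {} = app i w' s" using s by blast
    hence "Poly_Mapping.lookup (c {} s - kz (\<lambda>t. b t s) {}) 0 = 0" using lookup_app_0[OF s(1)] by simp
    thus False by (simp add: c_def lookup_minus lookup_koszul[OF finV])
  qed auto
next
  assume "syz_hom i 0 j"
  then obtain c where
    c: "\<And>s. s < n i \<Longrightarrow> c {} s \<in> polys V \<and> homogeneous (j - dg i s) (c {} s)" and
    nb: "\<not> (\<exists>b. (\<forall>t s. b t s \<in> polys V) \<and>
        (\<forall>t. t \<subseteq> V \<longrightarrow> card t = 0 \<longrightarrow> Z i (\<lambda>s. c t s - kz (\<lambda>t. b t s) t)))"
    unfolding syz_hom_def by (auto simp: finite_subset_V)
  show "\<exists>s<n i. dg i s = j"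
  proof (rule ccontr)
    assume no: "\<not> (\<exists>s<n i. dg i s = j)"
    have t_empty: "t = {}" if "t \<subseteq> V" "card t = 0" for t
      using that finite_subset_V by simp
    have "\<exists>b. (\<forall>t. b t \<in> polys V) \<and> (\<forall>t. t \<subseteq> V \<longrightarrow> card t = 0 \<longrightarrow> c t s = kz b t)"
      if s: "s < n i" for s
    proof (rule koszul_exact[OF finV])
      show "Poly_Mapping.lookup (c {} s) 0 = 0"
      proof (rule ccontr)
        assume "Poly_Mapping.lookup (c {} s) 0 \<noteq> 0"
        hence "j - dg i s = 0" using c[OF s] by (auto simp: homogeneous_iff)
        thus False using no s by auto
      qed
    qed (use c s t_empty in auto)
    then obtain B where B: "\<And>r t. r < n i \<Longrightarrow> B r t \<in> polys V"
      "\<And>r t. r < n i \<Longrightarrow> t \<subseteq> V \<Longrightarrow> card t = 0 \<Longrightarrow> c t r = kz (B r) t" by metis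
    define b where "b t r = (if r < n i then B r t else 0)" for t r
    have "Z i (\<lambda>s. c t s - kz (\<lambda>t. b t s) t)" if t: "t \<subseteq> V" "card t = 0" for t
    proof (rule Z_exactI[of i "\<lambda>_. 0"])
      fix r assume r: "r < n i"
      have "kz (\<lambda>t. b t r) t = kz (B r) t" using r by (simp add: b_def)
      thus "c t r - kz (\<lambda>t. b t r) t = app i (\<lambda>_. 0) r" using B(2)[OF r t] by (simp add: app_def)
    qed simp
    moreover have "\<forall>t s. b t s \<in> polys V" using B(1) by (simp add: b_def)
    ultimately show False using nb by blast
  qed
qed

section \<open>From the module F_0/Z_0 to the quotient ring\<close>

lemma I_add: "p \<in> I \<Longrightarrow> q \<in> I \<Longrightarrow> p + q \<in> I"
  unfolding I_def using Poly_Mapping.keys_add[of p q] polys_add[of p V q] by blast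

lemma I_uminus: "p \<in> I \<Longrightarrow> - p \<in> I"
  unfolding I_def using polys_uminus[of p V] by (auto simp: in_keys_iff)

lemma I_diff: "p \<in> I \<Longrightarrow> q \<in> I \<Longrightarrow> p - q \<in> I"
  using I_add[of p "- q"] I_uminus[of q] by simp

lemma I_mult:
  assumes "p \<in> polys V" "q \<in> I"
  shows "p * q \<in> I"
proof -
  have "P m" if "m \<in> Poly_Mapping.keys (p * q)" for m
  proof -
    obtain a b where "b \<in> Poly_Mapping.keys q" "m = b + a"
      using \<open>m \<in> Poly_Mapping.keys (p * q)\<close> keys_mult[of p q] add.commute by blast
    thus ?thesis using assms P_add by (auto simp: I_def)
  qed
  thus ?thesis using assms polys_mult[of p V q] by (auto simp: I_def)
qed

lemma I_zero: "0 \<in> I"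
  by (simp add: I_def)

lemma I_sum: "(\<And>i. i \<in> A \<Longrightarrow> f i \<in> I) \<Longrightarrow> (\<Sum>i\<in>A. f i) \<in> I"
  by (induction A rule: infinite_finite_induct) (auto intro: I_add I_zero)

lemma I_kz: "(\<And>u. u \<in> V - t \<Longrightarrow> c (insert u t) \<in> I) \<Longrightarrow> kz c t \<in> I"
  unfolding koszul_def mult.assoc
  by (intro I_sum) (auto simp: ksign_parity intro!: I_uminus I_mult polys_pvar)

lemma I_hom_part: "p \<in> I \<Longrightarrow> hom_part d p \<in> I"
  unfolding I_def using keys_hom_part polys_hom_part by blast

definition aug_app :: "(nat \<Rightarrow> ('v, 'k) mpoly) \<Rightarrow> ('v, 'k) mpoly" where
  "aug_app w = (\<Sum>s<n 0. al s * w s)"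

lemma aug_app_polys: "(\<And>s. s < n 0 \<Longrightarrow> w s \<in> polys V) \<Longrightarrow> aug_app w \<in> polys V"
  unfolding aug_app_def by (intro polys_sum polys_mult al_polys) auto

lemma aug_app_diff: "aug_app (\<lambda>s. w s - w' s) = aug_app w - aug_app w'"
  by (simp add: aug_app_def algebra_simps sum_subtractf)

lemma aug_app_kz: "aug_app (\<lambda>s. kz (\<lambda>t. c t s) t) = kz (\<lambda>t. aug_app (c t)) t"
  by (simp add: aug_app_def koszul_sum koszul_mult)

lemma aug_app_hom_part:
  "aug_app (\<lambda>s. hom_part (j - dg 0 s) (w s)) = hom_part j (aug_app w)"
proof -
  have "al s * hom_part (j - dg 0 s) (w s) = hom_part j (al s * w s)" if "s < n 0" for s
    using hom_part_mult[OF al_hom[OF that], of "j - dg 0 s" "w s"] by simp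
  thus ?thesis by (simp add: aug_app_def hom_part_sum)
qed

lemma lift_exists:
  assumes "\<And>t. t \<in> T \<Longrightarrow> C t \<in> polys V"
  shows "\<exists>c. (\<forall>t s. c t s \<in> polys V) \<and> (\<forall>t\<in>T. C t - aug_app (c t) \<in> I)"
proof -
  have "\<exists>w. (\<forall>s<n 0. w s \<in> polys V) \<and> C t - aug_app w \<in> I" if "t \<in> T" for t
    unfolding aug_app_def using assms that by (intro surj)
  then obtain w where w: "\<And>t s. t \<in> T \<Longrightarrow> s < n 0 \<Longrightarrow> w t s \<in> polys V"
    "\<And>t. t \<in> T \<Longrightarrow> C t - aug_app (w t) \<in> I" by metis
  define c where "c t s = (if t \<in> T \<and> s < n 0 then w t s else 0)" for t s
  have "aug_app (c t) = aug_app (w t)" if "t \<in> T" for t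
    using that by (simp add: aug_app_def c_def)
  thus ?thesis using w by (intro exI[of _ c]) (auto simp: c_def)
qed

text \<open>The augmentation induces an isomorphism from F_0/Z_0 to R/I. As F_0 is not assumed to be
  R, chains are carried over by choosing preimages.\<close>

lemma syz_hom_ideal: "syz_hom 0 p j \<longleftrightarrow> ideal_hom p j"
proof
  assume "syz_hom 0 p j"
  then obtain c where
    c: "\<And>t s. t \<subseteq> V \<Longrightarrow> card t = p \<Longrightarrow> s < n 0 \<Longrightarrow>
      c t s \<in> polys V \<and> homogeneous (j - int p - dg 0 s) (c t s)" and
    cyc: "\<And>t. t \<subseteq> V \<Longrightarrow> Suc (card t) = p \<Longrightarrow> Z 0 (\<lambda>s. kz (\<lambda>t. c t s) t)" and
    nb: "\<not> (\<exists>b. (\<forall>t s. b t s \<in> polys V) \<and>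
        (\<forall>t. t \<subseteq> V \<longrightarrow> card t = p \<longrightarrow> Z 0 (\<lambda>s. c t s - kz (\<lambda>t. b t s) t)))"
    unfolding syz_hom_def by blast
  define C where "C t = aug_app (c t)" for t
  show "ideal_hom p j"
    unfolding ideal_hom_def
  proof (intro exI[of _ C] conjI allI impI notI)
    fix t assume t: "t \<subseteq> V" "card t = p"
    show "C t \<in> polys V" unfolding C_def using c t by (intro aug_app_polys) auto
    have "aug_app (c t) = aug_app (\<lambda>s. hom_part (j - int p - dg 0 s) (c t s))"
      unfolding aug_app_def using c t by (intro sum.cong) (auto simp: hom_part_homogeneous)
    thus "homogeneous (j - int p) (C t)"
      unfolding C_def aug_app_hom_part using homogeneous_hom_part by metis
  next
    fix t assume "t \<subseteq> V" "Suc (card t) = p"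
    hence "aug_app (\<lambda>s. kz (\<lambda>t. c t s) t) \<in> I" using cyc[of t] by (simp add: Z_0 aug_app_def)
    thus "kz C t \<in> I" unfolding C_def aug_app_kz .
  next
    assume "\<exists>b. (\<forall>t. b t \<in> polys V) \<and> (\<forall>t. t \<subseteq> V \<longrightarrow> card t = p \<longrightarrow> C t - kz b t \<in> I)"
    then obtain B where B: "\<And>t. B t \<in> polys V"
      "\<And>t. t \<subseteq> V \<Longrightarrow> card t = p \<Longrightarrow> C t - kz B t \<in> I" by blast
    obtain b where b: "\<And>t s. b t s \<in> polys V" "\<And>t. B t - aug_app (b t) \<in> I"
      using lift_exists[of UNIV B] B(1) by blast
    have "Z 0 (\<lambda>s. c t s - kz (\<lambda>t. b t s) t)" if t: "t \<subseteq> V" "card t = p" for t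
    proof -
      have "(C t - kz B t) + kz (\<lambda>t. B t - aug_app (b t)) t \<in> I"
        using B(2) t b(2) by (intro I_add I_kz) auto
      also have "(C t - kz B t) + kz (\<lambda>t. B t - aug_app (b t)) t =
          aug_app (\<lambda>s. c t s - kz (\<lambda>t. b t s) t)"
        by (simp add: koszul_diff aug_app_diff aug_app_kz C_def)
      finally show ?thesis unfolding Z_0 aug_app_def .
    qed
    thus False using nb b(1) by blast
  qed
next
  assume "ideal_hom p j"
  then obtain C where
    C: "\<And>t. t \<subseteq> V \<Longrightarrow> card t = p \<Longrightarrow> C t \<in> polys V \<and> homogeneous (j - int p) (C t)" and
    cyc: "\<And>t. t \<subseteq> V \<Longrightarrow> Suc (card t) = p \<Longrightarrow> kz C t \<in> I" and
    nb: "\<not> (\<exists>b. (\<forall>t. b t \<in> polys V) \<and> (\<forall>t. t \<subseteq> V \<longrightarrow> card t = p \<longrightarrow> C t - kz b t \<in> I))"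
    unfolding ideal_hom_def by blast
  have "\<exists>w. (\<forall>t s. w t s \<in> polys V) \<and> (\<forall>t\<in>{t. t \<subseteq> V \<and> card t = p}. C t - aug_app (w t) \<in> I)"
    using C by (intro lift_exists) auto
  then obtain w where w: "\<And>t s. w t s \<in> polys V"
    "\<And>t. t \<subseteq> V \<Longrightarrow> card t = p \<Longrightarrow> C t - aug_app (w t) \<in> I" by blast
  \<comment> \<open>Homogeneous components of preimages are still preimages, because I is a
    homogeneous ideal.\<close>
  define c where "c t s = hom_part (j - int p - dg 0 s) (w t s)" for t s
  have c_polys: "c t s \<in> polys V" for t s unfolding c_def by (intro polys_hom_part w(1))
  have c: "C t - aug_app (c t) \<in> I" if t: "t \<subseteq> V" "card t = p" for t
  proof -
    have "hom_part (j - int p) (C t - aug_app (w t)) \<in> I" using w(2)[OF t] by (rule I_hom_part)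
    moreover have "c t = (\<lambda>s. hom_part (j - int p - dg 0 s) (w t s))" by (rule ext) (simp add: c_def)
    hence "aug_app (c t) = hom_part (j - int p) (aug_app (w t))" by (simp only: aug_app_hom_part)
    ultimately show ?thesis using C[OF t] by (simp add: hom_part_diff hom_part_homogeneous)
  qed
  show "syz_hom 0 p j"
    unfolding syz_hom_def
  proof (intro exI[of _ c] conjI allI impI notI)
    fix t s
    show "c t s \<in> polys V" by (rule c_polys)
    show "homogeneous (j - int p - dg 0 s) (c t s)" unfolding c_def by (rule homogeneous_hom_part)
  next
    fix t assume t: "t \<subseteq> V" "Suc (card t) = p"
    have "kz C t - kz (\<lambda>t. C t - aug_app (c t)) t \<in> I"
    proof (rule I_diff)
      show "kz C t \<in> I" using cyc t by blast
      show "kz (\<lambda>t. C t - aug_app (c t)) t \<in> I"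
        by (rule I_kz, rule c) (use t in \<open>auto simp: card_insert_V\<close>)
    qed
    hence "aug_app (\<lambda>s. kz (\<lambda>t. c t s) t) \<in> I" by (simp add: koszul_diff aug_app_kz)
    thus "Z 0 (\<lambda>s. kz (\<lambda>t. c t s) t)" unfolding Z_0 aug_app_def .
  next
    assume "\<exists>b. (\<forall>t s. b t s \<in> polys V) \<and>
        (\<forall>t. t \<subseteq> V \<longrightarrow> card t = p \<longrightarrow> Z 0 (\<lambda>s. c t s - kz (\<lambda>t. b t s) t))"
    then obtain b where b: "\<And>t s. b t s \<in> polys V"
      "\<And>t. t \<subseteq> V \<Longrightarrow> card t = p \<Longrightarrow> aug_app (\<lambda>s. c t s - kz (\<lambda>t. b t s) t) \<in> I"
      unfolding Z_0 aug_app_def by blast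
    have "C t - kz (\<lambda>t. aug_app (b t)) t \<in> I" if t: "t \<subseteq> V" "card t = p" for t
      using I_add[OF c[OF t] b(2)[OF t]] by (simp add: aug_app_diff aug_app_kz)
    moreover have "aug_app (b t) \<in> polys V" for t using b(1) by (intro aug_app_polys)
    ultimately have "\<exists>b. (\<forall>t. b t \<in> polys V) \<and> (\<forall>t. t \<subseteq> V \<longrightarrow> card t = p \<longrightarrow> C t - kz b t \<in> I)"
      by (intro exI[of _ "\<lambda>t. aug_app (b t)"]) simp
    thus False using nb by blast
  qed
qed

text \<open>Each shift trades one Koszul degree for one step in the resolution; after i of them the
  Koszul homology of R/I has become the generators of F_i.\<close>

lemma generator_degree_iff: "(\<exists>s<n i. dg i s = j) \<longleftrightarrow> ideal_hom i j"
proof -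
  have "syz_hom k p j \<longleftrightarrow> syz_hom (k + p) 0 j" for k p
  proof (induction p arbitrary: k)
    case (Suc p)
    have "syz_hom k (Suc p) j \<longleftrightarrow> syz_hom (Suc k) p j"
      using syz_hom_Suc_imp syz_hom_Suc_rev by blast
    thus ?case using Suc.IH[of "Suc k"] by simp
  qed simp
  from this[of 0 i] show ?thesis by (simp add: syz_hom_0 syz_hom_ideal)
qed

text \<open>If F_i = 0, every vector of F_(i+1) lies in the image of the next matrix. Its entries
  have no constant term, so the first basis vector cannot be reached.\<close>

lemma no_gap:
  assumes "n (Suc i) \<noteq> 0"
  shows "n i \<noteq> 0"
proof
  assume "n i = 0"
  define w :: "nat \<Rightarrow> ('v, 'k) mpoly" where "w s = (if s = 0 then 1 else 0)" for s
  have "Z (Suc i) w" using \<open>n i = 0\<close> by (simp add: Z_Suc)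
  moreover have "w s \<in> polys V" for s by (simp add: w_def)
  ultimately have "\<exists>w'. (\<forall>s. w' s \<in> polys V) \<and> (\<forall>r<n (Suc i). w r = app (Suc i) w' r)"
    by (rule Z_exactD)
  then obtain w' where "w 0 = app (Suc i) w' 0"
    using assms by blast
  hence "Poly_Mapping.lookup (w 0) 0 = 0" using lookup_app_0 assms by simp
  thus False by (simp add: w_def)
qed

end

section \<open>Resolutions of edge ideals\<close>

locale edge_ideal_resolution = minimal_resolution + edge_set E for E +
  assumes edges_V: "e \<in> E \<Longrightarrow> e \<subseteq> V"
    and P_edges: "P m \<longleftrightarrow> (\<exists>e\<in>E. e \<subseteq> Poly_Mapping.keys m)"
begin

lemma not_P_iff: "\<not> P m \<longleftrightarrow> edge_free E (Poly_Mapping.keys m)"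
  by (auto simp: P_edges edge_free_def)

lemma keys_sqfree_mon_diff:
  "finite S \<Longrightarrow> t \<subseteq> S \<Longrightarrow> Poly_Mapping.keys (sqfree_mon S - sqfree_mon t) = S - t"
  by (auto simp: in_keys_iff lookup_minus lookup_sqfree_mon finite_subset split: if_splits)

lemma khom_sqfree_mon:
  assumes "finite S"
  shows "khom TYPE('b) S (\<lambda>t. \<not> P (sqfree_mon S - sqfree_mon t)) p \<longleftrightarrow> ghom TYPE('b) E S p"
  unfolding ghom_def using assms by (intro khom_cong) (simp add: not_P_iff keys_sqfree_mon_diff)

lemma sqfree_mon_keys:
  assumes "\<And>v. Poly_Mapping.lookup m v \<le> 1"
  shows "m = sqfree_mon (Poly_Mapping.keys m)"
proof (rule poly_mapping_eqI)
  fix v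
  show "Poly_Mapping.lookup m v = Poly_Mapping.lookup (sqfree_mon (Poly_Mapping.keys m)) v"
    using assms[of v] by (auto simp: lookup_sqfree_mon in_keys_iff)
qed

text \<open>Dividing once by a variable of exponent at least 2 does not change the support, so v can
  be removed from t freely and the family is a cone.\<close>

lemma not_khom_not_squarefree:
  assumes "Poly_Mapping.lookup m v > 1"
  shows "\<not> khom TYPE('b) (Poly_Mapping.keys m) (\<lambda>t. \<not> P (m - sqfree_mon t)) p"
proof (rule not_khom_cone)
  show "v \<in> Poly_Mapping.keys m" using assms by (simp add: in_keys_iff)
  fix t assume t: "t \<subseteq> Poly_Mapping.keys m - {v}" "\<not> P (m - sqfree_mon (insert v t))"
  have ft: "finite t" using t(1) by (rule finite_subset) simp
  have "Poly_Mapping.keys (m - sqfree_mon (insert v t)) = Poly_Mapping.keys (m - sqfree_mon t)"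
    using assms ft by (auto simp: in_keys_iff lookup_minus lookup_sqfree_mon split: if_splits)
  thus "\<not> P (m - sqfree_mon t)" using t(2) by (simp add: not_P_iff)
qed simp

text \<open>Hochster's formula. A cycle of total degree j involves only multidegrees of that degree;
  the squarefree ones give \<open>ghom\<close>, the others nothing. Conversely, a class of
  \<open>ghom\<close> is placed in the multidegree of S.\<close>

lemma ideal_hom_iff:
  "ideal_hom p j \<longleftrightarrow> (\<exists>S\<subseteq>V. int (card S) = j \<and> ghom TYPE('b) E S p)"
proof
  assume "ideal_hom p j"
  then obtain C where
    C: "\<And>t. t \<subseteq> V \<Longrightarrow> card t = p \<Longrightarrow> C t \<in> polys V \<and> homogeneous (j - int p) (C t)" and
    cyc: "\<And>t. t \<subseteq> V \<Longrightarrow> Suc (card t) = p \<Longrightarrow> kz C t \<in> I" and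
    nb: "\<not> (\<exists>b. (\<forall>t. b t \<in> polys V) \<and> (\<forall>t. t \<subseteq> V \<longrightarrow> card t = p \<longrightarrow> C t - kz b t \<in> I))"
    unfolding ideal_hom_def by blast
  show "\<exists>S\<subseteq>V. int (card S) = j \<and> ghom TYPE('b) E S p"
  proof (rule ccontr)
    assume neg: "\<not> ?thesis"
    have "\<exists>b. (\<forall>t. b t \<in> polys V) \<and> (\<forall>t. t \<subseteq> V \<longrightarrow> card t = p \<longrightarrow>
        (\<forall>m\<in>Poly_Mapping.keys (C t - kz b t). P m))"
    proof (rule koszul_exact_of_multidegrees[OF finV])
      fix t m assume t: "t \<subseteq> V" "card t = p" "m \<in> Poly_Mapping.keys (C t)"
      define \<mu> where "\<mu> = m + sqfree_mon t"
      have ft: "finite t" using finite_subset_V[OF t(1)] .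
      have "int (mono_degree m) = j - int p" "Poly_Mapping.keys m \<subseteq> V"
        using C[OF t(1,2)] t(3) by (auto simp: homogeneous_def polys_def)
      hence \<mu>: "int (mono_degree \<mu>) = j" "Poly_Mapping.keys \<mu> \<subseteq> V"
        using t ft by (auto simp: \<mu>_def mono_degree_add mono_degree_sqfree_mon keys_add_nat)
      have "\<not> khom TYPE('b) (Poly_Mapping.keys \<mu>) (\<lambda>s. \<not> P (\<mu> - sqfree_mon s)) p"
      proof (cases "\<exists>v. Poly_Mapping.lookup \<mu> v > 1")
        case True
        thus ?thesis using not_khom_not_squarefree by blast
      next
        case False
        hence *: "\<mu> = sqfree_mon (Poly_Mapping.keys \<mu>)" by (intro sqfree_mon_keys) (simp add: not_less)
        have "int (card (Poly_Mapping.keys \<mu>)) = j"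
          using \<mu>(1) mono_degree_sqfree_mon[of "Poly_Mapping.keys \<mu>"] * by simp
        hence "\<not> ghom TYPE('b) E (Poly_Mapping.keys \<mu>) p" using neg \<mu>(2) by blast
        thus ?thesis using khom_sqfree_mon[of "Poly_Mapping.keys \<mu>" p] * by simp
      qed
      thus "\<not> khom TYPE('b) (Poly_Mapping.keys (m + sqfree_mon t))
          (\<lambda>s. \<not> P (m + sqfree_mon t - sqfree_mon s)) p" by (simp add: \<mu>_def)
    next
      fix t m assume "t \<subseteq> V" "Suc (card t) = p" "m \<in> Poly_Mapping.keys (kz C t)"
      thus "P m" using cyc[of t] by (auto simp: I_def)
    qed (use C in auto)
    then obtain b where b: "\<And>t. b t \<in> polys V"
      "\<And>t m. t \<subseteq> V \<Longrightarrow> card t = p \<Longrightarrow> m \<in> Poly_Mapping.keys (C t - kz b t) \<Longrightarrow> P m" by blast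
    have "C t - kz b t \<in> I" if "t \<subseteq> V" "card t = p" for t
      unfolding I_def using C b that by (auto intro!: polys_diff polys_koszul)
    thus False using nb b(1) by blast
  qed
next
  assume "\<exists>S\<subseteq>V. int (card S) = j \<and> ghom TYPE('b) E S p"
  then obtain S where S: "S \<subseteq> V" "int (card S) = j" "ghom TYPE('b) E S p" by blast
  have fS: "finite S" using finite_subset_V[OF S(1)] .
  have fsub: "finite t" if "t \<subseteq> S" for t using that fS finite_subset by blast
  \<comment> \<open>Truncated subtraction can be undone only because v divides m and v is an element
    of S outside t.\<close>
  have step: "m - Poly_Mapping.single v 1 = sqfree_mon S - sqfree_mon (insert v t) \<longleftrightarrow> m = sqfree_mon S - sqfree_mon t"
    if "v \<in> Poly_Mapping.keys m" "v \<notin> t" "insert v t \<subseteq> S" for m v t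
  proof
    assume m: "m = sqfree_mon S - sqfree_mon t"
    show "m - Poly_Mapping.single v 1 = sqfree_mon S - sqfree_mon (insert v t)"
      unfolding m using that fsub[of t] by (intro minus_sqfree_mon_insert) auto
  next
    assume eq: "m - Poly_Mapping.single v 1 = sqfree_mon S - sqfree_mon (insert v t)"
    show "m = sqfree_mon S - sqfree_mon t"
    proof (rule poly_mapping_eqI)
      fix u
      have "Poly_Mapping.lookup (m - Poly_Mapping.single v 1) u =
          Poly_Mapping.lookup (sqfree_mon S - sqfree_mon (insert v t)) u" by (simp only: eq)
      thus "Poly_Mapping.lookup m u = Poly_Mapping.lookup (sqfree_mon S - sqfree_mon t) u"
        using that fS fsub[of t]
        by (auto simp: lookup_minus lookup_sqfree_mon lookup_single when_def in_keys_iff split: if_splits)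
    qed
  qed
  obtain g :: "'a set \<Rightarrow> 'b" where
    cyc: "\<And>t. t \<subseteq> S \<Longrightarrow> edge_free E (S - t) \<Longrightarrow> Suc (card t) = p \<Longrightarrow> bd S g t = 0" and
    nb: "\<And>h. (\<And>t. t \<subseteq> S \<Longrightarrow> edge_free E (S - t) \<Longrightarrow> card t = p \<Longrightarrow> g t = bd S h t) \<Longrightarrow> False"
    using S(3) unfolding ghom_def khom_def by metis
  define C where "C t = (if t \<subseteq> S then Poly_Mapping.single (sqfree_mon S - sqfree_mon t) (g t) else 0)" for t
  have deg: "mono_degree (sqfree_mon S - sqfree_mon t) + card t = card S" if "t \<subseteq> S" for t
  proof -
    have "sqfree_mon S - sqfree_mon t + sqfree_mon t = sqfree_mon S"
      using that fS fsub by (intro minus_sqfree_mon_add) auto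
    hence "mono_degree (sqfree_mon S - sqfree_mon t) + mono_degree (sqfree_mon t) = mono_degree (sqfree_mon S)"
      by (metis mono_degree_add)
    thus ?thesis using that fS fsub by (simp add: mono_degree_sqfree_mon)
  qed
  have C_polys: "C t \<in> polys V" for t
    using S(1) fS by (auto simp: C_def keys_sqfree_mon_diff intro!: polys_single)
  show "ideal_hom p j"
    unfolding ideal_hom_def
  proof (intro exI[of _ C] conjI allI impI notI)
    fix t assume t: "t \<subseteq> V" "card t = p"
    show "C t \<in> polys V" by (rule C_polys)
    show "homogeneous (j - int p) (C t)"
      using deg[of t] t S(2) by (auto simp: C_def homogeneous_def)
  next
    fix t assume t: "t \<subseteq> V" "Suc (card t) = p"
    \<comment> \<open>The only monomial that can occur is x^(S - t), with coefficient
      \<open>bd S g t\<close>; this vanishes unless S - t contains an edge.\<close>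
    have "P m" if m: "m \<in> Poly_Mapping.keys (kz C t)" for m
    proof (rule ccontr)
      assume nP: "\<not> P m"
      have sum: "Poly_Mapping.lookup (kz C t) m = (\<Sum>v\<in>V \<inter> Poly_Mapping.keys m - t.
          ksign v t * Poly_Mapping.lookup (C (insert v t)) (m - Poly_Mapping.single v 1))"
        by (rule lookup_koszul[OF finV])
      moreover have "Poly_Mapping.lookup (kz C t) m \<noteq> 0" using m by (simp add: in_keys_iff)
      ultimately obtain v where v: "v \<in> V \<inter> Poly_Mapping.keys m - t"
        "Poly_Mapping.lookup (C (insert v t)) (m - Poly_Mapping.single v 1) \<noteq> 0"
        by (metis (no_types, lifting) mult_zero_right sum.neutral)
      have vS: "insert v t \<subseteq> S" using v(2) by (auto simp: C_def split: if_splits)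
      have "m - Poly_Mapping.single v 1 = sqfree_mon S - sqfree_mon (insert v t)"
        using v(2) vS by (auto simp: C_def lookup_single when_def split: if_splits)
      hence m_eq: "m = sqfree_mon S - sqfree_mon t" using step[of v m t] v(1) vS by blast
      have tS: "t \<subseteq> S" using vS by blast
      have km: "Poly_Mapping.keys m = S - t" unfolding m_eq using fS tS by (rule keys_sqfree_mon_diff)
      have "V \<inter> Poly_Mapping.keys m - t = S - t" using km S(1) by auto
      moreover have "Poly_Mapping.lookup (C (insert u t)) (m - Poly_Mapping.single u 1) = g (insert u t)"
        if "u \<in> S - t" for u
        using step[of u m t] that tS km by (simp add: C_def m_eq)
      ultimately have "Poly_Mapping.lookup (kz C t) m = bd S g t"
        unfolding sum koszul_def[of "\<lambda>_. 1"] by simp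
      also have "\<dots> = 0" using cyc[OF tS _ t(2)] nP km by (simp add: not_P_iff)
      finally show False using m by (simp add: in_keys_iff)
    qed
    moreover have "kz C t \<in> polys V" by (intro polys_koszul C_polys)
    ultimately show "kz C t \<in> I" by (simp add: I_def)
  next
    assume "\<exists>b. (\<forall>t. b t \<in> polys V) \<and> (\<forall>t. t \<subseteq> V \<longrightarrow> card t = p \<longrightarrow> C t - kz b t \<in> I)"
    then obtain b where b: "\<And>t. t \<subseteq> V \<Longrightarrow> card t = p \<Longrightarrow> C t - kz b t \<in> I" by blast
    show False
    \<comment> \<open>The part of \<open>b\<close> in the multidegree of S would bound the scalar
      cycle \<open>g\<close>.\<close>
    proof (rule nb[of "\<lambda>t. Poly_Mapping.lookup (b t) (sqfree_mon S - sqfree_mon t)"])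
      fix t assume t: "t \<subseteq> S" "edge_free E (S - t)" "card t = p"
      define m where "m = sqfree_mon S - sqfree_mon t"
      have km: "Poly_Mapping.keys m = S - t" unfolding m_def using fS t(1) by (rule keys_sqfree_mon_diff)
      have "t \<subseteq> V" using t(1) S(1) by blast
      hence "\<forall>m\<in>Poly_Mapping.keys (C t - kz b t). P m" using b[of t] t(3) by (simp add: I_def)
      moreover have "\<not> P m" using t(2) by (simp add: not_P_iff km)
      ultimately have "m \<notin> Poly_Mapping.keys (C t - kz b t)" by blast
      hence "Poly_Mapping.lookup (C t) m = Poly_Mapping.lookup (kz b t) m"
        by (simp add: in_keys_iff lookup_minus)
      also have "Poly_Mapping.lookup (C t) m = g t" using t by (simp add: C_def m_def)
      also have "Poly_Mapping.lookup (kz b t) m = (\<Sum>v\<in>V \<inter> Poly_Mapping.keys m - t.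
          ksign v t * Poly_Mapping.lookup (b (insert v t)) (m - Poly_Mapping.single v 1))"
        by (rule lookup_koszul[OF finV])
      also have "V \<inter> Poly_Mapping.keys m - t = S - t" using km S(1) by auto
      also have "(\<Sum>v\<in>S - t. ksign v t * Poly_Mapping.lookup (b (insert v t)) (m - Poly_Mapping.single v 1)) =
          bd S (\<lambda>t. Poly_Mapping.lookup (b t) (sqfree_mon S - sqfree_mon t)) t"
        unfolding koszul_def m_def using fsub[OF t(1)]
        by (intro sum.cong) (auto simp: minus_sqfree_mon_insert simp del: One_nat_def)
      finally show "g t = bd S (\<lambda>t. Poly_Mapping.lookup (b t) (sqfree_mon S - sqfree_mon t)) t" .
    qed
  qed
qed

lemma generator_degree_ghom:
  "(\<exists>s<n i. dg i s = j) \<longleftrightarrow> (\<exists>S\<subseteq>V. int (card S) = j \<and> ghom TYPE('b) E S i)"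
  by (simp add: generator_degree_iff ideal_hom_iff)

text \<open>The resolution has no gaps, so F_a has a generator. Its set is nonempty because a > 0,
  hence has more than a elements. This is t_a >= a + 1.\<close>

lemma linear_bound:
  assumes "n i \<noteq> 0" "0 < a" "a \<le> i"
  shows "\<exists>S\<subseteq>V. Suc a \<le> card S \<and> ghom TYPE('b) E S a"
proof -
  have "n a \<noteq> 0"
    using assms(3,1) by (induction i rule: dec_induct) (metis no_gap)+
  then obtain S where S: "S \<subseteq> V" "ghom TYPE('b) E S a"
    using generator_degree_ghom[of a "dg a 0"] by auto
  moreover have "S \<noteq> {}"
  proof
    assume "S = {}"
    thus False using S(2) assms(2) by (simp add: ghom_empty)
  qed
  ultimately show ?thesis using ghom_less_card finite_subset_V by (metis Suc_leI)
qed

end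

section \<open>Subadditivity\<close>

lemma prod_pvar: "finite e \<Longrightarrow> (\<Prod>v\<in>e. pvar v :: ('v, 'k::field) mpoly) = Poly_Mapping.single (sqfree_mon e) 1"
proof (induction e rule: finite_induct)
  case empty
  thus ?case by (simp add: sqfree_mon_def)
next
  case (insert v e)
  thus ?case by (simp add: sqfree_mon_insert mult_single pvar_def)
qed

lemma finite_edges: "finite_simple_graph G \<Longrightarrow> finite (edges G)"
  unfolding finite_simple_graph_def by (rule finite_subset[of _ "Pow (verts G)"]) auto

lemma finite_edge: "finite_simple_graph G \<Longrightarrow> e \<in> edges G \<Longrightarrow> finite e"
  unfolding finite_simple_graph_def using finite_subset by blast

text \<open>Membership in a monomial ideal is decided monomial by monomial, and an edge monomial
  divides m exactly when the edge lies in the support of m.\<close>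

lemma edge_ideal_eq:
  assumes G: "finite_simple_graph G"
  shows "(edge_ideal G :: ('v, 'k::field) mpoly set) =
    {p \<in> polys (verts G). \<forall>m\<in>Poly_Mapping.keys p. \<exists>e\<in>edges G. e \<subseteq> Poly_Mapping.keys m}"
proof -
  let ?I = "{p \<in> polys (verts G). \<forall>m\<in>Poly_Mapping.keys p. \<exists>e\<in>edges G. e \<subseteq> Poly_Mapping.keys m}"
  define \<phi> :: "'v set \<Rightarrow> ('v, 'k) mpoly" where "\<phi> e = (\<Prod>v\<in>e. pvar v)" for e
  have \<phi>: "\<phi> e = Poly_Mapping.single (sqfree_mon e) 1" if "e \<in> edges G" for e
    using prod_pvar[OF finite_edge[OF G that]] by (simp add: \<phi>_def)
  have edgeV: "e \<subseteq> verts G" if "e \<in> edges G" for e using that G by (simp add: finite_simple_graph_def)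
  have sub1: "p \<in> ?I" if "p \<in> edge_ideal G" for p :: "('v, 'k) mpoly"
  proof -
    from that
    obtain c where c: "\<forall>f\<in>\<phi> ` edges G. c f \<in> polys (verts G)" and p: "p = (\<Sum>f\<in>\<phi> ` edges G. c f * f)"
      unfolding edge_ideal_def ideal_gen_def \<phi>_def by blast
    have "\<phi> e \<in> polys (verts G)" if "e \<in> edges G" for e
      unfolding \<phi>[OF that] using edgeV[OF that] finite_edge[OF G that] by (intro polys_single) simp
    hence "p \<in> polys (verts G)"
      unfolding p using c by (intro polys_sum polys_mult) auto
    moreover have "\<exists>e\<in>edges G. e \<subseteq> Poly_Mapping.keys m" if m: "m \<in> Poly_Mapping.keys p" for m
    proof -
      obtain f where f: "f \<in> \<phi> ` edges G" "m \<in> Poly_Mapping.keys (c f * f)"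
        using m keys_sum[of "\<lambda>f. c f * f" "\<phi> ` edges G"] unfolding p by blast
      then obtain e where e: "e \<in> edges G" "f = \<phi> e" by blast
      obtain a b where ab: "b \<in> Poly_Mapping.keys f" "m = a + b"
        using f(2) keys_mult[of "c f" f] by blast
      have "b = sqfree_mon e" using ab(1) unfolding e(2) \<phi>[OF e(1)] by simp
      hence "e \<subseteq> Poly_Mapping.keys m"
        using finite_edge[OF G e(1)] by (simp add: ab(2) keys_add_nat)
      thus ?thesis using e(1) by blast
    qed
    ultimately show "p \<in> ?I" by blast
  qed
  have sub2: "p \<in> edge_ideal G" if "p \<in> ?I" for p :: "('v, 'k) mpoly"
  proof -
    from that have pV: "p \<in> polys (verts G)" and "\<forall>m\<in>Poly_Mapping.keys p. \<exists>e. e \<in> edges G \<and> e \<subseteq> Poly_Mapping.keys m"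
      by auto
    then obtain e where e: "\<And>m. m \<in> Poly_Mapping.keys p \<Longrightarrow> e m \<in> edges G"
      "\<And>m. m \<in> Poly_Mapping.keys p \<Longrightarrow> e m \<subseteq> Poly_Mapping.keys m" by metis
    define h where "h m = Poly_Mapping.single (m - sqfree_mon (e m)) (Poly_Mapping.lookup p m)" for m
    \<comment> \<open>The coefficients in \<open>ideal_gen\<close> are indexed by generators, so the
      monomials of p are grouped by the generator chosen to divide them.\<close>
    define c where "c f = (\<Sum>m\<in>{m \<in> Poly_Mapping.keys p. \<phi> (e m) = f}. h m)" for f
    have "(\<Sum>f\<in>\<phi> ` edges G. c f * f) =
        (\<Sum>f\<in>\<phi> ` edges G. \<Sum>m\<in>{m \<in> Poly_Mapping.keys p. \<phi> (e m) = f}. h m * \<phi> (e m))"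
      unfolding c_def sum_distrib_right by (intro sum.cong) auto
    also have "\<dots> = (\<Sum>m\<in>Poly_Mapping.keys p. h m * \<phi> (e m))"
      using finite_edges[OF G] e(1) by (intro sum.group) auto
    also have "\<dots> = (\<Sum>m\<in>Poly_Mapping.keys p. Poly_Mapping.single m (Poly_Mapping.lookup p m))"
    proof (intro sum.cong refl)
      fix m assume m: "m \<in> Poly_Mapping.keys p"
      show "h m * \<phi> (e m) = Poly_Mapping.single m (Poly_Mapping.lookup p m)"
        using minus_sqfree_mon_add[OF finite_edge[OF G e(1)[OF m]] e(2)[OF m]]
        by (simp add: h_def \<phi>[OF e(1)[OF m]] mult_single)
    qed
    also have "\<dots> = p" by (rule sum_single_lookup[symmetric])
    finally have sum: "p = (\<Sum>f\<in>\<phi> ` edges G. c f * f)" by simp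
    have "c f \<in> polys (verts G)" for f
      unfolding c_def h_def
    proof (intro polys_sum polys_single)
      fix m assume "m \<in> {m \<in> Poly_Mapping.keys p. \<phi> (e m) = f}"
      hence "Poly_Mapping.keys m \<subseteq> verts G" using pV by (auto simp: polys_def)
      thus "Poly_Mapping.keys (m - sqfree_mon (e m)) \<subseteq> verts G"
        by (auto simp: in_keys_iff lookup_minus subset_iff)
    qed
    thus "p \<in> edge_ideal G"
      unfolding edge_ideal_def ideal_gen_def using sum unfolding \<phi>_def by blast
  qed
  show ?thesis using sub1 sub2 by blast
qed

section \<open>From matrices and vectors to coordinate functions\<close>

lemma mult_mat_vec_lookup:
  assumes "A \<in> carrier_mat a b" "w \<in> carrier_vec b" "r < a"
  shows "(A *\<^sub>v w) $ r = (\<Sum>s<b. A $$ (r, s) * w $ s)"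
proof -
  have "(A *\<^sub>v w) $ r = (\<Sum>s<b. row A r $ s * w $ s)"
    using assms by (simp add: scalar_prod_def atLeast0LessThan)
  also have "\<dots> = (\<Sum>s<b. A $$ (r, s) * w $ s)" using assms by (intro sum.cong) auto
  finally show ?thesis .
qed

text \<open>The kernel predicate \<open>Z\<close> of \<open>minimal_resolution\<close>, with
  functions on indices in place of vectors.\<close>

definition syzygy :: "('v, 'k::field) mpoly set \<Rightarrow> ('v, 'k) mpoly graded_complex \<Rightarrow> nat \<Rightarrow>
    (nat \<Rightarrow> ('v, 'k) mpoly) \<Rightarrow> bool" where
  "syzygy I F i w = (case i of 0 \<Rightarrow> (\<Sum>s<free_rank F 0. aug F $ s * w s) \<in> I
     | Suc k \<Rightarrow> \<forall>r<free_rank F k. (\<Sum>s<free_rank F (Suc k). diff F k $$ (r, s) * w s) = 0)"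

lemma syzygy_exact:
  fixes F :: "('v, 'k::field) mpoly graded_complex"
  assumes F: "graded_free_resolution V I F"
    and w: "\<And>s. s < free_rank F i \<Longrightarrow> w s \<in> polys V"
  shows "syzygy I F i w \<longleftrightarrow> (\<exists>w'. (\<forall>s<free_rank F (Suc i). w' s \<in> polys V) \<and>
    (\<forall>r<free_rank F i. w r = (\<Sum>s<free_rank F (Suc i). diff F i $$ (r, s) * w' s)))"
proof -
  define W where "W = vec (free_rank F i) w"
  have W: "W \<in> free_module V (free_rank F i)" using w by (simp add: W_def free_module_def)
  have carrier: "diff F k \<in> carrier_mat (free_rank F k) (free_rank F (Suc k))" for k
    using F by (simp add: graded_free_resolution_def)
  have "syzygy I F i w \<longleftrightarrow> W \<in> (\<lambda>w. diff F i *\<^sub>v w) ` free_module V (free_rank F (Suc i))"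
  proof (cases i)
    case 0
    have "aug F \<bullet> W = (\<Sum>s<free_rank F 0. aug F $ s * w s)"
      by (simp add: scalar_prod_def W_def 0 atLeast0LessThan)
    hence "syzygy I F i w \<longleftrightarrow> W \<in> {w \<in> free_module V (free_rank F 0). aug F \<bullet> w \<in> I}"
      using W by (simp add: syzygy_def 0)
    moreover have "{w \<in> free_module V (free_rank F 0). aug F \<bullet> w \<in> I}
        = (\<lambda>w. diff F 0 *\<^sub>v w) ` free_module V (free_rank F 1)"
      using F unfolding graded_free_resolution_def by (elim conjE)
    ultimately show ?thesis by (simp only: 0 One_nat_def)
  next
    case (Suc k)
    have "(diff F k *\<^sub>v W) $ r = (\<Sum>s<free_rank F (Suc k). diff F k $$ (r, s) * w s)" if "r < free_rank F k" for r
      using mult_mat_vec_lookup[OF carrier, of W k r] that by (simp add: W_def Suc)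
    hence "diff F k *\<^sub>v W = 0\<^sub>v (free_rank F k) \<longleftrightarrow> syzygy I F i w"
      using carrier[of k] by (auto simp: syzygy_def Suc vec_eq_iff)
    hence "syzygy I F i w \<longleftrightarrow> W \<in> {w \<in> free_module V (free_rank F (Suc k)). diff F k *\<^sub>v w = 0\<^sub>v (free_rank F k)}"
      using W by (simp add: Suc)
    moreover have "\<forall>i. {w \<in> free_module V (free_rank F (Suc i)). diff F i *\<^sub>v w = 0\<^sub>v (free_rank F i)}
        = (\<lambda>w. diff F (Suc i) *\<^sub>v w) ` free_module V (free_rank F (Suc (Suc i)))"
      using F unfolding graded_free_resolution_def by (elim conjE)
    ultimately show ?thesis by (simp only: Suc)
  qed
  also have "\<dots> \<longleftrightarrow> (\<exists>w'. (\<forall>s<free_rank F (Suc i). w' s \<in> polys V) \<and>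
      (\<forall>r<free_rank F i. w r = (\<Sum>s<free_rank F (Suc i). diff F i $$ (r, s) * w' s)))"
  proof
    assume "W \<in> (\<lambda>w. diff F i *\<^sub>v w) ` free_module V (free_rank F (Suc i))"
    then obtain W' where W': "W' \<in> free_module V (free_rank F (Suc i))" "W = diff F i *\<^sub>v W'" by blast
    hence W'c: "W' \<in> carrier_vec (free_rank F (Suc i))" by (simp add: free_module_def)
    have "w r = (\<Sum>s<free_rank F (Suc i). diff F i $$ (r, s) * W' $ s)" if r: "r < free_rank F i" for r
    proof -
      have "w r = W $ r" using r by (simp add: W_def)
      thus ?thesis unfolding W'(2) mult_mat_vec_lookup[OF carrier W'c r] .
    qed
    thus "\<exists>w'. (\<forall>s<free_rank F (Suc i). w' s \<in> polys V) \<and>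
      (\<forall>r<free_rank F i. w r = (\<Sum>s<free_rank F (Suc i). diff F i $$ (r, s) * w' s))"
      using W'(1) by (intro exI[of _ "\<lambda>s. W' $ s"]) (simp add: free_module_def)
  next
    assume "\<exists>w'. (\<forall>s<free_rank F (Suc i). w' s \<in> polys V) \<and>
      (\<forall>r<free_rank F i. w r = (\<Sum>s<free_rank F (Suc i). diff F i $$ (r, s) * w' s))"
    then obtain w' where w': "\<forall>s<free_rank F (Suc i). w' s \<in> polys V"
      "\<And>r. r < free_rank F i \<Longrightarrow> w r = (\<Sum>s<free_rank F (Suc i). diff F i $$ (r, s) * w' s)" by blast
    define W' where "W' = vec (free_rank F (Suc i)) w'"
    have W'c: "W' \<in> carrier_vec (free_rank F (Suc i))" by (simp add: W'_def)
    have "W = diff F i *\<^sub>v W'"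
    proof (rule eq_vecI)
      show "dim_vec W = dim_vec (diff F i *\<^sub>v W')" using carrier[of i] by (simp add: W_def)
      fix r assume "r < dim_vec (diff F i *\<^sub>v W')"
      hence r: "r < free_rank F i" using carrier[of i] by simp
      have "(\<Sum>s<free_rank F (Suc i). diff F i $$ (r, s) * W' $ s) =
          (\<Sum>s<free_rank F (Suc i). diff F i $$ (r, s) * w' s)"
        by (intro sum.cong) (auto simp: W'_def)
      thus "W $ r = (diff F i *\<^sub>v W') $ r"
        unfolding mult_mat_vec_lookup[OF carrier W'c r] using w'(2)[OF r] r by (simp add: W_def)
    qed
    moreover have "W' \<in> free_module V (free_rank F (Suc i))"
      using w'(1) by (simp add: W'_def free_module_def)
    ultimately show "W \<in> (\<lambda>w. diff F i *\<^sub>v w) ` free_module V (free_rank F (Suc i))" by blast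
  qed
  finally show ?thesis .
qed

lemma graded_free_resolutionD:
  assumes "graded_free_resolution V I F"
  shows "aug F \<in> free_module V (free_rank F 0)"
    and "\<forall>k<free_rank F 0. homogeneous (gens F 0 ! k) (aug F $ k)"
    and "\<forall>i. diff F i \<in> carrier_mat (free_rank F i) (free_rank F (Suc i)) \<and>
        (\<forall>r<free_rank F i. \<forall>c<free_rank F (Suc i). diff F i $$ (r, c) \<in> polys V \<and>
           homogeneous (gens F (Suc i) ! c - gens F i ! r) (diff F i $$ (r, c)))"
    and "\<forall>p\<in>polys V. \<exists>w\<in>free_module V (free_rank F 0). p - aug F \<bullet> w \<in> I"
  using assms unfolding graded_free_resolution_def by - (elim conjE, assumption)+

lemma edge_ideal_resolution:
  fixes F :: "('v, 'k::field) mpoly graded_complex"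
  assumes G: "finite_simple_graph G"
    and F: "minimal_graded_free_resolution (verts G) (edge_ideal G) F"
  shows "edge_ideal_resolution (verts G) (\<lambda>m. \<exists>e\<in>edges G. e \<subseteq> Poly_Mapping.keys m) (free_rank F)
    (\<lambda>i s. gens F i ! s) (\<lambda>i r s. diff F i $$ (r, s)) (\<lambda>s. aug F $ s)
    (edge_ideal G) (syzygy (edge_ideal G) F) (edges G)"
proof -
  have res: "graded_free_resolution (verts G) (edge_ideal G) F"
    and min: "\<forall>i. \<forall>r<free_rank F i. \<forall>c<free_rank F (Suc i). diff F i $$ (r, c) \<in> irrelevant_ideal (verts G)"
    using F unfolding minimal_graded_free_resolution_def by blast+
  have surj: "\<exists>w. (\<forall>s<free_rank F 0. w s \<in> polys (verts G)) \<and>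
      p - (\<Sum>s<free_rank F 0. aug F $ s * w s) \<in> edge_ideal G" if p: "p \<in> polys (verts G)" for p
  proof -
    obtain w where w: "w \<in> free_module (verts G) (free_rank F 0)" "p - aug F \<bullet> w \<in> edge_ideal G"
      using graded_free_resolutionD(4)[OF res] p by blast
    have "aug F \<bullet> w = (\<Sum>s<free_rank F 0. aug F $ s * w $ s)"
      using w(1) by (auto simp: scalar_prod_def free_module_def atLeast0LessThan)
    thus ?thesis using w by (intro exI[of _ "\<lambda>s. w $ s"]) (simp add: free_module_def)
  qed
  have "minimal_resolution (verts G) (\<lambda>m. \<exists>e\<in>edges G. e \<subseteq> Poly_Mapping.keys m) (free_rank F)
    (\<lambda>i s. gens F i ! s) (\<lambda>i r s. diff F i $$ (r, s)) (\<lambda>s. aug F $ s)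
    (edge_ideal G) (syzygy (edge_ideal G) F)"
  proof (rule minimal_resolution.intro)
    show "finite (verts G)" using G by (simp add: finite_simple_graph_def)
    show "\<exists>e\<in>edges G. e \<subseteq> Poly_Mapping.keys (m + m')"
      if "\<exists>e\<in>edges G. e \<subseteq> Poly_Mapping.keys m" for m m' :: "'v \<Rightarrow>\<^sub>0 nat"
      using that by (auto simp: keys_add_nat)
    show "edge_ideal G = {p \<in> polys (verts G). \<forall>m\<in>Poly_Mapping.keys p. \<exists>e\<in>edges G. e \<subseteq> Poly_Mapping.keys m}"
      by (rule edge_ideal_eq[OF G])
    show "aug F $ s \<in> polys (verts G)" if "s < free_rank F 0" for s
      using graded_free_resolutionD(1)[OF res] that by (simp add: free_module_def)
    show "homogeneous (gens F 0 ! s) (aug F $ s)" if "s < free_rank F 0" for s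
      using graded_free_resolutionD(2)[OF res] that by blast
    show "diff F i $$ (r, s) \<in> polys (verts G)" if "r < free_rank F i" "s < free_rank F (Suc i)" for i r s
      using graded_free_resolutionD(3)[OF res] that by blast
    show "homogeneous (gens F (Suc i) ! s - gens F i ! r) (diff F i $$ (r, s))"
      if "r < free_rank F i" "s < free_rank F (Suc i)" for i r s
      using graded_free_resolutionD(3)[OF res] that by blast
    show "Poly_Mapping.lookup (diff F i $$ (r, s)) 0 = 0"
      if "r < free_rank F i" "s < free_rank F (Suc i)" for i r s
    proof -
      have "diff F i $$ (r, s) \<in> irrelevant_ideal (verts G)" using min that by blast
      thus ?thesis by (simp add: irrelevant_ideal_def)
    qed
  qed (use surj syzygy_exact[OF res] in \<open>simp_all add: syzygy_def\<close>)
  moreover have "edge_set (edges G)"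
    by unfold_locales (use G in \<open>simp add: finite_simple_graph_def\<close>)
  moreover have "edge_ideal_resolution_axioms (verts G) (\<lambda>m. \<exists>e\<in>edges G. e \<subseteq> Poly_Mapping.keys m) (edges G)"
    by unfold_locales (use G in \<open>simp_all add: finite_simple_graph_def\<close>)
  ultimately show ?thesis by (rule edge_ideal_resolution.intro)
qed

section \<open>From Betti numbers to sets of vertices\<close>

lemma t_inv_ge:
  fixes F :: "('v, 'k::field) mpoly graded_complex"
  assumes "minimal_graded_free_resolution (verts G) (edge_ideal G) F" "j \<in> set (gens F i)"
  shows "ereal (of_int j) \<le> t_inv TYPE('k) G i"
proof -
  have "enat (count_list (gens F i) j) \<le> graded_betti (verts G) (edge_ideal G :: ('v, 'k) mpoly set) i j"
    unfolding graded_betti_def using assms(1) by (intro SUP_upper) simp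
  moreover have "count_list (gens F i) j \<noteq> 0" using assms(2) by (simp add: count_list_0_iff)
  ultimately have "graded_betti (verts G) (edge_ideal G :: ('v, 'k) mpoly set) i j \<noteq> 0"
    by (auto simp: zero_enat_def)
  thus ?thesis unfolding t_inv_def by (intro SUP_upper) simp
qed

lemma graded_betti_neq_0D:
  assumes "graded_betti V I i j \<noteq> 0"
  obtains F where "minimal_graded_free_resolution V I F" "j \<in> set (gens F i)"
proof -
  have "\<exists>F. minimal_graded_free_resolution V I F \<and> count_list (gens F i) j \<noteq> 0"
  proof (rule ccontr)
    assume "\<not> ?thesis"
    hence "graded_betti V I i j \<le> 0"
      unfolding graded_betti_def by (intro SUP_least) (auto simp: zero_enat_def)
    thus False using assms by simp
  qed
  thus thesis using that by (auto simp: count_list_0_iff)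
qed

text \<open>A nonzero Betti number in homological degree a + b comes with a minimal resolution F.
  Since \<open>ghom\<close> does not refer to F, the same F turns the sets found for a and b into
  lower bounds of t_a and t_b.\<close>

lemma subadditive_if_ghom_subadditive:
  assumes G: "finite_simple_graph G"
    and sub: "ghom_subadditive TYPE('k::field) (edges G) (verts G)"
  shows "subadditive TYPE('k) G"
  unfolding subadditive_def
proof (intro allI impI)
  fix a b
  show "t_inv TYPE('k) G (a + b) \<le> t_inv TYPE('k) G a + t_inv TYPE('k) G b"
    unfolding t_inv_def[of _ _ "a + b"]
  proof (rule SUP_least)
    fix j assume "j \<in> {j. graded_betti (verts G) (edge_ideal G :: ('a, 'k) mpoly set) (a + b) j \<noteq> 0}"
    then obtain F :: "('a, 'k) mpoly graded_complex" where
      F: "minimal_graded_free_resolution (verts G) (edge_ideal G) F" and j: "j \<in> set (gens F (a + b))"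
      using graded_betti_neq_0D by blast
    interpret R: edge_ideal_resolution "verts G" "\<lambda>m. \<exists>e\<in>edges G. e \<subseteq> Poly_Mapping.keys m" "free_rank F"
      "\<lambda>i s. gens F i ! s" "\<lambda>i r s. diff F i $$ (r, s)" "\<lambda>s. aug F $ s"
      "edge_ideal G" "syzygy (edge_ideal G) F" "edges G"
      by (rule edge_ideal_resolution[OF G F])
    have gens_iff: "d \<in> set (gens F i) \<longleftrightarrow> (\<exists>S\<subseteq>verts G. int (card S) = d \<and> ghom TYPE('k) (edges G) S i)" for d i
      using R.generator_degree_ghom[of i d] by (simp add: in_set_conv_nth free_rank_def)
    have t_ge: "ereal (real (card S)) \<le> t_inv TYPE('k) G i"
      if "S \<subseteq> verts G" "ghom TYPE('k) (edges G) S i" for S i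
      using t_inv_ge[OF F, of "int (card S)" i] that gens_iff by auto
    \<comment> \<open>The empty set is the witness. This settles a = 0 and b = 0, which
      \<open>ghom_subadditive\<close> does not cover.\<close>
    have t0: "0 \<le> t_inv TYPE('k) G 0"
      using t_ge[of "{}" 0] by (simp add: R.ghom_empty zero_ereal_def)
    show "ereal (of_int j) \<le> t_inv TYPE('k) G a + t_inv TYPE('k) G b"
    proof (cases "a = 0 \<or> b = 0")
      case True
      thus ?thesis
      proof
        assume "a = 0"
        hence "ereal (of_int j) \<le> t_inv TYPE('k) G b" using t_inv_ge[OF F j] by simp
        hence "0 + ereal (of_int j) \<le> t_inv TYPE('k) G 0 + t_inv TYPE('k) G b"
          using t0 by (intro add_mono)
        thus ?thesis using \<open>a = 0\<close> by simp
      next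
        assume "b = 0"
        hence "ereal (of_int j) \<le> t_inv TYPE('k) G a" using t_inv_ge[OF F j] by simp
        hence "ereal (of_int j) + 0 \<le> t_inv TYPE('k) G a + t_inv TYPE('k) G 0"
          using t0 by (intro add_mono)
        thus ?thesis using \<open>b = 0\<close> by simp
      qed
    next
      case False
      hence ab: "0 < a" "0 < b" by auto
      obtain S where S: "S \<subseteq> verts G" "int (card S) = j" "ghom TYPE('k) (edges G) S (a + b)"
        using j gens_iff by blast
      obtain s t where st: "card S \<le> s + t" "linear_or_ghom TYPE('k) (edges G) (verts G) a s"
        "linear_or_ghom TYPE('k) (edges G) (verts G) b t"
        using ghom_subadditiveD[OF sub S(1) ab S(3)] .
      have rank: "free_rank F (a + b) \<noteq> 0" using j by (auto simp: free_rank_def)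
      \<comment> \<open>The linear alternative becomes an actual set by \<open>linear_bound\<close>,
        which applies because F is nonzero in degree a + b >= c.\<close>
      have bound: "ereal (real s) \<le> t_inv TYPE('k) G c"
        if lin: "linear_or_ghom TYPE('k) (edges G) (verts G) c s" and c: "0 < c" "c \<le> a + b" for c s
      proof -
        have "\<exists>T\<subseteq>verts G. s \<le> card T \<and> ghom TYPE('k) (edges G) T c"
          using lin R.linear_bound[OF rank c] unfolding linear_or_ghom_def by (meson le_trans)
        then obtain T where T: "T \<subseteq> verts G" "s \<le> card T" "ghom TYPE('k) (edges G) T c" by blast
        have "ereal (real s) \<le> ereal (real (card T))" using T(2) by simp
        also have "\<dots> \<le> t_inv TYPE('k) G c" using t_ge[OF T(1,3)] .
        finally show ?thesis .
      qed
      have "ereal (of_int j) \<le> ereal (real s) + ereal (real t)"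
        using st(1) S(2) by simp
      also have "\<dots> \<le> t_inv TYPE('k) G a + t_inv TYPE('k) G b"
        using ab st by (intro add_mono bound) auto
      finally show ?thesis .
    qed
  qed
qed

section \<open>The four families of graphs\<close>

lemma edge_setI: "finite_simple_graph G \<Longrightarrow> edge_set (edges G)"
  by unfold_locales (simp add: finite_simple_graph_def)

lemma cone_graph:
  assumes H: "finite_simple_graph H" "ghom_subadditive TYPE('k::field) (edges H) (verts H)"
    and x: "x \<notin> verts H" and U: "vertex_cover U H"
  shows "finite_simple_graph (cone x U H)"
    and "ghom_subadditive TYPE('k) (edges (cone x U H)) (verts (cone x U H))"
proof -
  have "card {x, u} = 2" if "u \<in> U" for u
  proof -
    have "x \<noteq> u" using that x U by (auto simp: vertex_cover_def)
    thus ?thesis by simp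
  qed
  thus fsg: "finite_simple_graph (cone x U H)"
    using H(1) U by (auto simp: finite_simple_graph_def cone_def vertex_cover_def)
  have "ghom_subadditive TYPE('k) (edges (cone x U H)) (insert x (verts H))"
  proof (rule ghom_subadditive_cone[OF H(2) _ x])
    show "edge_free (edges H) (verts H - U)"
      using U by (auto simp: vertex_cover_def edge_free_def)
    show "U \<subseteq> verts H" using U by (simp add: vertex_cover_def)
  qed (use H(1) fsg in \<open>auto simp: finite_simple_graph_def cone_def\<close>)
  thus "ghom_subadditive TYPE('k) (edges (cone x U H)) (verts (cone x U H))"
    by (simp add: cone_def)
qed

lemma cycle_graph:
  assumes "is_cycle_graph n H"
  shows "finite_simple_graph H" and "ghom_subadditive TYPE('k::field) (edges H) (verts H)"
proof -
  obtain v where n: "n \<ge> 3" and inj: "inj_on v {..<n}"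
    and H: "H = \<lparr>verts = v ` {..<n}, edges = {{v i, v (Suc i mod n)} | i. i < n}\<rparr>"
    using assms unfolding is_cycle_graph_def by blast
  have veq: "v i = v j \<longleftrightarrow> i = j" if "i < n" "j < n" for i j
    using inj_onD[OF inj] that by auto
  have less: "Suc i mod n < n" for i using n by simp
  have neq: "Suc i mod n \<noteq> i" if "i < n" for i
    using that n by (auto simp: mod_Suc split: if_splits)
  have "card {v i, v (Suc i mod n)} = 2" if "i < n" for i
    using veq[OF that less[of i]] neq[OF that] by simp
  thus fsg: "finite_simple_graph H"
    using less by (auto simp: finite_simple_graph_def H)
  interpret edge_set "edges H" using fsg by (rule edge_setI)
  interpret induced_cycle "edges H" v n
  proof
    fix i j assume ij: "i < n" "j < n"
    have "{v i, v j} \<in> edges H \<longleftrightarrow> (\<exists>k<n. {v i, v j} = {v k, v (Suc k mod n)})"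
      by (auto simp: H)
    also have "\<dots> \<longleftrightarrow> j = Suc i mod n \<or> i = Suc j mod n"
      using ij less veq by (auto simp: doubleton_eq_iff)
    finally show "{v i, v j} \<in> edges H \<longleftrightarrow> j = Suc i mod n \<or> i = Suc j mod n" .
  qed (use inj n in auto)
  show "ghom_subadditive TYPE('k) (edges H) (verts H)"
    using ghom_subadditive_cycle by (simp add: H)
qed

lemma path_graph:
  assumes "is_path_graph n H"
  shows "finite_simple_graph H" and "ghom_subadditive TYPE('k::field) (edges H) (verts H)"
proof -
  obtain v where inj: "inj_on v {..<n}"
    and H: "H = \<lparr>verts = v ` {..<n}, edges = {{v i, v (Suc i)} | i. Suc i < n}\<rparr>"
    using assms unfolding is_path_graph_def by blast
  have veq: "v i = v j \<longleftrightarrow> i = j" if "i < n" "j < n" for i j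
    using inj_onD[OF inj] that by auto
  have "card {v i, v (Suc i)} = 2" if "Suc i < n" for i
    using that veq[of i "Suc i"] by simp
  thus fsg: "finite_simple_graph H"
    by (auto simp: finite_simple_graph_def H)
  interpret edge_set "edges H" using fsg by (rule edge_setI)
  interpret induced_path "edges H" v n
  proof
    fix i j assume ij: "i < n" "j < n"
    have "{v i, v j} \<in> edges H \<longleftrightarrow> (\<exists>k. Suc k < n \<and> {v i, v j} = {v k, v (Suc k)})"
      by (auto simp: H)
    also have "\<dots> \<longleftrightarrow> j = Suc i \<or> i = Suc j"
      using ij veq by (auto simp: doubleton_eq_iff)
    finally show "{v i, v j} \<in> edges H \<longleftrightarrow> j = Suc i \<or> i = Suc j" .
  qed (use inj in auto)
  show "ghom_subadditive TYPE('k) (edges H) (verts H)"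
    using ghom_subadditive_path by (simp add: H)
qed

text \<open>The vertices of the path remain a vertex cover throughout, since every new edge ends in
  the path. So each further apex is again coned along a vertex cover.\<close>

lemma fan_graph:
  assumes H: "is_path_graph n H" and xs: "distinct xs" "set xs \<inter> verts H = {}"
    and G: "G = foldr (\<lambda>x H'. cone x (verts H) H') xs H"
  shows "finite_simple_graph G \<and> ghom_subadditive TYPE('k::field) (edges G) (verts G) \<and>
    verts G = set xs \<union> verts H \<and> vertex_cover (verts H) G"
  using xs G
proof (induction xs arbitrary: G)
  case Nil
  have "e \<inter> verts H \<noteq> {}" if "e \<in> edges H" for e
  proof -
    have "e \<subseteq> verts H" "card e = 2"
      using path_graph(1)[OF H] that by (auto simp: finite_simple_graph_def)
    thus ?thesis by (metis Int_absorb2 card.empty zero_neq_numeral)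
  qed
  thus ?case using path_graph[OF H] Nil by (auto simp: vertex_cover_def)
next
  case (Cons x xs)
  define G' where "G' = foldr (\<lambda>x H'. cone x (verts H) H') xs H"
  have IH: "finite_simple_graph G'" "ghom_subadditive TYPE('k) (edges G') (verts G')"
    "verts G' = set xs \<union> verts H" "vertex_cover (verts H) G'"
    using Cons.IH[OF _ _ G'_def] Cons.prems by auto
  have x: "x \<notin> verts G'" using IH(3) Cons.prems by auto
  have G: "G = cone x (verts H) G'" using Cons.prems by (simp add: G'_def)
  have "vertex_cover (verts H) G" "verts G = set (x # xs) \<union> verts H"
    using IH(3,4) by (auto simp: G cone_def vertex_cover_def)
  thus ?case using cone_graph[OF IH(1,2) x IH(4)] by (simp add: G)
qed

text \<open>The non-neighbours of a vertex form the rest of its part, which is independent. So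
  \<open>ghom_cone_cases\<close> applies to every vertex, and removing one lowers size and degree
  together until the linear bound is met.\<close>

lemma complete_multipartite_ghom_card:
  assumes G: "finite_simple_graph G" "complete_multipartite G"
    and S: "S \<subseteq> verts G" "ghom TYPE('k::field) (edges G) S p"
  shows "card S \<le> Suc p"
proof -
  interpret edge_set "edges G" using G(1) by (rule edge_setI)
  obtain Q where Q: "partition_on (verts G) Q"
    and E: "edges G = {{u, w} | u w. \<exists>A\<in>Q. \<exists>B\<in>Q. A \<noteq> B \<and> u \<in> A \<and> w \<in> B}"
    using G(2) unfolding complete_multipartite_def by - (elim exE conjE, rule that)
  have part: "\<exists>A\<in>Q. u \<in> A" if "u \<in> verts G" for u
    using Q that by (auto simp: partition_on_def)
  have disj: "A = B" if "A \<in> Q" "B \<in> Q" "u \<in> A" "u \<in> B" for A B u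
    using Q that unfolding partition_on_def disjoint_def by blast
  have fV: "finite (verts G)" using G(1) by (simp add: finite_simple_graph_def)
  have adj: "{u, w} \<in> edges G" if "A \<in> Q" "B \<in> Q" "A \<noteq> B" "u \<in> A" "w \<in> B" for u w A B
    unfolding E using that by blast
  have nadj: "{u, w} \<notin> edges G" if "A \<in> Q" "u \<in> A" "w \<in> A" for u w A
  proof
    assume "{u, w} \<in> edges G"
    then obtain u' w' B C where e: "{u, w} = {u', w'}" "B \<in> Q" "C \<in> Q" "B \<noteq> C" "u' \<in> B" "w' \<in> C"
      unfolding E by blast
    have "u' \<in> A" "w' \<in> A" using e(1) that(2,3) by (auto simp: doubleton_eq_iff)
    hence "B = A" "C = A" using disj e that(1) by metis+
    thus False using e(4) by simp
  qed
  show ?thesis using S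
  proof (induction "card S" arbitrary: S p)
    case (Suc k)
    then obtain v where v: "v \<in> S" by fastforce
    have fS: "finite S" using Suc.prems fV finite_subset by blast
    have "edge_free (edges G) (S - {v} - nbrs (edges G) S v)"
    proof -
      obtain A where A: "A \<in> Q" "v \<in> A" using part v Suc.prems by blast
      have "S - {v} - nbrs (edges G) S v \<subseteq> A"
      proof
        fix u assume u: "u \<in> S - {v} - nbrs (edges G) S v"
        then obtain B where "B \<in> Q" "u \<in> B" using part Suc.prems by blast
        moreover have "{u, v} \<notin> edges G" using u by (auto simp: nbrs_def)
        ultimately show "u \<in> A" using adj A by metis
      qed
      thus ?thesis unfolding edge_free_iff using nadj A by blast
    qed
    from ghom_cone_cases[OF fS v this Suc.prems(2)] show ?case
    proof
      assume "\<exists>q. p = Suc q \<and> ghom TYPE('k) (edges G) (S - {v}) q"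
      then obtain q where q: "p = Suc q" "ghom TYPE('k) (edges G) (S - {v}) q" by blast
      have "card (S - {v}) \<le> Suc q"
        using Suc q(2) v fS by (intro Suc.hyps(1)) auto
      thus ?thesis using v fS q by simp
    qed
  qed simp
qed

theorem corollary2p22:
  fixes G :: "'v ugraph"
  assumes "finite_simple_graph G"
    and "(\<exists>n\<ge>3. is_wheel n G)
       \<or> (\<exists>n\<ge>2. is_jahangir2 n G)
       \<or> complete_multipartite G
       \<or> (\<exists>m\<ge>1. \<exists>n\<ge>2. is_fan m n G)"
  shows "subadditive TYPE('k::field) G"
proof (rule subadditive_if_ghom_subadditive[OF assms(1)])
  from assms(2) consider (wheel) n where "is_wheel n G" | (jahangir) n where "is_jahangir2 n G"
    | (multipartite) "complete_multipartite G" | (fan) m n where "is_fan m n G" by blast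
  thus "ghom_subadditive TYPE('k) (edges G) (verts G)"
  proof cases
    case wheel
    then obtain H x where H: "is_cycle_graph n H" "x \<notin> verts H" "G = cone x (verts H) H"
      unfolding is_wheel_def by blast
    have "e \<inter> verts H \<noteq> {}" if "e \<in> edges H" for e
    proof -
      have "e \<subseteq> verts H" "card e = 2"
        using cycle_graph(1)[OF H(1)] that by (auto simp: finite_simple_graph_def)
      thus ?thesis by (metis Int_absorb2 card.empty zero_neq_numeral)
    qed
    hence "vertex_cover (verts H) H" by (simp add: vertex_cover_def)
    thus ?thesis unfolding H(3) by (intro cone_graph(2) cycle_graph[OF H(1)] H(2))
  next
    case jahangir
    then obtain H U x where H: "is_cycle_graph (2 * n) H" "vertex_cover U H" "x \<notin> verts H" "G = cone x U H"
      unfolding is_jahangir2_def by blast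
    thus ?thesis unfolding H(4) by (intro cone_graph(2) cycle_graph[OF H(1)])
  next
    case multipartite
    \<comment> \<open>At most a + b + 1 vertices are covered by the linear bounds a + 1 for a and b
      for b.\<close>
    have "\<exists>s t. card S \<le> s + t \<and> linear_or_ghom TYPE('k) (edges G) (verts G) a s \<and>
        linear_or_ghom TYPE('k) (edges G) (verts G) b t"
      if "S \<subseteq> verts G" "ghom TYPE('k) (edges G) S (a + b)" for S a b
      using complete_multipartite_ghom_card[OF assms(1) multipartite that]
      by (intro exI[of _ "Suc a"] exI[of _ b] conjI linear_or_ghomI1) auto
    thus ?thesis unfolding ghom_subadditive_def by blast
  next
    case fan
    then obtain H xs where "is_path_graph n H" "distinct xs" "set xs \<inter> verts H = {}"
      "G = foldr (\<lambda>x H'. cone x (verts H) H') xs H"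
      unfolding is_fan_def by blast
    from fan_graph[OF this] show ?thesis by blast
  qed
qed

end
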